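(* (Localic, hyperconnected) is a factorisation system on the category $\mathrm{jrCat}$ of join restriction categories and join restriction functors. That is: the class $\mathcal E$ of localic join restriction functors and the class $\mathcal M$ of hyperconnected join restriction functors are each closed under composition with isomorphisms; every join restriction functor factors as a localic functor followed by a hyperconnected one; and for every commuting square $HF=GL$ in $\mathrm{jrCat}$ with $L\colon\mathcal A\to\mathcal B$ localic and $H\colon\mathcal C\to\mathcal D$ hyperconnected (where $F\colon\mathcal A\to\mathcal C$, $G\colon\mathcal B\to\mathcal D$) there is a unique join restriction functor $J\colon\mathcal B\to\mathcal C$ with $JL=F$ and $HJ=G$.
   Context: A restriction category is a category with an operation assigning to each $f\colon A\to B$ a map $\bar f\colon A\to A$ such that $f\bar f=f$; $\bar f\bar g=\bar g\bar f$ and $\overline{g\bar f}=\bar g\bar f$ for $f\colon A\to B$, $g\colon A\to C$; and $\bar g f=f\,\overline{gf}$ for $f\colon A\to B$, $g\colon B\to C$. $\mathcal O(A)$ is the set of restriction idempotents on $A$ (maps $e\colon A\to A$ with $\bar e=e$). For parallel maps, $f\leqslant g$ iff $f=g\bar f$, and $f\smile g$ (compatible) iff $f\bar g=g\bar f$. A join restriction category is a restriction category in which every pairwise-compatible family of parallel maps has a join for $\leqslant$, and these joins are preserved by precomposition. A join restriction functor is a functor with $F\bar f=\overline{Ff}$ which preserves these joins. It is hyperconnected if each induced function $\mathcal O(A)\to\mathcal O(FA)$ is an isomorphism. In a join restriction category any two parallel maps $f,g$ have a meet $f\wedge g$ for $\leqslant$. A join restriction functor $F\colon\mathcal A\to\mathcal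 B$ is localic if it is bijective on objects and (i) $Ff\wedge Fg=F(f\wedge g)$ for all $f,g\in\mathcal A(i,j)$; (ii) $g=\bigvee_{f\in\mathcal A(i,j)}(g\wedge Ff)$ for all $g\in\mathcal B(Fi,Fj)$. *)

theory Defs
  imports "HOL-Library.FuncSet"
begin

section \<open>Categories and restriction categories\<close>

record ('o, 'm) cat =
  Obj :: "'o set"
  Arr :: "'m set"
  Dom :: "'m \<Rightarrow> 'o"
  Cod :: "'m \<Rightarrow> 'o"
  Ide :: "'o \<Rightarrow> 'm"
  Comp :: "'m \<Rightarrow> 'm \<Rightarrow> 'm" (infixl "\<odot>\<index>" 70)

record ('o, 'm) rcat = "('o, 'm) cat" +
  Rst :: "'m \<Rightarrow> 'm"

definition hom :: "('o, 'm, 'x) cat_scheme \<Rightarrow> 'o \<Rightarrow> 'o \<Rightarrow> 'm set" where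
  "hom C i j = {f \<in> Arr C. Dom C f = i \<and> Cod C f = j}"

locale category =
  fixes C :: "('o, 'm, 'x) cat_scheme" (structure)
  assumes Dom_closed: "f \<in> Arr C \<Longrightarrow> Dom C f \<in> Obj C"
    and Cod_closed: "f \<in> Arr C \<Longrightarrow> Cod C f \<in> Obj C"
    and Ide_closed: "i \<in> Obj C \<Longrightarrow> Ide C i \<in> hom C i i"
    and Comp_closed: "\<lbrakk>f \<in> hom C i j; g \<in> hom C j k\<rbrakk> \<Longrightarrow> g \<odot> f \<in> hom C i k"
    and Comp_assoc:
      "\<lbrakk>f \<in> hom C i j; g \<in> hom C j k; h \<in> hom C k l\<rbrakk> \<Longrightarrow> (h \<odot> g) \<odot> f = h \<odot> (g \<odot> f)"
    and Comp_Ide_right: "f \<in> hom C i j \<Longrightarrow> f \<odot> Ide C i = f"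
    and Comp_Ide_left: "f \<in> hom C i j \<Longrightarrow> Ide C j \<odot> f = f"

locale restriction_category = category C for C :: "('o, 'm) rcat" (structure) +
  assumes Rst_closed: "f \<in> hom C i j \<Longrightarrow> Rst C f \<in> hom C i i"
    and Comp_Rst: "f \<in> Arr C \<Longrightarrow> f \<odot> Rst C f = f"
    and Rst_commute:
      "\<lbrakk>f \<in> hom C i j; g \<in> hom C i k\<rbrakk> \<Longrightarrow> Rst C f \<odot> Rst C g = Rst C g \<odot> Rst C f"
    and Rst_Comp_Rst:
      "\<lbrakk>f \<in> hom C i j; g \<in> hom C i k\<rbrakk> \<Longrightarrow> Rst C (g \<odot> Rst C f) = Rst C g \<odot> Rst C f"
    and Rst_Comp:
      "\<lbrakk>f \<in> hom C i j; g \<in> hom C j k\<rbrakk> \<Longrightarrow> Rst C g \<odot> f = f \<odot> Rst C (g \<odot> f)"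

definition rest_idem :: "('o, 'm) rcat \<Rightarrow> 'o \<Rightarrow> 'm set" where
  "rest_idem C i = {e \<in> hom C i i. Rst C e = e}"

definition parallel :: "('o, 'm) rcat \<Rightarrow> 'm \<Rightarrow> 'm \<Rightarrow> bool" where
  "parallel C f g \<longleftrightarrow>
     f \<in> Arr C \<and> g \<in> Arr C \<and> Dom C f = Dom C g \<and> Cod C f = Cod C g"

definition le :: "('o, 'm) rcat \<Rightarrow> 'm \<Rightarrow> 'm \<Rightarrow> bool" where
  "le C f g \<longleftrightarrow> parallel C f g \<and> f = g \<odot>\<^bsub>C\<^esub> Rst C f"

definition compatible :: "('o, 'm) rcat \<Rightarrow> 'm \<Rightarrow> 'm \<Rightarrow> bool" where
  "compatible C f g \<longleftrightarrow> parallel C f g \<and> f \<odot>\<^bsub>C\<^esub> Rst C g = g \<odot>\<^bsub>C\<^esub> Rst C f"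

text \<open>
  A family of parallel maps from i to j is represented by its set of members. The objects i and j
  are parameters because the empty family, whose join is the least map from i to j, is included.
\<close>

definition compatible_family :: "('o, 'm) rcat \<Rightarrow> 'o \<Rightarrow> 'o \<Rightarrow> 'm set \<Rightarrow> bool" where
  "compatible_family C i j S \<longleftrightarrow>
     i \<in> Obj C \<and> j \<in> Obj C \<and> S \<subseteq> hom C i j \<and> (\<forall>f\<in>S. \<forall>g\<in>S. compatible C f g)"

definition is_join :: "('o, 'm) rcat \<Rightarrow> 'o \<Rightarrow> 'o \<Rightarrow> 'm set \<Rightarrow> 'm \<Rightarrow> bool" where
  "is_join C i j S s \<longleftrightarrow>
     S \<subseteq> hom C i j \<and> s \<in> hom C i j \<and> (\<forall>f\<in>S. le C f s) \<and>
     (\<forall>t \<in> hom C i j. (\<forall>f\<in>S. le C f t) \<longrightarrow> le C s t)"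

definition is_meet :: "('o, 'm) rcat \<Rightarrow> 'm \<Rightarrow> 'm \<Rightarrow> 'm \<Rightarrow> bool" where
  "is_meet C f g m \<longleftrightarrow>
     le C m f \<and> le C m g \<and> (\<forall>h. le C h f \<and> le C h g \<longrightarrow> le C h m)"

definition meet :: "('o, 'm) rcat \<Rightarrow> 'm \<Rightarrow> 'm \<Rightarrow> 'm" where
  "meet C f g = (THE m. is_meet C f g m)"

locale join_restriction_category = restriction_category C for C :: "('o, 'm) rcat" (structure) +
  assumes join_exists: "compatible_family C i j S \<Longrightarrow> \<exists>s. is_join C i j S s"
    and join_precomp:
      "\<lbrakk>compatible_family C i j S; is_join C i j S s; h \<in> hom C k i\<rbrakk>
        \<Longrightarrow> is_join C k j ((\<lambda>f. f \<odot> h) ` S) (s \<odot> h)"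
begin

lemma le_antisym:
  assumes "le C f g" "le C g f"
  shows "f = g"
proof -
  obtain i j where ij: "f \<in> hom C i j" "g \<in> hom C i j"
    using assms(1) unfolding le_def parallel_def hom_def by auto
  have fg: "f = g \<odot> Rst C f" and gf: "g = f \<odot> Rst C g"
    using assms unfolding le_def by auto
  have "f = (f \<odot> Rst C g) \<odot> Rst C f"
    using fg by (simp flip: gf)
  also have "\<dots> = f \<odot> (Rst C f \<odot> Rst C g)"
    by (simp add: Comp_assoc[OF Rst_closed[OF ij(1)] Rst_closed[OF ij(2)] ij(1)]
        Rst_commute[OF ij])
  also have "\<dots> = (f \<odot> Rst C f) \<odot> Rst C g"
    by (simp add: Comp_assoc[OF Rst_closed[OF ij(2)] Rst_closed[OF ij(1)] ij(1)])
  also have "\<dots> = g"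
    using ij(1) Comp_Rst[of f] by (simp add: hom_def flip: gf)
  finally show ?thesis .
qed

lemma le_imp_compatible:
  assumes "le C h f" "le C k f"
  shows "compatible C h k"
proof -
  obtain i j where ij: "f \<in> hom C i j" "h \<in> hom C i j" "k \<in> hom C i j"
    using assms unfolding le_def parallel_def hom_def by auto
  have h: "h = f \<odot> Rst C h" and k: "k = f \<odot> Rst C k"
    using assms unfolding le_def by auto
  have "h \<odot> Rst C k = f \<odot> (Rst C h \<odot> Rst C k)"
    using Comp_assoc[OF Rst_closed[OF ij(3)] Rst_closed[OF ij(2)] ij(1)] by (simp flip: h)
  also have "\<dots> = f \<odot> (Rst C k \<odot> Rst C h)"
    using Rst_commute[OF ij(2,3)] by simp
  also have "\<dots> = k \<odot> Rst C h"
    using Comp_assoc[OF Rst_closed[OF ij(2)] Rst_closed[OF ij(3)] ij(1)] by (simp flip: k)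
  finally show ?thesis
    using ij unfolding compatible_def parallel_def hom_def by auto
qed

lemma is_meet_meet:
  assumes "parallel C f g"
  shows "is_meet C f g (meet C f g)"
proof -
  define S where "S = {h. le C h f \<and> le C h g}"
  let ?i = "Dom C f" and ?j = "Cod C f"
  have fg: "f \<in> hom C ?i ?j" "g \<in> hom C ?i ?j"
    using assms unfolding parallel_def hom_def by auto
  have "compatible_family C ?i ?j S"
    unfolding compatible_family_def
    using fg Dom_closed Cod_closed le_imp_compatible
    by (auto simp: S_def hom_def le_def parallel_def)
  then obtain s where s: "is_join C ?i ?j S s"
    using join_exists by blast
  have "is_meet C f g s"
    using s fg unfolding is_meet_def is_join_def S_def by blast
  moreover have "m = s" if "is_meet C f g m" for m
    using that calculation le_antisym unfolding is_meet_def by blast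
  ultimately show ?thesis
    unfolding meet_def by (rule theI)
qed

end

section \<open>Join restriction functors\<close>

record ('o, 'm, 'p, 'n) ftor =
  omap :: "'o \<Rightarrow> 'p"
  amap :: "'m \<Rightarrow> 'n"

text \<open>
  The two components of a functor are required to be extensional (undefined outside the objects,
  respectively arrows, of the source), so that functors from A to B agreeing on A are equal in HOL.
\<close>

definition cat_functor ::
  "('o, 'm, 'x) cat_scheme \<Rightarrow> ('p, 'n, 'y) cat_scheme \<Rightarrow> ('o, 'm, 'p, 'n) ftor \<Rightarrow> bool" where
  "cat_functor A B F \<longleftrightarrow>
     category A \<and> category B \<and>
     omap F \<in> Obj A \<rightarrow>\<^sub>E Obj B \<and>
     amap F \<in> Arr A \<rightarrow>\<^sub>E Arr B \<and>
     (\<forall>f \<in> Arr A. Dom B (amap F f) = omap F (Dom A f)) \<and>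
     (\<forall>f \<in> Arr A. Cod B (amap F f) = omap F (Cod A f)) \<and>
     (\<forall>i \<in> Obj A. amap F (Ide A i) = Ide B (omap F i)) \<and>
     (\<forall>f \<in> Arr A. \<forall>g \<in> Arr A. Dom A g = Cod A f \<longrightarrow>
        amap F (g \<odot>\<^bsub>A\<^esub> f) = amap F g \<odot>\<^bsub>B\<^esub> amap F f)"

definition jr_functor ::
  "('o, 'm) rcat \<Rightarrow> ('p, 'n) rcat \<Rightarrow> ('o, 'm, 'p, 'n) ftor \<Rightarrow> bool" where
  "jr_functor A B F \<longleftrightarrow>
     join_restriction_category A \<and> join_restriction_category B \<and>
     cat_functor A B F \<and>
     (\<forall>f \<in> Arr A. amap F (Rst A f) = Rst B (amap F f)) \<and>
     (\<forall>i j S s. compatible_family A i j S \<and> is_join A i j S s \<longrightarrow>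
        is_join B (omap F i) (omap F j) (amap F ` S) (amap F s))"

definition id_ftor :: "('o, 'm) rcat \<Rightarrow> ('o, 'm, 'o, 'm) ftor" where
  "id_ftor A = \<lparr>omap = restrict id (Obj A), amap = restrict id (Arr A)\<rparr>"

text \<open>The argument A is the source of F, to which the composite is restricted.\<close>

definition comp_ftor ::
  "('o, 'm) rcat \<Rightarrow> ('p, 'n, 'q, 'k) ftor \<Rightarrow> ('o, 'm, 'p, 'n) ftor \<Rightarrow> ('o, 'm, 'q, 'k) ftor" where
  "comp_ftor A G F =
     \<lparr>omap = restrict (omap G \<circ> omap F) (Obj A), amap = restrict (amap G \<circ> amap F) (Arr A)\<rparr>"

definition jr_iso ::
  "('o, 'm) rcat \<Rightarrow> ('p, 'n) rcat \<Rightarrow> ('o, 'm, 'p, 'n) ftor \<Rightarrow> bool" where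
  "jr_iso A B F \<longleftrightarrow>
     jr_functor A B F \<and>
     (\<exists>G. jr_functor B A G \<and> comp_ftor A G F = id_ftor A \<and> comp_ftor B F G = id_ftor B)"

definition hyperconnected ::
  "('o, 'm) rcat \<Rightarrow> ('p, 'n) rcat \<Rightarrow> ('o, 'm, 'p, 'n) ftor \<Rightarrow> bool" where
  "hyperconnected A B F \<longleftrightarrow>
     jr_functor A B F \<and>
     (\<forall>i \<in> Obj A.
        bij_betw (amap F) (rest_idem A i) (rest_idem B (omap F i)) \<and>
        (\<forall>d \<in> rest_idem A i. \<forall>e \<in> rest_idem A i.
           le A d e \<longleftrightarrow> le B (amap F d) (amap F e)))"

definition localic ::
  "('o, 'm) rcat \<Rightarrow> ('p, 'n) rcat \<Rightarrow> ('o, 'm, 'p, 'n) ftor \<Rightarrow> bool" where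
  "localic A B F \<longleftrightarrow>
     jr_functor A B F \<and>
     bij_betw (omap F) (Obj A) (Obj B) \<and>
     (\<forall>i \<in> Obj A. \<forall>j \<in> Obj A.
        (\<forall>f \<in> hom A i j. \<forall>g \<in> hom A i j.
           meet B (amap F f) (amap F g) = amap F (meet A f g)) \<and>
        (\<forall>g \<in> hom B (omap F i) (omap F j).
           is_join B (omap F i) (omap F j) ((\<lambda>f. meet B g (amap F f)) ` hom A i j) g))"

end

(*
  In a join restriction category the restriction idempotents O(i) on an object form a frame, and
  two parallel maps f, g agree on a largest open [f = g], the restriction of their meet. If L is
  localic, a map b from L i to L j is glued from the maps L f over the opens [b = L f].

  Orthogonality: H identifies O(F i) with O(H F i) = O(G L i), so the opens G [b = L f] transport
  to opens of F i, and J b is the gluing of the maps F f over these.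

  Factorisation of F as H L: since O(L i) must be O(F i), a map b from L i to L j is determined by
  the opens e f = [b = L f] of F i, for f in A(i, j). The families e that arise are those for which
  the meet of e f and e g lies below [f = g] and the meet of e f and [f = g] lies below e g, where
  [f = g] stands for F applied to the region of agreement in A. These families are the arrows of
  the intermediate category. Composition is multiplication of matrices: b acts by the matrix whose
  (x, h) entry is [b L x = L h], for x in A(k, i) and h in A(k, j).

  Inequalities between opens are proved in forcing style: w <= SUP U is used by passing to a
  smaller v below a member of U.
*)

theory Submission
  imports Defs
begin

section \<open>Restriction categories\<close>

text \<open>\<open>F\<close> preserves meets of opens but not meets of arbitrary parallel maps, so
  \<open>F f\<close> and \<open>F g\<close> may agree on more than the image of [f = g]. A localic
  left factor has to preserve meets, so agreement in the intermediate category must be dictated by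
  \<open>A\<close>. This is why its arrows cannot be arrows of \<open>B\<close>, and why gluing a
  family \<open>e\<close> to an arrow of \<open>B\<close> is injective on opens but not in general.
  The same failure shapes the orthogonality argument: the overlap of [b = L f] and [b = L g] is
  computed in \<open>B\<close>, where it lies in L [f = g], and only then carried to the opens of
  \<open>F i\<close>. Matrix entries are needed because an arrow h in A(i, k) need not be of the
  form g f with f in A(i, j). A composite is known directly at the arrows g f, and the regions
  [g f = h] carry its values to all other h. Frame distributivity and stability of joins under
  inverse image are both instances of preservation of joins by precomposition, an open being itself
  a map. The forcing style packs them into elimination rules.\<close>

text \<open>Below, \<open>eqz C f g\<close> is the open written [f = g] above.\<close>

definition pull :: "('o, 'm) rcat \<Rightarrow> 'm \<Rightarrow> 'm \<Rightarrow> 'm" where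
  "pull C f u = Rst C (u \<odot>\<^bsub>C\<^esub> f)"

definition eqz :: "('o, 'm) rcat \<Rightarrow> 'm \<Rightarrow> 'm \<Rightarrow> 'm" where
  "eqz C f g = Rst C (meet C f g)"

text \<open>The object \<open>i\<close> is a parameter because the join of the empty set is the
  least open of \<open>i\<close>. In a join restriction category the \<open>THE\<close> is
  meaningful for every set of opens of an object, by \<open>is_join_osup\<close>.\<close>

definition osup :: "('o, 'm) rcat \<Rightarrow> 'o \<Rightarrow> 'm set \<Rightarrow> 'm" where
  "osup C i U = (THE u. is_join C i i U u)"

lemma (in category) hom_Obj:
  assumes "f \<in> hom C i j"
  shows "i \<in> Obj C" "j \<in> Obj C"
  using assms Dom_closed Cod_closed by (auto simp: hom_def)

lemma hom_Arr: "f \<in> hom C i j \<Longrightarrow> f \<in> Arr C"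
  by (simp add: hom_def)

lemma Arr_hom: "f \<in> Arr C \<Longrightarrow> f \<in> hom C (Dom C f) (Cod C f)"
  by (simp add: hom_def)

lemma le_hom: "le C f g \<Longrightarrow> f \<in> hom C i j \<longleftrightarrow> g \<in> hom C i j"
  by (auto simp: le_def parallel_def hom_def)

lemma le_eq: "le C f g \<Longrightarrow> g \<odot>\<^bsub>C\<^esub> Rst C f = f"
  by (simp add: le_def)

lemma leI: "f \<in> hom C i j \<Longrightarrow> g \<in> hom C i j \<Longrightarrow> g \<odot>\<^bsub>C\<^esub> Rst C f = f \<Longrightarrow> le C f g"
  by (auto simp: le_def parallel_def hom_def)

lemma idem_hom: "u \<in> rest_idem C i \<Longrightarrow> u \<in> hom C i i"
  by (simp add: rest_idem_def)

lemma idem_Rst: "u \<in> rest_idem C i \<Longrightarrow> Rst C u = u"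
  by (simp add: rest_idem_def)

context restriction_category
begin

lemma Comp_Rst_hom: "f \<in> hom C i j \<Longrightarrow> f \<odot> Rst C f = f"
  by (simp add: Comp_Rst hom_def)

lemma Ide_idem:
  assumes "i \<in> Obj C"
  shows "Ide C i \<in> rest_idem C i"
proof -
  have h: "Ide C i \<in> hom C i i"
    by (rule Ide_closed[OF assms])
  have "Rst C (Ide C i) = Ide C i"
    using Comp_Ide_left[OF Rst_closed[OF h]] Comp_Rst_hom[OF h] by simp
  with h show ?thesis by (simp add: rest_idem_def)
qed

lemma Rst_idem:
  assumes f: "f \<in> hom C i j"
  shows "Rst C f \<in> rest_idem C i"
proof -
  have i: "Ide C i \<in> hom C i i" "Rst C (Ide C i) = Ide C i"
    using Ide_idem hom_Obj[OF f] by (auto simp: rest_idem_def)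
  have "Rst C (Rst C f) = Rst C f"
    using Rst_Comp_Rst[OF f i(1)] Comp_Ide_left[OF Rst_closed[OF f]] i(2) by simp
  with Rst_closed[OF f] show ?thesis by (simp add: rest_idem_def)
qed

lemma idem_commute:
  assumes "u \<in> rest_idem C i" "v \<in> rest_idem C i"
  shows "u \<odot> v = v \<odot> u"
  using Rst_commute[of u i i v i] assms by (simp add: rest_idem_def)

lemma Rst_comp_idem:
  assumes "f \<in> hom C i j" "u \<in> rest_idem C i"
  shows "Rst C (f \<odot> u) = Rst C f \<odot> u"
  using Rst_Comp_Rst[OF idem_hom[OF assms(2)] assms(1)] idem_Rst[OF assms(2)] by simp

lemma idem_comp:
  assumes "u \<in> rest_idem C i" "v \<in> rest_idem C i"
  shows "u \<odot> v \<in> rest_idem C i"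
  using Comp_closed[OF idem_hom[OF assms(2)] idem_hom[OF assms(1)]]
    Rst_comp_idem[OF idem_hom[OF assms(1)] assms(2)] idem_Rst[OF assms(1)]
  by (simp add: rest_idem_def)

lemma le_refl: "f \<in> hom C i j \<Longrightarrow> le C f f"
  by (rule leI) (auto simp: Comp_Rst_hom)

lemma comp_idem_le:
  assumes f: "f \<in> hom C i j" and u: "u \<in> rest_idem C i"
  shows "le C (f \<odot> u) f"
proof (rule leI[OF Comp_closed[OF idem_hom[OF u] f] f])
  show "f \<odot> Rst C (f \<odot> u) = f \<odot> u"
    using Comp_assoc[OF idem_hom[OF u] Rst_closed[OF f] f]
      Rst_comp_idem[OF f u] Comp_Rst_hom[OF f] by metis
qed

lemma le_Rst:
  assumes fg: "le C f g" and g: "g \<in> hom C i j"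
  shows "le C (Rst C f) (Rst C g)"
proof -
  have f: "f \<in> hom C i j" using le_hom[OF fg] g by simp
  have "Rst C f = Rst C g \<odot> Rst C f"
    using Rst_comp_idem[OF g Rst_idem[OF f]] le_eq[OF fg] by simp
  then show ?thesis
    by (intro leI[OF Rst_closed[OF f] Rst_closed[OF g]]) (simp add: idem_Rst[OF Rst_idem[OF f]])
qed

lemma idem_le_iff:
  assumes "u \<in> rest_idem C i" "v \<in> rest_idem C i"
  shows "le C u v \<longleftrightarrow> v \<odot> u = u"
  using leI[OF idem_hom idem_hom, OF assms] le_eq[of C u v] idem_Rst[OF assms(1)] by auto

lemma le_trans:
  assumes fg: "le C f g" and gh: "le C g h"
  shows "le C f h"
proof -
  obtain i j where h: "h \<in> hom C i j"
    using gh by (auto simp: le_def parallel_def hom_def)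
  then have g: "g \<in> hom C i j" and f: "f \<in> hom C i j"
    using le_hom[OF gh] le_hom[OF fg] by auto
  have "h \<odot> Rst C f = h \<odot> (Rst C g \<odot> Rst C f)"
    using le_eq[OF le_Rst[OF fg g]] idem_Rst[OF Rst_idem[OF f]] by simp
  also have "\<dots> = (h \<odot> Rst C g) \<odot> Rst C f"
    using Comp_assoc[OF Rst_closed[OF f] Rst_closed[OF g] h] by simp
  also have "\<dots> = f"
    using le_eq[OF gh] le_eq[OF fg] by simp
  finally show ?thesis by (rule leI[OF f h])
qed

lemma le_idem:
  assumes "le C u v" "v \<in> rest_idem C i"
  shows "u \<in> rest_idem C i"
proof -
  have h: "u \<in> hom C i i"
    using le_hom[OF assms(1)] idem_hom[OF assms(2)] by simp
  show ?thesis
    using idem_comp[OF assms(2) Rst_idem[OF h]] le_eq[OF assms(1)] by simp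
qed

lemma le_comp_right:
  assumes fg: "le C f g" and g: "g \<in> hom C i j" and h: "h \<in> hom C k i"
  shows "le C (f \<odot> h) (g \<odot> h)"
proof -
  have f: "f \<in> hom C i j" using le_hom[OF fg] g by simp
  have "f \<odot> h = g \<odot> (Rst C f \<odot> h)"
    using Comp_assoc[OF h Rst_closed[OF f] g] le_eq[OF fg] by simp
  also have "\<dots> = (g \<odot> h) \<odot> Rst C (f \<odot> h)"
    using Comp_assoc[OF Rst_closed[OF Comp_closed[OF h f]] h g] Rst_Comp[OF h f] by simp
  finally show ?thesis
    by (intro leI[OF Comp_closed[OF h f] Comp_closed[OF h g]]) simp
qed

text \<open>A map below \<open>g\<close> is \<open>g\<close> cut down to its own domain, so equality
  of comparable maps is a question about opens. Recognising a join in \<open>is_joinI\<close> comes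
  down to this.\<close>

lemma Rst_eq_imp_eq:
  assumes "le C f g" "g \<in> hom C i j" "le C (Rst C g) (Rst C f)"
  shows "f = g"
proof -
  have f: "f \<in> hom C i j" using le_hom[OF assms(1)] assms(2) by simp
  have "Rst C g \<odot> Rst C f = Rst C f" "Rst C f \<odot> Rst C g = Rst C g"
    using le_Rst[OF assms(1,2)] assms(3) idem_le_iff[OF Rst_idem[OF f] Rst_idem[OF assms(2)]]
      idem_le_iff[OF Rst_idem[OF assms(2)] Rst_idem[OF f]] by auto
  then have "Rst C f = Rst C g"
    using Rst_commute[OF f assms(2)] by metis
  then show ?thesis
    using le_eq[OF assms(1)] Comp_Rst_hom[OF assms(2)] by metis
qed

lemma Rst_comp_le:
  assumes f: "f \<in> hom C i j" and g: "g \<in> hom C j k"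
  shows "le C (Rst C (g \<odot> f)) (Rst C f)"
proof -
  have "Rst C (g \<odot> f) \<odot> Rst C f = Rst C (g \<odot> f)"
    using Rst_comp_idem[OF Comp_closed[OF f g] Rst_idem[OF f]]
      Comp_assoc[OF Rst_closed[OF f] f g] Comp_Rst_hom[OF f] by metis
  then show ?thesis
    using idem_le_iff[OF Rst_idem[OF Comp_closed[OF f g]] Rst_idem[OF f]]
      Rst_commute[OF f Comp_closed[OF f g]] by simp
qed

lemma Rst_comp_Rst_left:
  assumes f: "f \<in> hom C i j" and g: "g \<in> hom C j k"
  shows "Rst C (Rst C g \<odot> f) = Rst C (g \<odot> f)"
  using Rst_comp_idem[OF f Rst_idem[OF Comp_closed[OF f g]]] Rst_Comp[OF f g]
    Rst_comp_le[OF f g] idem_le_iff[OF Rst_idem[OF Comp_closed[OF f g]] Rst_idem[OF f]] by metis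

lemma Rst_comp_of_idem_le:
  assumes f: "f \<in> hom C i j" and u: "le C u (Rst C f)"
  shows "Rst C (f \<odot> u) = u"
  using Rst_comp_idem[OF f le_idem[OF u Rst_idem[OF f]]] le_eq[OF u]
    idem_Rst[OF le_idem[OF u Rst_idem[OF f]]] by metis

lemma idem_le_Ide:
  assumes "u \<in> rest_idem C i"
  shows "le C u (Ide C i)"
  using assms hom_Obj[OF idem_hom[OF assms]] Ide_idem Comp_Ide_left[OF idem_hom[OF assms]]
  by (simp add: idem_le_iff)

lemma le_idem_comp_iff:
  assumes u: "u \<in> rest_idem C i" and v: "v \<in> rest_idem C i"
  shows "le C w (u \<odot> v) \<longleftrightarrow> le C w u \<and> le C w v"
proof
  have uv: "le C (u \<odot> v) u" "le C (u \<odot> v) v"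
    using comp_idem_le[OF idem_hom[OF u] v] comp_idem_le[OF idem_hom[OF v] u]
      idem_commute[OF u v] by auto
  show "le C w u \<and> le C w v" if "le C w (u \<odot> v)"
    using that uv le_trans by blast
  assume a: "le C w u \<and> le C w v"
  then have w: "w \<in> rest_idem C i" using le_idem u by blast
  show "le C w (u \<odot> v)"
    using a Comp_assoc[OF idem_hom[OF w] idem_hom[OF v] idem_hom[OF u]] u v w
    by (simp add: idem_le_iff idem_comp)
qed

lemma eq_on_le:
  assumes e: "f \<odot> u = g \<odot> u" and vu: "le C v u" and u: "u \<in> rest_idem C i"
    and f: "f \<in> hom C i j" and g: "g \<in> hom C i j"
  shows "f \<odot> v = g \<odot> v"
proof -
  have v: "v \<in> rest_idem C i" by (rule le_idem[OF vu u])
  have uv: "u \<odot> v = v" using vu u v by (simp add: idem_le_iff)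
  show ?thesis
    using Comp_assoc[OF idem_hom[OF v] idem_hom[OF u] f]
      Comp_assoc[OF idem_hom[OF v] idem_hom[OF u] g] e uv by metis
qed

section \<open>Inverse images of opens along maps\<close>

lemma pull_idem:
  "f \<in> hom C i j \<Longrightarrow> u \<in> rest_idem C j \<Longrightarrow> pull C f u \<in> rest_idem C i"
  unfolding pull_def by (rule Rst_idem[OF Comp_closed[OF _ idem_hom]])

text \<open>By \<open>Rst_Comp\<close>, \<open>u \<odot> f\<close> is \<open>f\<close> restricted to
  the inverse image of \<open>u\<close>, so lying in that inverse image becomes an equation saying
  that \<open>f\<close> maps \<open>w\<close> into \<open>u\<close>. From this equation come
  stability under meets (\<open>le_pull_comp_iff\<close>) and under replacing \<open>f\<close> by a
  map that coincides with it on \<open>w\<close> (\<open>le_pull_cong\<close>).\<close>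

lemma le_pull_iff:
  assumes f: "f \<in> hom C i j" and u: "u \<in> rest_idem C j"
  shows "le C w (pull C f u) \<longleftrightarrow> le C w (Rst C f) \<and> u \<odot> (f \<odot> w) = f \<odot> w"
proof
  note uf = Comp_closed[OF f idem_hom[OF u]]
  have e: "u \<odot> f = f \<odot> Rst C (u \<odot> f)"
    using Rst_Comp[OF f idem_hom[OF u]] idem_Rst[OF u] by simp
  show "le C w (Rst C f) \<and> u \<odot> (f \<odot> w) = f \<odot> w" if w: "le C w (pull C f u)"
  proof
    show "le C w (Rst C f)"
      using le_trans[OF w] Rst_comp_le[OF f idem_hom[OF u]] by (simp add: pull_def)
    have wi: "w \<in> rest_idem C i" by (rule le_idem[OF w pull_idem[OF f u]])
    have "f \<odot> w = f \<odot> (Rst C (u \<odot> f) \<odot> w)"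
      using w idem_le_iff[OF wi pull_idem[OF f u]] by (simp add: pull_def)
    also have "\<dots> = (u \<odot> f) \<odot> w"
      using Comp_assoc[OF idem_hom[OF wi] Rst_closed[OF uf] f] e by simp
    also have "\<dots> = u \<odot> (f \<odot> w)"
      by (rule Comp_assoc[OF idem_hom[OF wi] f idem_hom[OF u]])
    finally show "u \<odot> (f \<odot> w) = f \<odot> w" by simp
  qed
  assume a: "le C w (Rst C f) \<and> u \<odot> (f \<odot> w) = f \<odot> w"
  then have wi: "w \<in> rest_idem C i" using le_idem Rst_idem[OF f] by blast
  have "pull C f u \<odot> w = Rst C ((u \<odot> f) \<odot> w)"
    unfolding pull_def using Rst_comp_idem[OF uf wi] by simp
  also have "\<dots> = Rst C (f \<odot> w)"
    using a Comp_assoc[OF idem_hom[OF wi] f idem_hom[OF u]] by simp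
  also have "\<dots> = w" using Rst_comp_of_idem_le[OF f] a by simp
  finally show "le C w (pull C f u)"
    using idem_le_iff[OF wi pull_idem[OF f u]] by simp
qed

lemma pull_comp:
  assumes f: "f \<in> hom C i j" and g: "g \<in> hom C j k" and u: "u \<in> rest_idem C k"
  shows "pull C (g \<odot> f) u = pull C f (pull C g u)"
  using Rst_comp_Rst_left[OF f Comp_closed[OF g idem_hom[OF u]]] Comp_assoc[OF f g idem_hom[OF u]]
  by (simp add: pull_def)

lemma pull_mono:
  assumes "le C u v" "v \<in> rest_idem C j" "f \<in> hom C i j"
  shows "le C (pull C f u) (pull C f v)"
  unfolding pull_def
  using le_Rst[OF le_comp_right[OF assms(1) idem_hom[OF assms(2)] assms(3)]
      Comp_closed[OF assms(3) idem_hom[OF assms(2)]]] .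

lemma le_pull_comp_iff:
  assumes f: "f \<in> hom C i j" and u: "u \<in> rest_idem C j" and v: "v \<in> rest_idem C j"
  shows "le C w (pull C f (u \<odot> v)) \<longleftrightarrow> le C w (pull C f u) \<and> le C w (pull C f v)"
proof
  assume "le C w (pull C f (u \<odot> v))"
  moreover have "le C (u \<odot> v) u" "le C (u \<odot> v) v"
    using le_idem_comp_iff[OF u v] le_refl[OF idem_hom[OF idem_comp[OF u v]]] by auto
  ultimately show "le C w (pull C f u) \<and> le C w (pull C f v)"
    using pull_mono[OF _ u f] pull_mono[OF _ v f] le_trans by blast
next
  assume a: "le C w (pull C f u) \<and> le C w (pull C f v)"
  then have w: "w \<in> hom C i i"
    by (meson le_idem pull_idem[OF f u] idem_hom)
  show "le C w (pull C f (u \<odot> v))"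
    using a le_pull_iff[OF f u] le_pull_iff[OF f v] le_pull_iff[OF f idem_comp[OF u v]]
      Comp_assoc[OF Comp_closed[OF w f] idem_hom[OF v] idem_hom[OF u]] by metis
qed

lemma pull_Rst: "f \<in> hom C i j \<Longrightarrow> g \<in> hom C j k \<Longrightarrow> pull C f (Rst C g) = Rst C (g \<odot> f)"
  by (simp add: pull_def Rst_comp_Rst_left)

lemma pull_Ide: "u \<in> rest_idem C i \<Longrightarrow> pull C (Ide C i) u = u"
  by (simp add: pull_def Comp_Ide_right[OF idem_hom] idem_Rst)

lemma pull_le_Rst: "f \<in> hom C i j \<Longrightarrow> u \<in> rest_idem C j \<Longrightarrow> le C (pull C f u) (Rst C f)"
  unfolding pull_def by (rule Rst_comp_le[OF _ idem_hom])

lemma le_pull_cong: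
  assumes f: "f \<in> hom C i j" and g: "g \<in> hom C i j" and u: "u \<in> rest_idem C j"
    and w: "le C w (pull C f u)" and e: "f \<odot> w = g \<odot> w"
  shows "le C w (pull C g u)"
proof -
  have wf: "le C w (Rst C f)" and uw: "u \<odot> (f \<odot> w) = f \<odot> w"
    using w le_pull_iff[OF f u] by auto
  have wi: "w \<in> rest_idem C i" using le_idem[OF wf Rst_idem[OF f]] .
  have "Rst C g \<odot> w = w"
    using Rst_comp_of_idem_le[OF f wf] e Rst_comp_idem[OF g wi] by metis
  then have "le C w (Rst C g)" using idem_le_iff[OF wi Rst_idem[OF g]] by simp
  then show ?thesis using le_pull_iff[OF g u] uw e by simp
qed

lemma compatible_iff:
  assumes f: "f \<in> hom C i j" and g: "g \<in> hom C i j"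
  shows "compatible C f g \<longleftrightarrow> f \<odot> Rst C g = g \<odot> Rst C f"
  using f g by (simp add: compatible_def parallel_def hom_def)

end

section \<open>Joins and regions of agreement\<close>

context join_restriction_category
begin

lemma is_join_unique:
  assumes "is_join C i j S s" "is_join C i j S t"
  shows "s = t"
  using assms le_antisym unfolding is_join_def by blast

lemma is_join_family:
  assumes "is_join C i j S s"
  shows "compatible_family C i j S"
proof -
  have s: "s \<in> hom C i j" using assms by (simp add: is_join_def)
  show ?thesis
    using assms hom_Obj[OF s] le_imp_compatible
    unfolding compatible_family_def is_join_def by blast
qed

text \<open>Opens all lie below the identity and are therefore pairwise compatible, so every set of
  opens has a join.\<close>

lemma is_join_osup:
  assumes U: "U \<subseteq> rest_idem C i" and i: "i \<in> Obj C"
  shows "is_join C i i U (osup C i U)"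
proof -
  have "compatible_family C i i U"
    unfolding compatible_family_def
  proof (intro conjI ballI i subsetI)
    show "u \<in> hom C i i" if "u \<in> U" for u
      using idem_hom[OF subsetD[OF U that]] .
    fix u v assume "u \<in> U" "v \<in> U"
    then have "u \<in> rest_idem C i" "v \<in> rest_idem C i" using U by auto
    then show "compatible C u v"
      by (intro le_imp_compatible[of u "Ide C i"] idem_le_Ide)
  qed
  then obtain s where s: "is_join C i i U s"
    using join_exists by blast
  show ?thesis
    unfolding osup_def using is_join_unique[OF _ s] s by (rule theI[rotated])
qed

lemma osup_idem:
  assumes U: "U \<subseteq> rest_idem C i" and i: "i \<in> Obj C"
  shows "osup C i U \<in> rest_idem C i"
proof -
  have "le C (osup C i U) (Ide C i)"
    using is_join_osup[OF assms] U idem_le_Ide Ide_closed[OF i] unfolding is_join_def by blast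
  then show ?thesis using le_idem Ide_idem[OF i] by blast
qed

lemma osup_upper:
  "u \<in> U \<Longrightarrow> U \<subseteq> rest_idem C i \<Longrightarrow> i \<in> Obj C \<Longrightarrow> le C u (osup C i U)"
  using is_join_osup[of U i] by (simp add: is_join_def)

lemma osup_least:
  assumes "U \<subseteq> rest_idem C i" "v \<in> rest_idem C i" "\<And>u. u \<in> U \<Longrightarrow> le C u v"
  shows "le C (osup C i U) v"
  using is_join_osup[OF assms(1) hom_Obj(1)[OF idem_hom[OF assms(2)]]] assms(3)
    idem_hom[OF assms(2)] by (simp add: is_join_def)

text \<open>Let \<open>d\<close> be the join of the domains. Cutting \<open>s\<close> down to
  \<open>d\<close> still leaves an upper bound of \<open>S\<close>, so \<open>s\<close> lies below
  \<open>s \<odot> d\<close> and its domain below \<open>d\<close>.\<close>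

lemma Rst_join:
  assumes s: "is_join C i j S s"
  shows "Rst C s = osup C i (Rst C ` S)"
proof -
  have sh: "s \<in> hom C i j" and S: "S \<subseteq> hom C i j" and up: "\<And>f. f \<in> S \<Longrightarrow> le C f s"
    using s by (auto simp: is_join_def)
  note i = hom_Obj(1)[OF sh]
  have RS: "Rst C ` S \<subseteq> rest_idem C i" using S Rst_idem by blast
  define d where "d = osup C i (Rst C ` S)"
  have d: "d \<in> rest_idem C i" unfolding d_def by (rule osup_idem[OF RS i])
  have sd: "s \<odot> d \<in> hom C i j" by (rule Comp_closed[OF idem_hom[OF d] sh])
  have "le C f (s \<odot> d)" if f: "f \<in> S" for f
  proof -
    have fh: "f \<in> hom C i j" using S f by blast
    have "le C (Rst C f) d" unfolding d_def using osup_upper[OF _ RS i] f by blast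
    then have "d \<odot> Rst C f = Rst C f" using idem_le_iff[OF Rst_idem[OF fh] d] by simp
    then have "(s \<odot> d) \<odot> Rst C f = f"
      using Comp_assoc[OF Rst_closed[OF fh] idem_hom[OF d] sh] le_eq[OF up[OF f]] by simp
    then show ?thesis by (rule leI[OF fh sd])
  qed
  then have "le C s (s \<odot> d)" using s sd unfolding is_join_def by blast
  from le_Rst[OF this sd] have 1: "le C (Rst C s) d"
    using Rst_comp_idem[OF sh d] le_idem_comp_iff[OF Rst_idem[OF sh] d] by simp
  have 2: "le C d (Rst C s)"
    unfolding d_def using osup_least[OF RS Rst_idem[OF sh]] le_Rst[OF up sh] by blast
  show ?thesis using le_antisym[OF 1 2] by (simp add: d_def)
qed

text \<open>Precomposition with \<open>f\<close> preserves the join, and \<open>Rst_join\<close>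
  turns a join of maps into the join of their domains.\<close>

lemma pull_osup:
  assumes f: "f \<in> hom C k i" and U: "U \<subseteq> rest_idem C i"
  shows "pull C f (osup C i U) = osup C k (pull C f ` U)"
proof -
  note j = is_join_osup[OF U hom_Obj(2)[OF f]]
  have "pull C f (osup C i U) = osup C k (Rst C ` (\<lambda>u. u \<odot> f) ` U)"
    unfolding pull_def by (rule Rst_join[OF join_precomp[OF is_join_family[OF j] j f]])
  also have "Rst C ` (\<lambda>u. u \<odot> f) ` U = pull C f ` U"
    by (auto simp: pull_def image_iff)
  finally show ?thesis .
qed

text \<open>The infinite distributive law of a frame: composition of opens is their meet, so this is
  the case of \<open>join_precomp\<close> in which the map is the open \<open>w\<close>.\<close>

lemma osup_comp:
  assumes U: "U \<subseteq> rest_idem C i" and w: "w \<in> rest_idem C i"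
  shows "osup C i U \<odot> w = osup C i ((\<lambda>u. u \<odot> w) ` U)"
proof -
  note i = hom_Obj(1)[OF idem_hom[OF w]]
  note j = is_join_osup[OF U i]
  have "(\<lambda>u. u \<odot> w) ` U \<subseteq> rest_idem C i" using U w idem_comp by blast
  from is_join_osup[OF this i] show ?thesis
    using join_precomp[OF is_join_family[OF j] j idem_hom[OF w]] is_join_unique by blast
qed

text \<open>By distributivity \<open>w\<close> is the join of its meets with the members of
  \<open>U\<close>, and \<open>step\<close> is applied to each of these meets.\<close>

lemma osup_elim:
  assumes w: "le C w (osup C i U)" and U: "U \<subseteq> rest_idem C i" and z: "z \<in> rest_idem C i"
    and step: "\<And>v u. le C v w \<Longrightarrow> u \<in> U \<Longrightarrow> le C v u \<Longrightarrow> le C v z"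
  shows "le C w z"
proof -
  note i = hom_Obj(1)[OF idem_hom[OF z]]
  have wi: "w \<in> rest_idem C i" by (rule le_idem[OF w osup_idem[OF U i]])
  have "w = osup C i ((\<lambda>u. u \<odot> w) ` U)"
    using osup_comp[OF U wi] w idem_le_iff[OF wi osup_idem[OF U i]] by simp
  moreover have "le C (osup C i ((\<lambda>u. u \<odot> w) ` U)) z"
  proof (rule osup_least[OF _ z])
    show "(\<lambda>u. u \<odot> w) ` U \<subseteq> rest_idem C i" using U wi idem_comp by blast
    fix v assume "v \<in> (\<lambda>u. u \<odot> w) ` U"
    then obtain u where u: "u \<in> U" "v = u \<odot> w" by blast
    then have ui: "u \<in> rest_idem C i" using U by blast
    have "le C v v" using u(2) le_refl[OF idem_hom[OF idem_comp[OF ui wi]]] by simp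
    then have "le C v u \<and> le C v w" using le_idem_comp_iff[OF ui wi] u(2) by simp
    then show "le C v z" using step[of v u] u(1) by simp
  qed
  ultimately show ?thesis by simp
qed

lemma pull_osup_elim:
  assumes w: "le C w (pull C f (osup C i U))" and f: "f \<in> hom C k i" and U: "U \<subseteq> rest_idem C i"
    and z: "z \<in> rest_idem C k"
    and step: "\<And>v u. le C v w \<Longrightarrow> u \<in> U \<Longrightarrow> le C v (pull C f u) \<Longrightarrow> le C v z"
  shows "le C w z"
proof (rule osup_elim[OF _ _ z])
  show "le C w (osup C k (pull C f ` U))" using w pull_osup[OF f U] by simp
  show "pull C f ` U \<subseteq> rest_idem C k" using U pull_idem[OF f] by blast
qed (use step in blast)

text \<open>The join exists and lies below the upper bound \<open>s\<close>, hence is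
  \<open>s\<close> as soon as the domain of \<open>s\<close> is covered by the domains of the
  members. Statements about joins of maps thus become statements about opens.\<close>

lemma is_joinI:
  assumes S: "compatible_family C i j S" and s: "s \<in> hom C i j"
    and up: "\<And>f. f \<in> S \<Longrightarrow> le C f s" and cover: "le C (Rst C s) (osup C i (Rst C ` S))"
  shows "is_join C i j S s"
proof -
  obtain t where t: "is_join C i j S t" using join_exists[OF S] by blast
  have "le C t s" using t s up unfolding is_join_def by blast
  then have "t = s" using Rst_eq_imp_eq[OF _ s] Rst_join[OF t] cover by simp
  with t show ?thesis by simp
qed

lemma le_family:
  assumes s: "s \<in> hom C i j" and up: "\<And>f. f \<in> S \<Longrightarrow> le C f s"
  shows "compatible_family C i j S"
  unfolding compatible_family_def
proof (intro conjI ballI subsetI)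
  show "i \<in> Obj C" "j \<in> Obj C" using hom_Obj[OF s] by auto
  show "f \<in> hom C i j" if "f \<in> S" for f
    using le_hom[OF up[OF that]] s by simp
  show "compatible C f g" if "f \<in> S" "g \<in> S" for f g
    using le_imp_compatible[OF up up] that by blast
qed

section \<open>Meets of parallel maps and their regions of agreement\<close>

lemma meet_le:
  assumes "f \<in> hom C i j" "g \<in> hom C i j"
  shows "le C (meet C f g) f" "le C (meet C f g) g"
  using is_meet_meet[of f g] assms unfolding is_meet_def by (auto simp: parallel_def hom_def)

lemma meet_greatest:
  assumes "le C h f" "le C h g"
  shows "le C h (meet C f g)"
  using is_meet_meet[of f g] assms unfolding is_meet_def by (auto simp: le_def parallel_def)

lemma meet_hom: "f \<in> hom C i j \<Longrightarrow> g \<in> hom C i j \<Longrightarrow> meet C f g \<in> hom C i j"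
  using le_hom[OF meet_le(1)] by simp

lemma meet_eqI:
  assumes "is_meet C f g m"
  shows "meet C f g = m"
proof -
  have "le C m f" "le C m g" using assms by (auto simp: is_meet_def)
  then have "is_meet C f g (meet C f g)"
    using is_meet_meet by (auto simp: le_def parallel_def)
  with assms show ?thesis
    using le_antisym unfolding is_meet_def by blast
qed

lemma eqz_idem: "f \<in> hom C i j \<Longrightarrow> g \<in> hom C i j \<Longrightarrow> eqz C f g \<in> rest_idem C i"
  unfolding eqz_def by (rule Rst_idem[OF meet_hom])

lemma meet_eqz:
  assumes "f \<in> hom C i j" "g \<in> hom C i j"
  shows "f \<odot> eqz C f g = meet C f g" "g \<odot> eqz C f g = meet C f g"
  using le_eq[OF meet_le(1)[OF assms]] le_eq[OF meet_le(2)[OF assms]] by (auto simp: eqz_def)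

text \<open>Where both maps are defined and agree, \<open>f \<odot> w\<close> is a common lower
  bound with domain \<open>w\<close>, so it lies below the meet.\<close>

lemma le_eqz_iff:
  assumes f: "f \<in> hom C i j" and g: "g \<in> hom C i j"
  shows "le C w (eqz C f g) \<longleftrightarrow> le C w (Rst C f) \<and> le C w (Rst C g) \<and> f \<odot> w = g \<odot> w"
proof
  note e = eqz_idem[OF assms]
  assume w: "le C w (eqz C f g)"
  have "le C w (Rst C f)" "le C w (Rst C g)"
    using w le_Rst[OF meet_le(1)[OF assms] f] le_Rst[OF meet_le(2)[OF assms] g] le_trans
    unfolding eqz_def by blast+
  moreover have "f \<odot> w = g \<odot> w"
    using eq_on_le[OF _ w e f g] meet_eqz[OF assms] by simp
  ultimately show "le C w (Rst C f) \<and> le C w (Rst C g) \<and> f \<odot> w = g \<odot> w" by simp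
next
  assume a: "le C w (Rst C f) \<and> le C w (Rst C g) \<and> f \<odot> w = g \<odot> w"
  then have w: "w \<in> rest_idem C i" using le_idem Rst_idem[OF f] by blast
  have "le C (f \<odot> w) (meet C f g)"
    using meet_greatest[OF comp_idem_le[OF f w]] comp_idem_le[OF g w] a by simp
  from le_Rst[OF this meet_hom[OF assms]] show "le C w (eqz C f g)"
    using Rst_comp_of_idem_le[OF f, of w] a unfolding eqz_def by metis
qed

lemma eqz_refl: "f \<in> hom C i j \<Longrightarrow> eqz C f f = Rst C f"
  using meet_eqI[of f f f] le_refl by (auto simp: eqz_def is_meet_def)

lemma eqz_commute: "f \<in> hom C i j \<Longrightarrow> g \<in> hom C i j \<Longrightarrow> eqz C f g = eqz C g f"
  using le_eqz_iff[of f i j g] le_eqz_iff[of g i j f] le_refl[OF idem_hom[OF eqz_idem]] le_antisym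
  by metis

lemma eqz_le_Rst:
  assumes "f \<in> hom C i j" "g \<in> hom C i j"
  shows "le C (eqz C f g) (Rst C f)" "le C (eqz C f g) (Rst C g)"
  using le_eqz_iff[OF assms] le_refl[OF idem_hom[OF eqz_idem[OF assms]]] by auto

lemma eqz_trans:
  assumes "f \<in> hom C i j" "g \<in> hom C i j" "h \<in> hom C i j"
    "le C w (eqz C f g)" "le C w (eqz C g h)"
  shows "le C w (eqz C f h)"
  using assms le_eqz_iff[of f i j g] le_eqz_iff[of g i j h] le_eqz_iff[of f i j h] by auto

text \<open>On the inverse image, \<open>x\<close> lands in [f = g], where \<open>f\<close> and
  \<open>g\<close> coincide. The inclusion can be strict: two maps may agree along \<open>x\<close>
  without agreeing on any open around its image.\<close>

lemma pull_eqz_le: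
  assumes x: "x \<in> hom C k i" and f: "f \<in> hom C i j" and g: "g \<in> hom C i j"
  shows "le C (pull C x (eqz C f g)) (eqz C (f \<odot> x) (g \<odot> x))"
proof -
  let ?w = "pull C x (eqz C f g)" and ?e = "eqz C f g"
  note e = eqz_idem[OF f g]
  have w: "?w \<in> rest_idem C k" by (rule pull_idem[OF x e])
  note fx = Comp_closed[OF x f] and gx = Comp_closed[OF x g] and xw = Comp_closed[OF idem_hom[OF w] x]
  have "le C ?w (Rst C (f \<odot> x))" "le C ?w (Rst C (g \<odot> x))"
    using pull_mono[OF eqz_le_Rst(1)[OF f g] Rst_idem[OF f] x] pull_Rst[OF x f]
      pull_mono[OF eqz_le_Rst(2)[OF f g] Rst_idem[OF g] x] pull_Rst[OF x g] by auto
  moreover have "(f \<odot> x) \<odot> ?w = (g \<odot> x) \<odot> ?w"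
  proof -
    have "?e \<odot> (x \<odot> ?w) = x \<odot> ?w"
      using le_pull_iff[OF x e] le_refl[OF idem_hom[OF w]] by blast
    then have "h \<odot> (x \<odot> ?w) = (h \<odot> ?e) \<odot> (x \<odot> ?w)" if "h \<in> hom C i j" for h
      using Comp_assoc[OF xw idem_hom[OF e] that] by simp
    then have "f \<odot> (x \<odot> ?w) = g \<odot> (x \<odot> ?w)"
      using f g meet_eqz[OF f g] by metis
    then show ?thesis
      using Comp_assoc[OF idem_hom[OF w] x f] Comp_assoc[OF idem_hom[OF w] x g] by simp
  qed
  ultimately show ?thesis using le_eqz_iff[OF fx gx] by blast
qed

lemma le_eqz_of_le:
  assumes fg: "le C f g" and g: "g \<in> hom C i j" and h: "h \<in> hom C i j"
  shows "le C w (eqz C f h) \<longleftrightarrow> le C w (Rst C f) \<and> le C w (eqz C g h)"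
proof -
  have f: "f \<in> hom C i j" using le_hom[OF fg] g by simp
  have eq: "f \<odot> w = g \<odot> w" if w: "le C w (Rst C f)"
    using eq_on_le[OF _ w Rst_idem[OF f] f g] le_eq[OF fg] Comp_Rst_hom[OF f] by simp
  show ?thesis
    using eq le_eqz_iff[OF f h] le_eqz_iff[OF g h] le_trans[OF _ le_Rst[OF fg g]] by metis
qed

text \<open>The domain of the meet is [f = g], which contains the intersection of [f = h] and
  [g = h] by transitivity. Preservation of meets by the left factor rests on this.\<close>

lemma le_eqz_meet_iff:
  assumes f: "f \<in> hom C i j" and g: "g \<in> hom C i j" and h: "h \<in> hom C i j"
  shows "le C w (eqz C (meet C f g) h) \<longleftrightarrow> le C w (eqz C f h) \<and> le C w (eqz C g h)"
proof -
  have "le C w (Rst C (meet C f g)) \<longleftrightarrow> le C w (eqz C f g)" by (simp add: eqz_def)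
  then show ?thesis
    using le_eqz_of_le[OF meet_le(1)[OF f g] f h] le_eqz_of_le[OF meet_le(2)[OF f g] g h]
      eqz_trans[OF f h g] eqz_commute[OF g h] by metis
qed

section \<open>Gluing maps along opens\<close>

text \<open>As \<open>u k\<close> lies in the domain of \<open>m k\<close>, the restricted map
  \<open>m k \<odot> u k\<close> has domain exactly \<open>u k\<close>, and compatibility of two
  such maps is agreement on the overlap of \<open>u k\<close> and \<open>u l\<close>.\<close>

lemma glue_exists:
  assumes ij: "i \<in> Obj C" "j \<in> Obj C" and m: "\<And>k. k \<in> K \<Longrightarrow> m k \<in> hom C i j"
    and u: "\<And>k. k \<in> K \<Longrightarrow> le C (u k) (Rst C (m k))"
    and agree: "\<And>k l. k \<in> K \<Longrightarrow> l \<in> K \<Longrightarrow> m k \<odot> (u k \<odot> u l) = m l \<odot> (u k \<odot> u l)"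
  shows "\<exists>s. is_join C i j ((\<lambda>k. m k \<odot> u k) ` K) s"
proof (rule join_exists)
  have ui: "u k \<in> rest_idem C i" if "k \<in> K" for k
    using le_idem[OF u[OF that] Rst_idem[OF m[OF that]]] .
  have mu: "m k \<odot> u k \<in> hom C i j" if "k \<in> K" for k
    using Comp_closed[OF idem_hom[OF ui[OF that]] m[OF that]] .
  have ru: "Rst C (m k \<odot> u k) = u k" if "k \<in> K" for k
    using Rst_comp_of_idem_le[OF m u] that by blast
  have "compatible C (m k \<odot> u k) (m l \<odot> u l)" if k: "k \<in> K" and l: "l \<in> K" for k l
  proof -
    have "(m k \<odot> u k) \<odot> u l = (m l \<odot> u l) \<odot> u k"
      using Comp_assoc[OF idem_hom[OF ui[OF l]] idem_hom[OF ui[OF k]] m[OF k]]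
        Comp_assoc[OF idem_hom[OF ui[OF k]] idem_hom[OF ui[OF l]] m[OF l]]
        agree[OF k l] idem_commute[OF ui[OF k] ui[OF l]] by simp
    then show ?thesis using compatible_iff[OF mu[OF k] mu[OF l]] ru k l by simp
  qed
  then show "compatible_family C i j ((\<lambda>k. m k \<odot> u k) ` K)"
    unfolding compatible_family_def using ij mu by auto
qed

lemma glue_unique:
  assumes s: "is_join C i j ((\<lambda>k. m k \<odot> u k) ` K) s" and t: "t \<in> hom C i j"
    and m: "\<And>k. k \<in> K \<Longrightarrow> m k \<in> hom C i j" and u: "\<And>k. k \<in> K \<Longrightarrow> le C (u k) (Rst C (m k))"
    and eq: "\<And>k. k \<in> K \<Longrightarrow> t \<odot> u k = m k \<odot> u k"
    and cover: "le C (Rst C t) (osup C i (u ` K))"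
  shows "t = s"
proof -
  have ui: "u k \<in> rest_idem C i" if "k \<in> K" for k
    using le_idem[OF u[OF that] Rst_idem[OF m[OF that]]] .
  have "Rst C ` (\<lambda>k. m k \<odot> u k) ` K = u ` K"
    using Rst_comp_of_idem_le[OF m u] by (auto simp: image_iff)
  moreover have "le C (m k \<odot> u k) t" if "k \<in> K" for k
    using comp_idem_le[OF t ui[OF that]] eq[OF that] by simp
  ultimately have "is_join C i j ((\<lambda>k. m k \<odot> u k) ` K) t"
    using cover by (intro is_joinI[OF is_join_family[OF s] t]) auto
  then show ?thesis using s is_join_unique by blast
qed

lemma glue_props:
  assumes s: "is_join C i j ((\<lambda>k. m k \<odot> u k) ` K) s"
    and m: "\<And>k. k \<in> K \<Longrightarrow> m k \<in> hom C i j" and u: "\<And>k. k \<in> K \<Longrightarrow> le C (u k) (Rst C (m k))"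
  shows "s \<in> hom C i j" "Rst C s = osup C i (u ` K)" "\<And>k. k \<in> K \<Longrightarrow> s \<odot> u k = m k \<odot> u k"
proof -
  show "s \<in> hom C i j" using s by (simp add: is_join_def)
  have "Rst C ` (\<lambda>k. m k \<odot> u k) ` K = u ` K"
    using Rst_comp_of_idem_le[OF m u] by (auto simp: image_iff)
  then show "Rst C s = osup C i (u ` K)" using Rst_join[OF s] by simp
  fix k assume k: "k \<in> K"
  then have "le C (m k \<odot> u k) s" using s by (simp add: is_join_def)
  from le_eq[OF this] show "s \<odot> u k = m k \<odot> u k"
    using Rst_comp_of_idem_le[OF m[OF k] u[OF k]] by simp
qed

end

section \<open>Join restriction functors\<close>

lemma amap_comp_ftor: "f \<in> Arr A \<Longrightarrow> amap (comp_ftor A G F) f = amap G (amap F f)"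
  by (simp add: comp_ftor_def)

lemma omap_comp_ftor: "i \<in> Obj A \<Longrightarrow> omap (comp_ftor A G F) i = omap G (omap F i)"
  by (simp add: comp_ftor_def)

text \<open>Functoriality and \<open>rst\<close> already make \<open>amap F s\<close> an upper bound
  of the images, so by \<open>is_joinI\<close> only its domain has to be covered. The join condition
  is thereby reduced to an inequality of opens.\<close>

lemma jr_functorI:
  assumes A: "join_restriction_category A" and B: "join_restriction_category B"
    and ob: "omap F \<in> Obj A \<rightarrow>\<^sub>E Obj B" and ext: "amap F \<in> extensional (Arr A)"
    and hom: "\<And>f i j. f \<in> hom A i j \<Longrightarrow> amap F f \<in> hom B (omap F i) (omap F j)"
    and ide: "\<And>i. i \<in> Obj A \<Longrightarrow> amap F (Ide A i) = Ide B (omap F i)"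
    and comp: "\<And>f g i j k. f \<in> hom A i j \<Longrightarrow> g \<in> hom A j k \<Longrightarrow>
      amap F (g \<odot>\<^bsub>A\<^esub> f) = amap F g \<odot>\<^bsub>B\<^esub> amap F f"
    and rst: "\<And>f i j. f \<in> hom A i j \<Longrightarrow> amap F (Rst A f) = Rst B (amap F f)"
    and join: "\<And>i j S s. is_join A i j S s \<Longrightarrow>
      le B (amap F (Rst A s)) (osup B (omap F i) ((\<lambda>f. amap F (Rst A f)) ` S))"
  shows "jr_functor A B F"
proof -
  interpret A: join_restriction_category A by fact
  interpret B: join_restriction_category B by fact
  have "is_join B (omap F i) (omap F j) (amap F ` S) (amap F s)"
    if s: "is_join A i j S s" for i j S s
  proof -
    have sh: "s \<in> hom A i j" and S: "S \<subseteq> hom A i j" and up: "\<And>f. f \<in> S \<Longrightarrow> le A f s"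
      using s by (auto simp: is_join_def)
    have le: "le B g (amap F s)" if g: "g \<in> amap F ` S" for g
    proof -
      obtain f where f: "f \<in> S" "g = amap F f" using g by blast
      have fh: "f \<in> hom A i j" using S f by blast
      show ?thesis
        using comp[OF A.Rst_closed[OF fh] sh] le_eq[OF up[OF f(1)]] rst[OF fh] f(2)
        by (intro leI[OF _ hom[OF sh]]) (auto intro: hom[OF fh])
    qed
    have "Rst B ` amap F ` S = (\<lambda>f. amap F (Rst A f)) ` S"
      using S rst by (force simp: image_iff)
    then show ?thesis
      using join[OF s] rst[OF sh] le
      by (intro B.is_joinI[OF B.le_family[OF hom[OF sh] le] hom[OF sh]]) auto
  qed
  moreover have "cat_functor A B F"
    unfolding cat_functor_def
  proof (intro conjI ballI impI)
    show "category A" "category B" by unfold_locales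
    show "amap F \<in> Arr A \<rightarrow>\<^sub>E Arr B"
      using ext hom_Arr[OF hom[OF Arr_hom]] by (auto simp: PiE_iff)
    show "Dom B (amap F f) = omap F (Dom A f)" "Cod B (amap F f) = omap F (Cod A f)"
      if "f \<in> Arr A" for f
      using hom[OF Arr_hom[OF that]] by (auto simp: hom_def)
    show "amap F (g \<odot>\<^bsub>A\<^esub> f) = amap F g \<odot>\<^bsub>B\<^esub> amap F f"
      if "f \<in> Arr A" "g \<in> Arr A" "Dom A g = Cod A f" for f g
      using comp[OF Arr_hom[OF that(1)], of g "Cod A g"] that by (simp add: hom_def)
  qed (use ob ide in auto)
  moreover have "\<forall>f\<in>Arr A. amap F (Rst A f) = Rst B (amap F f)"
    using rst[OF Arr_hom] by blast
  ultimately show ?thesis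
    using A B unfolding jr_functor_def by blast
qed

locale jr_map = A: join_restriction_category A + B: join_restriction_category B
  for A :: "('o, 'm) rcat" and B :: "('p, 'n) rcat" +
  fixes F :: "('o, 'm, 'p, 'n) ftor"
  assumes jr: "jr_functor A B F"
begin

lemma cat_functor: "cat_functor A B F"
  using jr by (simp add: jr_functor_def)

lemma omap_extensional: "omap F \<in> extensional (Obj A)"
  using cat_functor by (simp add: cat_functor_def PiE_iff)

lemma amap_extensional: "amap F \<in> extensional (Arr A)"
  using cat_functor by (simp add: cat_functor_def PiE_iff)

lemma omap_Obj: "i \<in> Obj A \<Longrightarrow> omap F i \<in> Obj B"
  using cat_functor by (auto simp: cat_functor_def)

lemma amap_hom: "f \<in> hom A i j \<Longrightarrow> amap F f \<in> hom B (omap F i) (omap F j)"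
  using cat_functor by (auto simp: cat_functor_def hom_def)

lemma amap_comp:
  "f \<in> hom A i j \<Longrightarrow> g \<in> hom A j k \<Longrightarrow> amap F (g \<odot>\<^bsub>A\<^esub> f) = amap F g \<odot>\<^bsub>B\<^esub> amap F f"
  using cat_functor by (auto simp: cat_functor_def hom_def)

lemma amap_Ide: "i \<in> Obj A \<Longrightarrow> amap F (Ide A i) = Ide B (omap F i)"
  using cat_functor by (auto simp: cat_functor_def)

lemma amap_Rst: "f \<in> hom A i j \<Longrightarrow> amap F (Rst A f) = Rst B (amap F f)"
  using jr by (auto simp: jr_functor_def hom_def)

lemma amap_join:
  "is_join A i j S s \<Longrightarrow> is_join B (omap F i) (omap F j) (amap F ` S) (amap F s)"
  using jr A.is_join_family unfolding jr_functor_def by blast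

lemma amap_le:
  assumes fg: "le A f g"
  shows "le B (amap F f) (amap F g)"
proof -
  obtain i j where g: "g \<in> hom A i j"
    using fg by (auto simp: le_def parallel_def hom_def)
  then have f: "f \<in> hom A i j" using le_hom[OF fg] by simp
  show ?thesis
    using amap_comp[OF A.Rst_closed[OF f] g] le_eq[OF fg] amap_Rst[OF f]
    by (intro leI[OF amap_hom[OF f] amap_hom[OF g]]) simp
qed

lemma amap_idem: "u \<in> rest_idem A i \<Longrightarrow> amap F u \<in> rest_idem B (omap F i)"
  using amap_hom[OF idem_hom] amap_Rst[OF idem_hom] idem_Rst by (fastforce simp: rest_idem_def)

lemma amap_osup:
  assumes U: "U \<subseteq> rest_idem A i" and i: "i \<in> Obj A"
  shows "amap F (osup A i U) = osup B (omap F i) (amap F ` U)"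
proof -
  have "amap F ` U \<subseteq> rest_idem B (omap F i)" using U amap_idem by blast
  from B.is_join_osup[OF this omap_Obj[OF i]] amap_join[OF A.is_join_osup[OF U i]]
  show ?thesis using B.is_join_unique by blast
qed

lemma amap_pull:
  "f \<in> hom A i j \<Longrightarrow> u \<in> rest_idem A j \<Longrightarrow> amap F (pull A f u) = pull B (amap F f) (amap F u)"
  unfolding pull_def using amap_Rst[OF A.Comp_closed[OF _ idem_hom]] amap_comp[OF _ idem_hom]
  by metis

lemma amap_agree:
  assumes f: "f \<in> hom A i j" and g: "g \<in> hom A i j" and w: "le B w (amap F (eqz A f g))"
  shows "amap F f \<odot>\<^bsub>B\<^esub> w = amap F g \<odot>\<^bsub>B\<^esub> w"
  using B.eq_on_le[OF _ w amap_idem[OF A.eqz_idem[OF f g]] amap_hom[OF f] amap_hom[OF g]]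
    A.meet_eqz[OF f g] amap_comp[OF idem_hom[OF A.eqz_idem[OF f g]]] f g by metis

lemma amap_eqz_le:
  assumes f: "f \<in> hom A i j" and g: "g \<in> hom A i j"
  shows "le B (amap F (eqz A f g)) (eqz B (amap F f) (amap F g))"
  unfolding eqz_def using amap_Rst[OF A.meet_hom[OF f g]]
    B.le_Rst[OF B.meet_greatest[OF amap_le amap_le] B.meet_hom[OF amap_hom amap_hom]]
    A.meet_le[OF f g] f g by metis

text \<open>The second condition on a localic functor, reduced to opens: the meets with
  \<open>g\<close> all lie below \<open>g\<close>, and their domains are the regions
  [g = F f].\<close>

lemma is_join_meets_iff:
  assumes g: "g \<in> hom B (omap F i) (omap F j)"
  shows "is_join B (omap F i) (omap F j) ((\<lambda>f. meet B g (amap F f)) ` hom A i j) g \<longleftrightarrow>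
    le B (Rst B g) (osup B (omap F i) ((\<lambda>f. eqz B g (amap F f)) ` hom A i j))"
    (is "is_join B ?i ?j ?S g \<longleftrightarrow> _")
proof -
  have e: "Rst B ` ?S = (\<lambda>f. eqz B g (amap F f)) ` hom A i j"
    by (auto simp: eqz_def image_iff)
  have le: "le B h g" if "h \<in> ?S" for h
    using that B.meet_le(1)[OF g amap_hom] by blast
  show ?thesis
  proof
    assume j: "is_join B ?i ?j ?S g"
    show "le B (Rst B g) (osup B ?i ((\<lambda>f. eqz B g (amap F f)) ` hom A i j))"
      using B.Rst_join[OF j] e B.le_refl[OF B.Rst_closed[OF g]] by simp
  next
    assume "le B (Rst B g) (osup B ?i ((\<lambda>f. eqz B g (amap F f)) ` hom A i j))"
    then show "is_join B ?i ?j ?S g"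
      using e le by (intro B.is_joinI[OF B.le_family[OF g le] g]) auto
  qed
qed

end

lemma jr_mapI: "jr_functor A B F \<Longrightarrow> jr_map A B F"
  by (simp add: jr_map_def jr_map_axioms_def jr_functor_def)

section \<open>Closure of the two classes under composition, and isomorphisms\<close>

lemma jr_functor_comp:
  assumes F: "jr_functor A B F" and G: "jr_functor B C G"
  shows "jr_functor A C (comp_ftor A G F)"
proof -
  interpret F: jr_map A B F by (rule jr_mapI[OF F])
  interpret G: jr_map B C G by (rule jr_mapI[OF G])
  note simps = amap_comp_ftor omap_comp_ftor hom_Arr F.A.hom_Obj
  show ?thesis
  proof (rule jr_functorI)
    show "omap (comp_ftor A G F) \<in> Obj A \<rightarrow>\<^sub>E Obj C"
      using F.omap_Obj G.omap_Obj by (auto simp: comp_ftor_def)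
    show "amap (comp_ftor A G F) \<in> extensional (Arr A)"
      by (simp add: comp_ftor_def)
    show "amap (comp_ftor A G F) f \<in> hom C (omap (comp_ftor A G F) i) (omap (comp_ftor A G F) j)"
      if f: "f \<in> hom A i j" for f i j
      using G.amap_hom[OF F.amap_hom[OF f]] F.A.hom_Obj[OF f] f by (simp add: simps)
    show "amap (comp_ftor A G F) (Ide A i) = Ide C (omap (comp_ftor A G F) i)"
      if i: "i \<in> Obj A" for i
      using i hom_Arr[OF F.A.Ide_closed[OF i]] F.amap_Ide[OF i] G.amap_Ide[OF F.omap_Obj[OF i]]
      by (simp add: simps)
    show "amap (comp_ftor A G F) (g \<odot>\<^bsub>A\<^esub> f) =
        amap (comp_ftor A G F) g \<odot>\<^bsub>C\<^esub> amap (comp_ftor A G F) f"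
      if f: "f \<in> hom A i j" and g: "g \<in> hom A j k" for f g i j k
      using hom_Arr[OF f] hom_Arr[OF g] hom_Arr[OF F.A.Comp_closed[OF f g]] F.amap_comp[OF f g]
        G.amap_comp[OF F.amap_hom[OF f] F.amap_hom[OF g]]
      by (simp add: amap_comp_ftor)
    show r: "amap (comp_ftor A G F) (Rst A f) = Rst C (amap (comp_ftor A G F) f)"
      if f: "f \<in> hom A i j" for f i j
      using hom_Arr[OF f] hom_Arr[OF F.A.Rst_closed[OF f]] F.amap_Rst[OF f]
        G.amap_Rst[OF F.amap_hom[OF f]]
      by (simp add: amap_comp_ftor)
    fix i j S s assume s: "is_join A i j S s"
    then have sh: "s \<in> hom A i j" and S: "S \<subseteq> hom A i j" by (auto simp: is_join_def)
    have "Rst C (amap G (amap F s)) = osup C (omap G (omap F i)) (Rst C ` amap G ` amap F ` S)"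
      by (rule G.B.Rst_join[OF G.amap_join[OF F.amap_join[OF s]]])
    also have "Rst C ` amap G ` amap F ` S = (\<lambda>f. amap (comp_ftor A G F) (Rst A f)) ` S"
      using S r by (force simp: image_iff amap_comp_ftor hom_Arr)
    also have "omap G (omap F i) = omap (comp_ftor A G F) i"
      using F.A.hom_Obj[OF sh] by (simp add: omap_comp_ftor)
    finally have "amap (comp_ftor A G F) (Rst A s) =
        osup C (omap (comp_ftor A G F) i) ((\<lambda>f. amap (comp_ftor A G F) (Rst A f)) ` S)"
      using r[OF sh] hom_Arr[OF sh] by (simp add: amap_comp_ftor)
    moreover have "amap (comp_ftor A G F) (Rst A s) \<in> hom C (omap G (omap F i)) (omap G (omap F i))"
      using G.amap_hom[OF F.amap_hom[OF F.A.Rst_closed[OF sh]]] hom_Arr[OF F.A.Rst_closed[OF sh]]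
      by (simp add: amap_comp_ftor)
    ultimately show "le C (amap (comp_ftor A G F) (Rst A s))
        (osup C (omap (comp_ftor A G F) i) ((\<lambda>f. amap (comp_ftor A G F) (Rst A f)) ` S))"
      using G.B.le_refl by metis
  qed (unfold_locales)
qed

lemma hyperconnected_comp:
  assumes F: "hyperconnected A B F" and G: "hyperconnected B C G"
  shows "hyperconnected A C (comp_ftor A G F)"
proof -
  have jF: "jr_functor A B F" and jG: "jr_functor B C G"
    using F G by (auto simp: hyperconnected_def)
  interpret F: jr_map A B F by (rule jr_mapI[OF jF])
  interpret G: jr_map B C G by (rule jr_mapI[OF jG])
  show ?thesis
    unfolding hyperconnected_def
  proof (intro conjI ballI jr_functor_comp[OF jF jG])
    fix i assume i: "i \<in> Obj A"
    have e: "amap (comp_ftor A G F) u = (amap G \<circ> amap F) u" if "u \<in> rest_idem A i" for u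
      using hom_Arr[OF idem_hom[OF that]] by (simp add: amap_comp_ftor)
    have "bij_betw (amap G \<circ> amap F) (rest_idem A i) (rest_idem C (omap G (omap F i)))"
      using F G i F.omap_Obj[OF i] unfolding hyperconnected_def by (blast intro: bij_betw_trans)
    then show "bij_betw (amap (comp_ftor A G F)) (rest_idem A i)
        (rest_idem C (omap (comp_ftor A G F) i))"
      using bij_betw_cong[of "rest_idem A i" "amap (comp_ftor A G F)" "amap G \<circ> amap F"]
        e omap_comp_ftor[OF i, of G F] by simp
    fix d e' assume "d \<in> rest_idem A i" "e' \<in> rest_idem A i"
    then show "le A d e' \<longleftrightarrow> le C (amap (comp_ftor A G F) d) (amap (comp_ftor A G F) e')"
      using F G i F.omap_Obj[OF i] F.amap_idem e by (simp add: hyperconnected_def)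
  qed
qed

text \<open>For the second condition, \<open>g\<close> is covered by the regions [g = G b], and the
  domain of each \<open>b\<close> by the regions [b = F f]. Since \<open>G\<close> sends [b = F f]
  into [G b = G (F f)], transitivity of agreement gives a cover by the regions
  [g = G (F f)].\<close>

lemma localic_comp:
  assumes F: "localic A B F" and G: "localic B C G"
  shows "localic A C (comp_ftor A G F)"
proof -
  have jF: "jr_functor A B F" and jG: "jr_functor B C G"
    using F G by (auto simp: localic_def)
  interpret F: jr_map A B F by (rule jr_mapI[OF jF])
  interpret G: jr_map B C G by (rule jr_mapI[OF jG])
  interpret H: jr_map A C "comp_ftor A G F" by (rule jr_mapI[OF jr_functor_comp[OF jF jG]])
  show ?thesis
    unfolding localic_def
  proof (intro conjI ballI H.jr)
    have "bij_betw (omap G \<circ> omap F) (Obj A) (Obj C)"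
      using F G unfolding localic_def by (blast intro: bij_betw_trans)
    then show "bij_betw (omap (comp_ftor A G F)) (Obj A) (Obj C)"
      using bij_betw_cong[of "Obj A" "omap (comp_ftor A G F)" "omap G \<circ> omap F"]
      by (simp add: omap_comp_ftor)
  next
    fix i j f g assume ij: "i \<in> Obj A" "j \<in> Obj A" and f: "f \<in> hom A i j" and g: "g \<in> hom A i j"
    have "meet B (amap F f) (amap F g) = amap F (meet A f g)"
      using F ij f g unfolding localic_def by blast
    moreover have "meet C (amap G (amap F f)) (amap G (amap F g)) =
        amap G (meet B (amap F f) (amap F g))"
      using G F.omap_Obj[OF ij(1)] F.omap_Obj[OF ij(2)] F.amap_hom[OF f] F.amap_hom[OF g]
      unfolding localic_def by blast
    ultimately show "meet C (amap (comp_ftor A G F) f) (amap (comp_ftor A G F) g) =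
        amap (comp_ftor A G F) (meet A f g)"
      using f g F.A.meet_hom[OF f g] by (simp add: amap_comp_ftor hom_Arr)
  next
    fix i j g assume ij: "i \<in> Obj A" "j \<in> Obj A"
      and "g \<in> hom C (omap (comp_ftor A G F) i) (omap (comp_ftor A G F) j)"
    then have g: "g \<in> hom C (omap G (omap F i)) (omap G (omap F j))"
      by (simp add: omap_comp_ftor)
    let ?U = "(\<lambda>b. eqz C g (amap G b)) ` hom B (omap F i) (omap F j)"
    let ?V = "(\<lambda>f. eqz C g (amap G (amap F f))) ` hom A i j"
    have U: "?U \<subseteq> rest_idem C (omap G (omap F i))"
      using G.B.eqz_idem[OF g G.amap_hom] by blast
    have V: "?V \<subseteq> rest_idem C (omap G (omap F i))"
      using G.B.eqz_idem[OF g G.amap_hom[OF F.amap_hom]] by blast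
    note Oi = F.omap_Obj[OF ij(1)] F.omap_Obj[OF ij(2)] G.omap_Obj[OF F.omap_Obj[OF ij(1)]]
    note oV = G.B.osup_idem[OF V Oi(3)]
    have gG: "le C (Rst C g) (osup C (omap G (omap F i)) ?U)"
      using G g Oi G.is_join_meets_iff[OF g] unfolding localic_def by blast
    have "le C (Rst C g) (osup C (omap G (omap F i)) ?V)"
    proof (rule G.B.osup_elim[OF gG U oV])
      fix v u assume "u \<in> ?U" and vu: "le C v u"
      then obtain b where b: "b \<in> hom B (omap F i) (omap F j)" and u: "u = eqz C g (amap G b)"
        by blast
      have vb: "le C v (eqz C g (amap G b))" using vu u by simp
      let ?W = "(\<lambda>f. eqz B b (amap F f)) ` hom A i j"
      have W: "?W \<subseteq> rest_idem B (omap F i)" using F.B.eqz_idem[OF b F.amap_hom] by blast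
      have "le B (Rst B b) (osup B (omap F i) ?W)"
        using F b ij F.is_join_meets_iff[OF b] unfolding localic_def by blast
      note Gb = G.amap_le[OF this]
      have "le C v (amap G (Rst B b))"
        using vb G.B.le_eqz_iff[OF g G.amap_hom[OF b]] G.amap_Rst[OF b] by simp
      from G.B.le_trans[OF this Gb] have "le C v (osup C (omap G (omap F i)) (amap G ` ?W))"
        using G.amap_osup[OF W Oi(1)] by simp
      then show "le C v (osup C (omap G (omap F i)) ?V)"
      proof (rule G.B.osup_elim[OF _ _ oV])
        show "amap G ` ?W \<subseteq> rest_idem C (omap G (omap F i))" using W G.amap_idem by blast
        fix x w assume xv: "le C x v" and "w \<in> amap G ` ?W" and xw: "le C x w"
        then obtain f where f: "f \<in> hom A i j" and w: "w = amap G (eqz B b (amap F f))" by blast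
        have 1: "le C x (eqz C g (amap G b))" using xv vb G.B.le_trans by blast
        have 2: "le C x (eqz C (amap G b) (amap G (amap F f)))"
          using xw w G.amap_eqz_le[OF b F.amap_hom[OF f]] G.B.le_trans by blast
        have "le C x (eqz C g (amap G (amap F f)))"
          by (rule G.B.eqz_trans[OF g G.amap_hom[OF b] G.amap_hom[OF F.amap_hom[OF f]] 1 2])
        moreover have "le C (eqz C g (amap G (amap F f))) (osup C (omap G (omap F i)) ?V)"
          using f by (intro G.B.osup_upper[OF _ V Oi(3)]) blast
        ultimately show "le C x (osup C (omap G (omap F i)) ?V)" using G.B.le_trans by blast
      qed
    qed
    moreover have "?V = (\<lambda>f. eqz C g (amap (comp_ftor A G F) f)) ` hom A i j"
      by (auto simp: image_iff amap_comp_ftor hom_Arr)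
    ultimately show "is_join C (omap (comp_ftor A G F) i) (omap (comp_ftor A G F) j)
        ((\<lambda>f. meet C g (amap (comp_ftor A G F) f)) ` hom A i j) g"
      using H.is_join_meets_iff[of g i j] g ij by (simp add: omap_comp_ftor)
  qed
qed

lemma jr_iso_inverse:
  assumes "jr_iso A B K"
  obtains G where "jr_functor A B K" "jr_functor B A G"
    "\<And>i. i \<in> Obj A \<Longrightarrow> omap G (omap K i) = i" "\<And>i. i \<in> Obj B \<Longrightarrow> omap K (omap G i) = i"
    "\<And>f. f \<in> Arr A \<Longrightarrow> amap G (amap K f) = f" "\<And>f. f \<in> Arr B \<Longrightarrow> amap K (amap G f) = f"
proof -
  obtain G where G: "jr_functor A B K" "jr_functor B A G"
    and 1: "comp_ftor A G K = id_ftor A" and 2: "comp_ftor B K G = id_ftor B"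
    using assms unfolding jr_iso_def by blast
  have "amap G (amap K f) = f" if "f \<in> Arr A" for f
    using that amap_comp_ftor[of f A G K] 1 by (simp add: id_ftor_def)
  moreover have "amap K (amap G f) = f" if "f \<in> Arr B" for f
    using that amap_comp_ftor[of f B K G] 2 by (simp add: id_ftor_def)
  moreover have "omap G (omap K i) = i" if "i \<in> Obj A" for i
    using that omap_comp_ftor[of i A G K] 1 by (simp add: id_ftor_def)
  moreover have "omap K (omap G i) = i" if "i \<in> Obj B" for i
    using that omap_comp_ftor[of i B K G] 2 by (simp add: id_ftor_def)
  ultimately show thesis using that G by blast
qed

text \<open>Isomorphisms belong to both classes, so stability under composing with them is a special
  case of stability under composition.\<close>

lemma jr_iso_hyperconnected:
  assumes "jr_iso A B K"
  shows "hyperconnected A B K"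
proof -
  obtain G where K: "jr_functor A B K" and G: "jr_functor B A G"
    and o: "\<And>i. i \<in> Obj A \<Longrightarrow> omap G (omap K i) = i" "\<And>i. i \<in> Obj B \<Longrightarrow> omap K (omap G i) = i"
    and a: "\<And>f. f \<in> Arr A \<Longrightarrow> amap G (amap K f) = f" "\<And>f. f \<in> Arr B \<Longrightarrow> amap K (amap G f) = f"
    using jr_iso_inverse[OF assms] by blast
  interpret K: jr_map A B K by (rule jr_mapI[OF K])
  interpret G: jr_map B A G by (rule jr_mapI[OF G])
  show ?thesis
    unfolding hyperconnected_def
  proof (intro conjI ballI K)
    fix i assume i: "i \<in> Obj A"
    have ar: "u \<in> Arr A" if "u \<in> rest_idem A i" for u
      using hom_Arr[OF idem_hom[OF that]] .
    show "bij_betw (amap K) (rest_idem A i) (rest_idem B (omap K i))"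
    proof (rule bij_betw_byWitness[where f' = "amap G"])
      show "amap G ` rest_idem B (omap K i) \<subseteq> rest_idem A i"
        using G.amap_idem[of _ "omap K i"] o(1)[OF i] by auto
      show "amap K ` rest_idem A i \<subseteq> rest_idem B (omap K i)"
        using K.amap_idem by blast
      show "\<forall>u\<in>rest_idem A i. amap G (amap K u) = u"
        using a(1) ar by blast
      show "\<forall>u\<in>rest_idem B (omap K i). amap K (amap G u) = u"
        using a(2)[OF hom_Arr[OF idem_hom]] by blast
    qed
    fix d e assume "d \<in> rest_idem A i" "e \<in> rest_idem A i"
    then show "le A d e \<longleftrightarrow> le B (amap K d) (amap K e)"
      using K.amap_le[of d e] G.amap_le[of "amap K d" "amap K e"] a(1) ar by auto
  qed
qed

lemma jr_iso_localic:
  assumes "jr_iso A B K"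
  shows "localic A B K"
proof -
  obtain G where K: "jr_functor A B K" and G: "jr_functor B A G"
    and o: "\<And>i. i \<in> Obj A \<Longrightarrow> omap G (omap K i) = i" "\<And>i. i \<in> Obj B \<Longrightarrow> omap K (omap G i) = i"
    and a: "\<And>f. f \<in> Arr A \<Longrightarrow> amap G (amap K f) = f" "\<And>f. f \<in> Arr B \<Longrightarrow> amap K (amap G f) = f"
    using jr_iso_inverse[OF assms] by blast
  interpret K: jr_map A B K by (rule jr_mapI[OF K])
  interpret G: jr_map B A G by (rule jr_mapI[OF G])
  show ?thesis
    unfolding localic_def
  proof (intro conjI ballI K)
    show "bij_betw (omap K) (Obj A) (Obj B)"
      by (rule bij_betw_byWitness[where f' = "omap G"]) (use o K.omap_Obj G.omap_Obj in auto)
  next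
    fix i j f g assume f: "f \<in> hom A i j" and g: "g \<in> hom A i j"
    have "is_meet B (amap K f) (amap K g) (amap K (meet A f g))"
      unfolding is_meet_def
    proof (intro conjI allI impI)
      show "le B (amap K (meet A f g)) (amap K f)" "le B (amap K (meet A f g)) (amap K g)"
        using K.amap_le K.A.meet_le[OF f g] by auto
      fix h assume h: "le B h (amap K f) \<and> le B h (amap K g)"
      then have "h \<in> Arr B" by (simp add: le_def parallel_def)
      moreover have "le A (amap G h) (meet A f g)"
        using h G.amap_le[of h] a(1) hom_Arr[OF f] hom_Arr[OF g]
        by (intro K.A.meet_greatest) (metis+)
      ultimately show "le B h (amap K (meet A f g))"
        using K.amap_le a(2) by metis
    qed
    then show "meet B (amap K f) (amap K g) = amap K (meet A f g)"
      by (rule K.B.meet_eqI)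
  next
    fix i j g assume ij: "i \<in> Obj A" "j \<in> Obj A" and g: "g \<in> hom B (omap K i) (omap K j)"
    \<comment> \<open>The inverse supplies an arrow of \<open>A\<close> that \<open>K\<close> sends
      to \<open>g\<close>, so a single member of the family covers.\<close>
    have Gg: "amap G g \<in> hom A i j" using G.amap_hom[OF g] o ij by simp
    have e: "amap K (amap G g) = g" using a(2)[OF hom_Arr[OF g]] .
    have "Rst B g \<in> (\<lambda>f. eqz B g (amap K f)) ` hom A i j"
      using Gg e K.B.eqz_refl[OF g] by (auto simp: image_iff intro!: bexI[of _ "amap G g"])
    moreover have "(\<lambda>f. eqz B g (amap K f)) ` hom A i j \<subseteq> rest_idem B (omap K i)"
      using K.B.eqz_idem[OF g K.amap_hom] by blast
    ultimately have "le B (Rst B g) (osup B (omap K i) ((\<lambda>f. eqz B g (amap K f)) ` hom A i j))"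
      using K.omap_Obj[OF ij(1)] by (rule K.B.osup_upper)
    then show "is_join B (omap K i) (omap K j) ((\<lambda>f. meet B g (amap K f)) ` hom A i j) g"
      using K.is_join_meets_iff[OF g] by blast
  qed
qed

section \<open>Orthogonality\<close>

context join_restriction_category
begin

lemma le_eqzI:
  assumes f: "f \<in> hom C i j" and g: "g \<in> hom C i j" and w: "le C w (Rst C f)"
    and eq: "f \<odot> w = g \<odot> w"
  shows "le C w (eqz C f g)"
proof -
  have wi: "w \<in> rest_idem C i" by (rule le_idem[OF w Rst_idem[OF f]])
  have "Rst C g \<odot> w = w"
    using Rst_comp_of_idem_le[OF f w] eq Rst_comp_idem[OF g wi] by metis
  then have "le C w (Rst C g)" using idem_le_iff[OF wi Rst_idem[OF g]] by simp
  with w eq show ?thesis using le_eqz_iff[OF f g] by blast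
qed

text \<open>Two replacements in turn: \<open>g\<close> by \<open>g'\<close>, using [g = g'] pulled
  back along \<open>f\<close>, and then \<open>f\<close> by \<open>f'\<close> inside
  \<open>g'\<close>. The first also shows that \<open>w\<close> lies in the domain of the
  composite.\<close>

lemma eqz_comp_le:
  assumes f: "f \<in> hom C i j" and f': "f' \<in> hom C i j" and g: "g \<in> hom C j k" and g': "g' \<in> hom C j k"
    and w: "le C w (eqz C f f')" and w': "le C w (pull C f (eqz C g g'))"
  shows "le C w (eqz C (g \<odot> f) (g' \<odot> f'))"
proof (rule le_eqzI[OF Comp_closed[OF f g] Comp_closed[OF f' g']])
  have e: "le C w (eqz C (g \<odot> f) (g' \<odot> f))"
    using le_trans[OF w' pull_eqz_le[OF f g g']] .
  then show "le C w (Rst C (g \<odot> f))"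
    using le_eqz_iff[OF Comp_closed[OF f g] Comp_closed[OF f g']] by blast
  have wh: "w \<in> hom C i i" by (rule idem_hom[OF le_idem[OF w eqz_idem[OF f f']]])
  have "(g \<odot> f) \<odot> w = (g' \<odot> f) \<odot> w" "f \<odot> w = f' \<odot> w"
    using e w le_eqz_iff[OF Comp_closed[OF f g] Comp_closed[OF f g']] le_eqz_iff[OF f f'] by auto
  then show "(g \<odot> f) \<odot> w = (g' \<odot> f') \<odot> w"
    using Comp_assoc[OF wh f g'] Comp_assoc[OF wh f' g'] by simp
qed

end

locale lifting_square =
  A: join_restriction_category A + B: join_restriction_category B +
  C: join_restriction_category C + D: join_restriction_category D +
  F: jr_map A C F + G: jr_map B D G + L: jr_map A B L + H: jr_map C D H
  for A :: "('o1, 'm1) rcat" and B :: "('o2, 'm2) rcat"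
    and C :: "('o3, 'm3) rcat" and D :: "('o4, 'm4) rcat" and F G L H +
  assumes localic: "localic A B L" and hyperconnected: "hyperconnected C D H"
    and square: "comp_ftor A H F = comp_ftor A G L"
begin

lemma square_omap: "i \<in> Obj A \<Longrightarrow> omap H (omap F i) = omap G (omap L i)"
  using square omap_comp_ftor by metis

lemma square_amap: "f \<in> hom A i j \<Longrightarrow> amap H (amap F f) = amap G (amap L f)"
  using square amap_comp_ftor hom_Arr by metis

section \<open>Transport of opens from \<open>L i\<close> to \<open>F i\<close>\<close>

text \<open>Any filler \<open>J\<close> has to act on opens in this way, since
  \<open>H J = G\<close> and \<open>H\<close> is injective on the opens of each object. The
  parameter \<open>i\<close> is an object of \<open>A\<close>, so that inverting \<open>L\<close> on
  objects is left to \<open>src\<close>.\<close>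

definition transport :: "'o1 \<Rightarrow> 'm2 \<Rightarrow> 'm3" where
  "transport i u = inv_into (rest_idem C (omap F i)) (amap H) (amap G u)"

lemma H_bij: "i \<in> Obj A \<Longrightarrow>
    bij_betw (amap H) (rest_idem C (omap F i)) (rest_idem D (omap G (omap L i)))"
  using hyperconnected F.omap_Obj[of i] square_omap[of i] unfolding hyperconnected_def by metis

lemma transport_idem:
  assumes i: "i \<in> Obj A" and u: "u \<in> rest_idem B (omap L i)"
  shows "transport i u \<in> rest_idem C (omap F i)" "amap H (transport i u) = amap G u"
proof -
  have "amap G u \<in> amap H ` rest_idem C (omap F i)"
    using G.amap_idem[OF u] H_bij[OF i] by (simp add: bij_betw_def)
  then show "transport i u \<in> rest_idem C (omap F i)" "amap H (transport i u) = amap G u"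
    unfolding transport_def by (rule inv_into_into, rule f_inv_into_f)
qed

lemma transport_unique:
  assumes i: "i \<in> Obj A" and d: "d \<in> rest_idem C (omap F i)" and e: "amap H d = amap G u"
  shows "transport i u = d"
  unfolding transport_def using H_bij[OF i] d e
  by (metis bij_betw_def inv_into_f_f)

text \<open>A monotone bijection may fail to have a monotone inverse; here \<open>H\<close> is used
  as an order isomorphism on opens.\<close>

lemma transport_mono:
  assumes i: "i \<in> Obj A" and v: "v \<in> rest_idem B (omap L i)" and uv: "le B u v"
  shows "le C (transport i u) (transport i v)"
proof -
  have u: "u \<in> rest_idem B (omap L i)" by (rule B.le_idem[OF uv v])
  show ?thesis
    using hyperconnected F.omap_Obj[OF i] transport_idem[OF i u] transport_idem[OF i v] G.amap_le[OF uv]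
    by (simp add: hyperconnected_def)
qed

lemma transport_comp:
  assumes i: "i \<in> Obj A" and u: "u \<in> rest_idem B (omap L i)" and v: "v \<in> rest_idem B (omap L i)"
  shows "transport i (u \<odot>\<^bsub>B\<^esub> v) = transport i u \<odot>\<^bsub>C\<^esub> transport i v"
  using H.amap_comp[OF idem_hom idem_hom, OF transport_idem(1)[OF i v] transport_idem(1)[OF i u]]
    G.amap_comp[OF idem_hom[OF v] idem_hom[OF u]] transport_idem(2)[OF i u] transport_idem(2)[OF i v]
  by (intro transport_unique[OF i C.idem_comp[OF transport_idem(1)[OF i u] transport_idem(1)[OF i v]]]) simp

lemma transport_L: "u \<in> rest_idem A i \<Longrightarrow> transport i (amap L u) = amap F u"
  using transport_unique[OF A.hom_Obj(1)[OF idem_hom] F.amap_idem] square_amap[OF idem_hom] by metis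

lemma transport_osup:
  assumes i: "i \<in> Obj A" and U: "U \<subseteq> rest_idem B (omap L i)"
  shows "transport i (osup B (omap L i) U) = osup C (omap F i) (transport i ` U)"
proof (rule transport_unique[OF i])
  have TU: "transport i ` U \<subseteq> rest_idem C (omap F i)" using U transport_idem(1)[OF i] by blast
  show "osup C (omap F i) (transport i ` U) \<in> rest_idem C (omap F i)"
    by (rule C.osup_idem[OF TU F.omap_Obj[OF i]])
  have "amap H ` transport i ` U = amap G ` U"
    using U transport_idem(2)[OF i] by (force simp: image_iff)
  then show "amap H (osup C (omap F i) (transport i ` U)) = amap G (osup B (omap L i) U)"
    using H.amap_osup[OF TU F.omap_Obj[OF i]] G.amap_osup[OF U L.omap_Obj[OF i]] square_omap[OF i]
    by simp
qed

text \<open>The first condition on a localic functor, read on domains. \<open>F\<close> gives only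
  the inclusion \<open>amap_eqz_le\<close>, which is why agreement is established in
  \<open>B\<close> and then transported.\<close>

lemma L_eqz:
  assumes f: "f \<in> hom A i j" and g: "g \<in> hom A i j"
  shows "amap L (eqz A f g) = eqz B (amap L f) (amap L g)"
proof -
  have "meet B (amap L f) (amap L g) = amap L (meet A f g)"
    using localic A.hom_Obj[OF f] f g unfolding localic_def by blast
  then show ?thesis using L.amap_Rst[OF A.meet_hom[OF f g]] by (simp add: eqz_def)
qed

lemma L_cover:
  assumes i: "i \<in> Obj A" and j: "j \<in> Obj A" and b: "b \<in> hom B (omap L i) (omap L j)"
  shows "osup B (omap L i) ((\<lambda>f. eqz B b (amap L f)) ` hom A i j) = Rst B b"
proof -
  have "is_join B (omap L i) (omap L j) ((\<lambda>f. meet B b (amap L f)) ` hom A i j) b"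
    using localic i j b unfolding localic_def by blast
  from B.Rst_join[OF this] show ?thesis by (simp add: image_image eqz_def)
qed

section \<open>The lift of a single arrow\<close>

text \<open>The open of \<open>F i\<close> over which the lift of \<open>b\<close> has to coincide
  with \<open>F f\<close>.\<close>

definition agree :: "'o1 \<Rightarrow> 'm2 \<Rightarrow> 'm1 \<Rightarrow> 'm3" where
  "agree i b f = transport i (eqz B b (amap L f))"

lemma agree_le:
  assumes f: "f \<in> hom A i j" and b: "b \<in> hom B (omap L i) (omap L j)"
  shows "le C (agree i b f) (Rst C (amap F f))"
proof -
  note i = A.hom_Obj(1)[OF f]
  have "le C (agree i b f) (transport i (amap L (Rst A f)))"
    unfolding agree_def
    using transport_mono[OF i B.Rst_idem[OF L.amap_hom[OF f]] B.eqz_le_Rst(2)[OF b L.amap_hom[OF f]]]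
      L.amap_Rst[OF f] by simp
  then show ?thesis using transport_L[OF A.Rst_idem[OF f]] F.amap_Rst[OF f] by simp
qed

lemma agree_idem:
  assumes f: "f \<in> hom A i j" and b: "b \<in> hom B (omap L i) (omap L j)"
  shows "agree i b f \<in> rest_idem C (omap F i)"
  by (rule C.le_idem[OF agree_le[OF f b] C.Rst_idem[OF F.amap_hom[OF f]]])

lemma agree_cover:
  assumes i: "i \<in> Obj A" and j: "j \<in> Obj A" and b: "b \<in> hom B (omap L i) (omap L j)"
  shows "osup C (omap F i) (agree i b ` hom A i j) = transport i (Rst B b)"
proof -
  have "(\<lambda>f. eqz B b (amap L f)) ` hom A i j \<subseteq> rest_idem B (omap L i)"
    using B.eqz_idem[OF b L.amap_hom] by blast
  from transport_osup[OF i this] show ?thesis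
    using L_cover[OF i j b] by (simp add: image_image agree_def)
qed

text \<open>On the overlap of [b = L f] and [b = L g] the maps \<open>L f\<close> and
  \<open>L g\<close> agree, so the overlap lies in L [f = g]. By commutativity of the square this is
  transported to F [f = g], on which \<open>F f\<close> and \<open>F g\<close> coincide.\<close>

lemma lift_exists:
  assumes i: "i \<in> Obj A" and j: "j \<in> Obj A" and b: "b \<in> hom B (omap L i) (omap L j)"
  shows "\<exists>s. is_join C (omap F i) (omap F j)
    ((\<lambda>f. amap F f \<odot>\<^bsub>C\<^esub> agree i b f) ` hom A i j) s"
proof (rule C.glue_exists[OF F.omap_Obj[OF i] F.omap_Obj[OF j] F.amap_hom agree_le[OF _ b]])
  fix f g assume f: "f \<in> hom A i j" and g: "g \<in> hom A i j"
  let ?u = "eqz B b (amap L f)" and ?v = "eqz B b (amap L g)"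
  have u: "?u \<in> rest_idem B (omap L i)" and v: "?v \<in> rest_idem B (omap L i)"
    using B.eqz_idem[OF b L.amap_hom] f g by auto
  have "le B (?u \<odot>\<^bsub>B\<^esub> ?v) ?u \<and> le B (?u \<odot>\<^bsub>B\<^esub> ?v) ?v"
    using B.le_idem_comp_iff[OF u v] B.le_refl[OF idem_hom[OF B.idem_comp[OF u v]]] by simp
  then have "le B (?u \<odot>\<^bsub>B\<^esub> ?v) (amap L (eqz A f g))"
    using B.eqz_trans[OF L.amap_hom[OF f] b L.amap_hom[OF g]] B.eqz_commute[OF b L.amap_hom[OF f]]
      L_eqz[OF f g] by simp
  from transport_mono[OF i L.amap_idem[OF A.eqz_idem[OF f g]] this]
  have "le C (agree i b f \<odot>\<^bsub>C\<^esub> agree i b g) (amap F (eqz A f g))"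
    using transport_comp[OF i u v] transport_L[OF A.eqz_idem[OF f g]] by (simp add: agree_def)
  then show "amap F f \<odot>\<^bsub>C\<^esub> (agree i b f \<odot>\<^bsub>C\<^esub> agree i b g) =
      amap F g \<odot>\<^bsub>C\<^esub> (agree i b f \<odot>\<^bsub>C\<^esub> agree i b g)"
    by (rule F.amap_agree[OF f g])
qed

definition lift :: "'o1 \<Rightarrow> 'o1 \<Rightarrow> 'm2 \<Rightarrow> 'm3" where
  "lift i j b = (SOME s. is_join C (omap F i) (omap F j)
    ((\<lambda>f. amap F f \<odot>\<^bsub>C\<^esub> agree i b f) ` hom A i j) s)"

context
  fixes i j b
  assumes i: "i \<in> Obj A" and j: "j \<in> Obj A" and b: "b \<in> hom B (omap L i) (omap L j)"
begin

lemma lift_join: "is_join C (omap F i) (omap F j)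
    ((\<lambda>f. amap F f \<odot>\<^bsub>C\<^esub> agree i b f) ` hom A i j) (lift i j b)"
  unfolding lift_def by (rule someI_ex[OF lift_exists[OF i j b]])

lemma lift_hom: "lift i j b \<in> hom C (omap F i) (omap F j)"
  using lift_join by (simp add: is_join_def)

lemma lift_Rst: "Rst C (lift i j b) = transport i (Rst B b)"
  using C.glue_props(2)[OF lift_join F.amap_hom agree_le[OF _ b]] agree_cover[OF i j b] by simp

lemma lift_agree:
  assumes f: "f \<in> hom A i j"
  shows "le C (agree i b f) (eqz C (lift i j b) (amap F f))"
proof -
  have "le C (agree i b f) (transport i (Rst B b))"
    unfolding agree_def
    by (rule transport_mono[OF i B.Rst_idem[OF b] B.eqz_le_Rst(1)[OF b L.amap_hom[OF f]]])
  then show ?thesis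
    using C.glue_props(3)[OF lift_join F.amap_hom agree_le[OF _ b] f] lift_Rst
    by (intro C.le_eqzI[OF lift_hom F.amap_hom[OF f]]) simp_all
qed

text \<open>The form in which the gluing is used: the value of \<open>lift\<close> on composites, on
  opens and on arrows \<open>L x\<close>, and the comparison with another filler, are all found by
  testing a candidate \<open>t\<close> on the opens \<open>agree i b f\<close> and bounding its
  domain.\<close>

lemma lift_unique:
  assumes t: "t \<in> hom C (omap F i) (omap F j)"
    and eq: "\<And>f. f \<in> hom A i j \<Longrightarrow> t \<odot>\<^bsub>C\<^esub> agree i b f = amap F f \<odot>\<^bsub>C\<^esub> agree i b f"
    and rst: "le C (Rst C t) (transport i (Rst B b))"
  shows "lift i j b = t"
  using C.glue_unique[OF lift_join t F.amap_hom agree_le[OF _ b] eq] rst agree_cover[OF i j b] by simp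

text \<open>\<open>H\<close> sends the piece of the gluing at \<open>f\<close> to \<open>G\<close>
  of the meet of \<open>b\<close> and \<open>L f\<close>, so \<open>H (lift i j b)\<close> and
  \<open>G b\<close> are joins of one and the same family.\<close>

lemma H_lift: "amap H (lift i j b) = amap G b"
proof -
  have "is_join B (omap L i) (omap L j) ((\<lambda>f. meet B b (amap L f)) ` hom A i j) b"
    using localic i j b unfolding localic_def by blast
  note Gb = G.amap_join[OF this]
  have "amap H (amap F f \<odot>\<^bsub>C\<^esub> agree i b f) = amap G (meet B b (amap L f))"
    if f: "f \<in> hom A i j" for f
  proof -
    note e = B.eqz_idem[OF b L.amap_hom[OF f]]
    have "amap H (amap F f \<odot>\<^bsub>C\<^esub> agree i b f) = amap G (amap L f) \<odot>\<^bsub>D\<^esub> amap G (eqz B b (amap L f))"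
      using H.amap_comp[OF idem_hom[OF agree_idem[OF f b]] F.amap_hom[OF f]] square_amap[OF f]
        transport_idem(2)[OF i e] by (simp add: agree_def)
    also have "\<dots> = amap G (meet B b (amap L f))"
      using G.amap_comp[OF idem_hom[OF e] L.amap_hom[OF f]] B.meet_eqz(2)[OF b L.amap_hom[OF f]] by simp
    finally show ?thesis .
  qed
  then have "amap H ` (\<lambda>f. amap F f \<odot>\<^bsub>C\<^esub> agree i b f) ` hom A i j =
      amap G ` (\<lambda>f. meet B b (amap L f)) ` hom A i j"
    by (auto simp: image_image)
  with Gb have "is_join D (omap H (omap F i)) (omap H (omap F j))
      (amap H ` (\<lambda>f. amap F f \<odot>\<^bsub>C\<^esub> agree i b f) ` hom A i j) (amap G b)"
    using square_omap[OF i] square_omap[OF j] by simp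
  with H.amap_join[OF lift_join] show ?thesis by (rule D.is_join_unique)
qed

text \<open>Both sides are opens of \<open>F i\<close> with the same image under \<open>H\<close>,
  which is injective on opens.\<close>

lemma lift_pull:
  assumes v: "v \<in> rest_idem B (omap L j)"
  shows "pull C (lift i j b) (transport j v) = transport i (pull B b v)"
proof -
  note tv = transport_idem[OF j v]
  have "amap H (pull C (lift i j b) (transport j v)) = amap G (pull B b v)"
    using H.amap_pull[OF lift_hom tv(1)] tv(2) H_lift G.amap_pull[OF b v] by simp
  from transport_unique[OF i C.pull_idem[OF lift_hom tv(1)] this] show ?thesis by simp
qed

end

text \<open>On [b' b = L h] the composite of the lifts must be \<open>F h\<close>. Locally
  \<open>b\<close> is \<open>L f\<close> and, along \<open>b\<close>, \<open>b'\<close> is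
  \<open>L g\<close>. There the composite of the lifts is \<open>F (g f)\<close>, while
  \<open>L (g f)\<close> agrees with \<open>L h\<close>. This agreement takes place inside L
  [g f = h], and \<open>F (g f)\<close> coincides with \<open>F h\<close> on F [g f = h].\<close>

lemma lift_comp:
  assumes i: "i \<in> Obj A" and j: "j \<in> Obj A" and k: "k \<in> Obj A"
    and b: "b \<in> hom B (omap L i) (omap L j)" and b': "b' \<in> hom B (omap L j) (omap L k)"
  shows "lift i k (b' \<odot>\<^bsub>B\<^esub> b) = lift j k b' \<odot>\<^bsub>C\<^esub> lift i j b"
proof (rule lift_unique[OF i k B.Comp_closed[OF b b']])
  note lb = lift_hom[OF i j b] and lb' = lift_hom[OF j k b']
  note bb = B.Comp_closed[OF b b'] and lbb = C.Comp_closed[OF lb lb']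
  show "lift j k b' \<odot>\<^bsub>C\<^esub> lift i j b \<in> hom C (omap F i) (omap F k)" by (rule lbb)
  have rst: "Rst C (lift j k b' \<odot>\<^bsub>C\<^esub> lift i j b) = transport i (Rst B (b' \<odot>\<^bsub>B\<^esub> b))"
    using C.pull_Rst[OF lb lb'] lift_Rst[OF j k b'] lift_pull[OF i j b B.Rst_idem[OF b']]
      B.pull_Rst[OF b b'] by simp
  then show "le C (Rst C (lift j k b' \<odot>\<^bsub>C\<^esub> lift i j b)) (transport i (Rst B (b' \<odot>\<^bsub>B\<^esub> b)))"
    using C.le_refl[OF C.Rst_closed[OF lbb]] by simp
  fix h assume h: "h \<in> hom A i k"
  let ?e = "agree i (b' \<odot>\<^bsub>B\<^esub> b) h" and ?z = "eqz C (lift j k b' \<odot>\<^bsub>C\<^esub> lift i j b) (amap F h)"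
  note z = C.eqz_idem[OF lbb F.amap_hom[OF h]]
  have E: "eqz B (b' \<odot>\<^bsub>B\<^esub> b) (amap L h) \<in> rest_idem B (omap L i)"
    by (rule B.eqz_idem[OF bb L.amap_hom[OF h]])
  have eR: "le C ?e (transport i (Rst B (b' \<odot>\<^bsub>B\<^esub> b)))"
    unfolding agree_def
    by (rule transport_mono[OF i B.Rst_idem[OF bb] B.eqz_le_Rst(1)[OF bb L.amap_hom[OF h]]])
  have "le C (transport i (Rst B (b' \<odot>\<^bsub>B\<^esub> b))) (transport i (Rst B b))"
    by (rule transport_mono[OF i B.Rst_idem[OF b] B.Rst_comp_le[OF b b']])
  from C.le_trans[OF eR this] have "le C ?e (osup C (omap F i) (agree i b ` hom A i j))"
    using agree_cover[OF i j b] by simp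
  then have "le C ?e ?z"
  proof (rule C.osup_elim[OF _ _ z])
    show "agree i b ` hom A i j \<subseteq> rest_idem C (omap F i)"
      using agree_idem[OF _ b] by blast
    fix v u assume ve: "le C v ?e" and "u \<in> agree i b ` hom A i j" and "le C v u"
    then obtain f where f: "f \<in> hom A i j" and vf: "le C v (agree i b f)" by blast
    have "le C v (pull C (lift i j b) (osup C (omap F j) (agree j b' ` hom A j k)))"
      using C.le_trans[OF ve eR] agree_cover[OF j k b'] lift_pull[OF i j b B.Rst_idem[OF b']]
        B.pull_Rst[OF b b'] by simp
    then show "le C v ?z"
    proof (rule C.pull_osup_elim[OF _ lb _ z])
      show "agree j b' ` hom A j k \<subseteq> rest_idem C (omap F j)"
        using agree_idem[OF _ b'] by blast
      fix w u assume wv: "le C w v" and "u \<in> agree j b' ` hom A j k"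
        and "le C w (pull C (lift i j b) u)"
      then obtain g where g: "g \<in> hom A j k"
        and wg: "le C w (pull C (lift i j b) (agree j b' g))" by blast
      have gf: "g \<odot>\<^bsub>A\<^esub> f \<in> hom A i k" by (rule A.Comp_closed[OF f g])
      let ?Lf = "amap L f" and ?Lg = "amap L g" and ?Lh = "amap L h"
      note Lf = L.amap_hom[OF f] and Lg = L.amap_hom[OF g] and Lh = L.amap_hom[OF h]
      let ?E = "eqz B (b' \<odot>\<^bsub>B\<^esub> b) ?Lh" and ?Ef = "eqz B b ?Lf" and ?Eg = "pull B b (eqz B b' ?Lg)"
      have Ef: "?Ef \<in> rest_idem B (omap L i)" by (rule B.eqz_idem[OF b Lf])
      have Eg0: "eqz B b' ?Lg \<in> rest_idem B (omap L j)" by (rule B.eqz_idem[OF b' Lg])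
      have Eg: "?Eg \<in> rest_idem B (omap L i)" by (rule B.pull_idem[OF b Eg0])
      have EE: "?E \<odot>\<^bsub>B\<^esub> ?Ef \<in> rest_idem B (omap L i)" by (rule B.idem_comp[OF E Ef])
      \<comment> \<open>The three regions containing \<open>w\<close> are intersected in
        \<open>B\<close>, before transport, because it is there that \<open>L_eqz\<close> turns
        agreement of \<open>L (g f)\<close> and \<open>L h\<close> into the open L
        [g f = h].\<close>
      define X where "X = (?E \<odot>\<^bsub>B\<^esub> ?Ef) \<odot>\<^bsub>B\<^esub> ?Eg"
      have X: "X \<in> rest_idem B (omap L i)" unfolding X_def by (rule B.idem_comp[OF EE Eg])
      have "le B X X" by (rule B.le_refl[OF idem_hom[OF X]])
      then have XE: "le B X ?E" and Xf: "le B X ?Ef" and Xg: "le B X ?Eg"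
        unfolding X_def[symmetric]
        using B.le_idem_comp_iff[OF EE Eg] B.le_idem_comp_iff[OF E Ef] by (auto simp: X_def)
      have Lgf: "amap L (g \<odot>\<^bsub>A\<^esub> f) = ?Lg \<odot>\<^bsub>B\<^esub> ?Lf" by (rule L.amap_comp[OF f g])
      have "le B X (eqz B (b' \<odot>\<^bsub>B\<^esub> b) (?Lg \<odot>\<^bsub>B\<^esub> ?Lf))"
        by (rule B.eqz_comp_le[OF b Lf b' Lg Xf Xg])
      then have "le B X (amap L (eqz A (g \<odot>\<^bsub>A\<^esub> f) h))"
        using XE B.eqz_trans[OF L.amap_hom[OF gf] bb Lh, of X] B.eqz_commute[OF bb L.amap_hom[OF gf]]
          Lgf L_eqz[OF gf h] by simp
      from transport_mono[OF i L.amap_idem[OF A.eqz_idem[OF gf h]] this]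
      have tX: "le C (transport i X) (amap F (eqz A (g \<odot>\<^bsub>A\<^esub> f) h))"
        using transport_L[OF A.eqz_idem[OF gf h]] by simp
      have we: "le C w ?e" and wf: "le C w (agree i b f)"
        using wv ve vf C.le_trans by blast+
      have "le C w (transport i X)"
        unfolding X_def transport_comp[OF i EE Eg] transport_comp[OF i E Ef]
        using we wf wg lift_pull[OF i j b Eg0]
          C.le_idem_comp_iff[OF C.idem_comp[OF transport_idem(1)[OF i E] transport_idem(1)[OF i Ef]] transport_idem(1)[OF i Eg]]
          C.le_idem_comp_iff[OF transport_idem(1)[OF i E] transport_idem(1)[OF i Ef]]
        by (simp add: agree_def)
      then have 2: "le C w (eqz C (amap F (g \<odot>\<^bsub>A\<^esub> f)) (amap F h))"
        using tX F.amap_eqz_le[OF gf h] C.le_trans by blast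
      have "le C w (eqz C (lift i j b) (amap F f))"
        using wf lift_agree[OF i j b f] C.le_trans by blast
      moreover have "le C w (pull C (lift i j b) (eqz C (lift j k b') (amap F g)))"
        using wg C.pull_mono[OF lift_agree[OF j k b' g] C.eqz_idem[OF lb' F.amap_hom[OF g]] lb] C.le_trans
        by blast
      ultimately have 1: "le C w (eqz C (lift j k b' \<odot>\<^bsub>C\<^esub> lift i j b) (amap F (g \<odot>\<^bsub>A\<^esub> f)))"
        using C.eqz_comp_le[OF lb F.amap_hom[OF f] lb' F.amap_hom[OF g]] F.amap_comp[OF f g] by simp
      show "le C w ?z"
        by (rule C.eqz_trans[OF lbb F.amap_hom[OF gf] F.amap_hom[OF h] 1 2])
    qed
  qed
  then show "(lift j k b' \<odot>\<^bsub>C\<^esub> lift i j b) \<odot>\<^bsub>C\<^esub> ?e = amap F h \<odot>\<^bsub>C\<^esub> ?e"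
    using C.le_eqz_iff[OF lbb F.amap_hom[OF h]] by blast
qed

text \<open>Since \<open>u\<close> lies below the identity, [u = L f] lies in L [Ide = f], so
  \<open>F f\<close> is an identity over its transport. The action of the filler on identities,
  restrictions and joins is then read off from \<open>transport\<close>.\<close>

lemma lift_idem:
  assumes i: "i \<in> Obj A" and u: "u \<in> rest_idem B (omap L i)"
  shows "lift i i u = transport i u"
proof (rule lift_unique[OF i i idem_hom[OF u]])
  note tu = transport_idem(1)[OF i u]
  show "transport i u \<in> hom C (omap F i) (omap F i)" by (rule idem_hom[OF tu])
  show "le C (Rst C (transport i u)) (transport i (Rst B u))"
    using idem_Rst[OF u] idem_Rst[OF tu] C.le_refl[OF idem_hom[OF tu]] by simp
  fix f assume f: "f \<in> hom A i i"
  note Ii = A.Ide_closed[OF i] and uh = idem_hom[OF u]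
  note e = B.eqz_idem[OF uh L.amap_hom[OF f]]
  have "le B (eqz B u (amap L f)) (eqz B (Ide B (omap L i)) (amap L f))"
    using B.le_eqz_of_le[OF B.idem_le_Ide[OF u] B.Ide_closed[OF L.omap_Obj[OF i]] L.amap_hom[OF f]]
      B.le_refl[OF idem_hom[OF e]] by blast
  then have "le B (eqz B u (amap L f)) (amap L (eqz A (Ide A i) f))"
    using L_eqz[OF Ii f] L.amap_Ide[OF i] by simp
  from transport_mono[OF i L.amap_idem[OF A.eqz_idem[OF Ii f]] this]
  have "le C (agree i u f) (amap F (eqz A (Ide A i) f))"
    using transport_L[OF A.eqz_idem[OF Ii f]] by (simp add: agree_def)
  from F.amap_agree[OF Ii f this]
  have 1: "amap F f \<odot>\<^bsub>C\<^esub> agree i u f = agree i u f"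
    using F.amap_Ide[OF i] C.Comp_Ide_left[OF idem_hom[OF agree_idem[OF f uh]]] by simp
  have "le C (agree i u f) (transport i u)"
    unfolding agree_def using transport_mono[OF i u] B.eqz_le_Rst(1)[OF uh L.amap_hom[OF f]]
      idem_Rst[OF u] by simp
  then show "transport i u \<odot>\<^bsub>C\<^esub> agree i u f = amap F f \<odot>\<^bsub>C\<^esub> agree i u f"
    using 1 C.idem_le_iff[OF agree_idem[OF f uh] tu] by simp
qed

lemma lift_L:
  assumes x: "x \<in> hom A i j"
  shows "lift i j (amap L x) = amap F x"
proof (rule lift_unique[OF A.hom_Obj[OF x] L.amap_hom[OF x] F.amap_hom[OF x]])
  show "le C (Rst C (amap F x)) (transport i (Rst B (amap L x)))"
    using L.amap_Rst[OF x] F.amap_Rst[OF x] transport_L[OF A.Rst_idem[OF x]]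
      C.le_refl[OF C.Rst_closed[OF F.amap_hom[OF x]]] by simp
  fix f assume f: "f \<in> hom A i j"
  have e: "agree i (amap L x) f = amap F (eqz A x f)"
    unfolding agree_def using L_eqz[OF x f] transport_L[OF A.eqz_idem[OF x f]] by simp
  show "amap F x \<odot>\<^bsub>C\<^esub> agree i (amap L x) f = amap F f \<odot>\<^bsub>C\<^esub> agree i (amap L x) f"
    unfolding e
    by (rule F.amap_agree[OF x f C.le_refl[OF idem_hom[OF F.amap_idem[OF A.eqz_idem[OF x f]]]]])
qed

section \<open>The diagonal functor and its uniqueness\<close>

definition src :: "'o2 \<Rightarrow> 'o1" where
  "src y = inv_into (Obj A) (omap L) y"

lemma L_bij: "bij_betw (omap L) (Obj A) (Obj B)"
  using localic by (simp add: localic_def)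

lemma src_Obj: "y \<in> Obj B \<Longrightarrow> src y \<in> Obj A" "y \<in> Obj B \<Longrightarrow> omap L (src y) = y"
  unfolding src_def using L_bij by (auto simp: bij_betw_def inv_into_into f_inv_into_f)

lemma src_L: "i \<in> Obj A \<Longrightarrow> src (omap L i) = i"
  unfolding src_def using L_bij by (simp add: bij_betw_def)

definition lift_ftor :: "('o2, 'm2, 'o3, 'm3) ftor" where
  "lift_ftor = \<lparr>omap = restrict (\<lambda>y. omap F (src y)) (Obj B),
    amap = restrict (\<lambda>b. lift (src (Dom B b)) (src (Cod B b)) b) (Arr B)\<rparr>"

lemma lift_ftor_omap: "y \<in> Obj B \<Longrightarrow> omap lift_ftor y = omap F (src y)"
  by (simp add: lift_ftor_def)

lemma lift_ftor_amap: "b \<in> hom B y z \<Longrightarrow> amap lift_ftor b = lift (src y) (src z) b"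
  by (auto simp: lift_ftor_def hom_def)

lemma hom_src:
  assumes "b \<in> hom B y z"
  shows "src y \<in> Obj A" "src z \<in> Obj A" "b \<in> hom B (omap L (src y)) (omap L (src z))"
  using assms src_Obj B.hom_Obj[OF assms] by auto

lemma lift_ftor_idem:
  assumes u: "u \<in> rest_idem B y"
  shows "amap lift_ftor u = transport (src y) u"
  using lift_ftor_amap[OF idem_hom[OF u]] lift_idem[of "src y" u] u hom_src[OF idem_hom[OF u]]
    src_Obj B.hom_Obj[OF idem_hom[OF u]] by simp

lemma lift_ftor_jr: "jr_functor B C lift_ftor"
proof (rule jr_functorI[OF B.join_restriction_category_axioms C.join_restriction_category_axioms])
  show "omap lift_ftor \<in> Obj B \<rightarrow>\<^sub>E Obj C"
    using F.omap_Obj src_Obj by (auto simp: lift_ftor_def)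
  show "amap lift_ftor \<in> extensional (Arr B)"
    by (simp add: lift_ftor_def)
  show "amap lift_ftor b \<in> hom C (omap lift_ftor y) (omap lift_ftor z)"
    if b: "b \<in> hom B y z" for b y z
    using lift_hom[OF hom_src[OF b]] lift_ftor_amap[OF b] lift_ftor_omap B.hom_Obj[OF b] by simp
  show "amap lift_ftor (Ide B y) = Ide C (omap lift_ftor y)" if y: "y \<in> Obj B" for y
    using lift_ftor_idem[OF B.Ide_idem[OF y]] transport_L[OF A.Ide_idem[OF src_Obj(1)[OF y]]]
      L.amap_Ide[OF src_Obj(1)[OF y]] F.amap_Ide[OF src_Obj(1)[OF y]] src_Obj(2)[OF y]
      lift_ftor_omap[OF y] by simp
  show "amap lift_ftor (c \<odot>\<^bsub>B\<^esub> b) = amap lift_ftor c \<odot>\<^bsub>C\<^esub> amap lift_ftor b"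
    if b: "b \<in> hom B y z" and c: "c \<in> hom B z x" for b c y z x
    using lift_comp[OF hom_src(1,2)[OF b] hom_src(2)[OF c] hom_src(3)[OF b] hom_src(3)[OF c]]
      lift_ftor_amap[OF b] lift_ftor_amap[OF c] lift_ftor_amap[OF B.Comp_closed[OF b c]] by simp
  show "amap lift_ftor (Rst B b) = Rst C (amap lift_ftor b)" if b: "b \<in> hom B y z" for b y z
    using lift_ftor_idem[OF B.Rst_idem[OF b]] lift_Rst[OF hom_src[OF b]] lift_ftor_amap[OF b] by simp
  \<comment> \<open>Only opens are left to check, and on these the functor is
    \<open>transport\<close>, which preserves joins.\<close>
  fix y z S s assume s: "is_join B y z S s"
  then have sh: "s \<in> hom B y z" and S: "S \<subseteq> hom B y z" by (auto simp: is_join_def)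
  note y = B.hom_Obj(1)[OF sh]
  have RS: "Rst B ` S \<subseteq> rest_idem B (omap L (src y))"
    using S B.Rst_idem src_Obj(2)[OF y] by auto
  have "(\<lambda>f. amap lift_ftor (Rst B f)) ` S = transport (src y) ` Rst B ` S"
    using lift_ftor_idem[OF B.Rst_idem] S by (force simp: image_iff)
  then have "amap lift_ftor (Rst B s) =
      osup C (omap lift_ftor y) ((\<lambda>f. amap lift_ftor (Rst B f)) ` S)"
    using lift_ftor_idem[OF B.Rst_idem[OF sh]] B.Rst_join[OF s] transport_osup[OF src_Obj(1)[OF y] RS]
      src_Obj(2)[OF y] lift_ftor_omap[OF y] by simp
  moreover have "amap lift_ftor (Rst B s) \<in> rest_idem C (omap F (src y))"
    using lift_ftor_idem[OF B.Rst_idem[OF sh]] transport_idem(1)[OF src_Obj(1)[OF y], of "Rst B s"]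
      B.Rst_idem[OF sh] src_Obj(2)[OF y] by simp
  ultimately show "le C (amap lift_ftor (Rst B s))
      (osup C (omap lift_ftor y) ((\<lambda>f. amap lift_ftor (Rst B f)) ` S))"
    using C.le_refl[OF idem_hom] by metis
qed

lemma lift_ftor_L: "comp_ftor A lift_ftor L = F"
proof (rule ftor.equality)
  show "omap (comp_ftor A lift_ftor L) = omap F"
  proof (rule extensionalityI[of _ "Obj A"])
    show "omap F \<in> extensional (Obj A)"
      by (rule F.omap_extensional)
  qed (auto simp: comp_ftor_def lift_ftor_omap L.omap_Obj src_L)
  show "amap (comp_ftor A lift_ftor L) = amap F"
  proof (rule extensionalityI[of _ "Arr A"])
    show "amap F \<in> extensional (Arr A)"
      by (rule F.amap_extensional)
    fix f assume f: "f \<in> Arr A"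
    show "amap (comp_ftor A lift_ftor L) f = amap F f"
      using lift_ftor_amap[OF L.amap_hom[OF Arr_hom[OF f]]] lift_L[OF Arr_hom[OF f]]
        src_L[OF A.hom_Obj(1)[OF Arr_hom[OF f]]] src_L[OF A.hom_Obj(2)[OF Arr_hom[OF f]]] f
      by (simp add: amap_comp_ftor)
  qed (simp add: comp_ftor_def)
qed simp

lemma H_lift_ftor: "comp_ftor B H lift_ftor = G"
proof (rule ftor.equality)
  show "omap (comp_ftor B H lift_ftor) = omap G"
  proof (rule extensionalityI[of _ "Obj B"])
    show "omap G \<in> extensional (Obj B)"
      by (rule G.omap_extensional)
  qed (auto simp: comp_ftor_def lift_ftor_omap src_Obj square_omap)
  show "amap (comp_ftor B H lift_ftor) = amap G"
  proof (rule extensionalityI[of _ "Arr B"])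
    show "amap G \<in> extensional (Arr B)"
      by (rule G.amap_extensional)
    fix b assume b: "b \<in> Arr B"
    show "amap (comp_ftor B H lift_ftor) b = amap G b"
      using lift_ftor_amap[OF Arr_hom[OF b]] H_lift[OF hom_src[OF Arr_hom[OF b]]] b
      by (simp add: amap_comp_ftor)
  qed (simp add: comp_ftor_def)
qed simp

text \<open>\<open>H J = G\<close> forces \<open>J\<close> to be \<open>transport\<close> on opens,
  which fixes the domain of \<open>J b\<close>. Over the transport of [b = L f], \<open>J b\<close>
  must then coincide with \<open>J (L f) = F f\<close>, and \<open>lift_unique\<close>
  applies.\<close>

lemma lift_ftor_unique:
  assumes J: "jr_functor B C J" and JL: "comp_ftor A J L = F" and HJ: "comp_ftor B H J = G"
  shows "J = lift_ftor"
proof -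
  interpret J: jr_map B C J by (rule jr_mapI[OF J])
  have JLo: "omap J (omap L i) = omap F i" if "i \<in> Obj A" for i
    using that JL omap_comp_ftor by metis
  have JLa: "amap J (amap L f) = amap F f" if "f \<in> Arr A" for f
    using that JL amap_comp_ftor by metis
  have HJa: "amap H (amap J b) = amap G b" if "b \<in> Arr B" for b
    using that HJ amap_comp_ftor by metis
  have Jo: "omap J y = omap F (src y)" if "y \<in> Obj B" for y
    using JLo[OF src_Obj(1)[OF that]] src_Obj(2)[OF that] by simp
  have Ju: "transport i u = amap J u" if i: "i \<in> Obj A" and u: "u \<in> rest_idem B (omap L i)" for i u
    using transport_unique[OF i _ HJa[OF hom_Arr[OF idem_hom[OF u]]]] J.amap_idem[OF u] JLo[OF i] by simp
  have Ja: "lift i j b = amap J b"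
    if i: "i \<in> Obj A" and j: "j \<in> Obj A" and b: "b \<in> hom B (omap L i) (omap L j)" for i j b
  proof (rule lift_unique[OF i j b])
    show Jb: "amap J b \<in> hom C (omap F i) (omap F j)"
      using J.amap_hom[OF b] JLo i j by simp
    show "le C (Rst C (amap J b)) (transport i (Rst B b))"
      using Ju[OF i B.Rst_idem[OF b]] J.amap_Rst[OF b] C.le_refl[OF C.Rst_closed[OF Jb]] by simp
    fix f assume f: "f \<in> hom A i j"
    note e = B.eqz_idem[OF b L.amap_hom[OF f]]
    have "amap J b \<odot>\<^bsub>C\<^esub> amap J (eqz B b (amap L f)) =
        amap J (amap L f) \<odot>\<^bsub>C\<^esub> amap J (eqz B b (amap L f))"
      using J.amap_comp[OF idem_hom[OF e] b] J.amap_comp[OF idem_hom[OF e] L.amap_hom[OF f]]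
        B.meet_eqz[OF b L.amap_hom[OF f]] by simp
    then show "amap J b \<odot>\<^bsub>C\<^esub> agree i b f = amap F f \<odot>\<^bsub>C\<^esub> agree i b f"
      unfolding agree_def using Ju[OF i e] JLa[OF hom_Arr[OF f]] by simp
  qed
  show ?thesis
  proof (rule ftor.equality)
    show "omap J = omap lift_ftor"
    proof (rule extensionalityI[of _ "Obj B"])
    show "omap J \<in> extensional (Obj B)"
      by (rule J.omap_extensional)
    qed (auto simp: Jo lift_ftor_def)
    show "amap J = amap lift_ftor"
    proof (rule extensionalityI[of _ "Arr B"])
    show "amap J \<in> extensional (Arr B)"
      by (rule J.amap_extensional)
      fix b assume b: "b \<in> Arr B"
      show "amap J b = amap lift_ftor b"
        using lift_ftor_amap[OF Arr_hom[OF b]] Ja[OF hom_src[OF Arr_hom[OF b]]] by simp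
    qed (simp add: lift_ftor_def)
  qed simp
qed

end

lemma localic_hyperconnected_lift:
  assumes "jr_functor A C F" "jr_functor B D G" "localic A B L" "hyperconnected C D H"
    and "comp_ftor A H F = comp_ftor A G L"
  shows "\<exists>!J. jr_functor B C J \<and> comp_ftor A J L = F \<and> comp_ftor B H J = G"
proof -
  interpret lifting_square A B C D F G L H
    using assms
    by (intro lifting_square.intro lifting_square_axioms.intro jr_mapI)
      (auto simp: jr_functor_def localic_def hyperconnected_def)
  show ?thesis
  proof (rule ex1I)
    show "jr_functor B C lift_ftor \<and> comp_ftor A lift_ftor L = F \<and> comp_ftor B H lift_ftor = G"
      by (intro conjI lift_ftor_jr lift_ftor_L H_lift_ftor)
  qed (elim conjE, rule lift_ftor_unique)
qed

section \<open>The factorisation\<close>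

locale localic_part = jr_map A B F
  for A :: "('o, 'm) rcat" and B :: "('p, 'n) rcat" and F
begin

section \<open>Agreement and inverse images among the opens of \<open>F i\<close>\<close>

abbreviation le_B (infix "\<sqsubseteq>" 50) where "u \<sqsubseteq> v \<equiv> le B u v"
abbreviation comp_A (infixl "\<cdot>" 70) where "g \<cdot> f \<equiv> g \<odot>\<^bsub>A\<^esub> f"
abbreviation comp_B (infixl "\<sqinter>" 70) where "u \<sqinter> v \<equiv> u \<odot>\<^bsub>B\<^esub> v"
abbreviation opens where "opens i \<equiv> rest_idem B (omap F i)"

text \<open>
  \<open>ag f g\<close> is [f = g] as seen in the opens of F i. It may be smaller than the region on which F f and
  F g agree.
\<close>

definition ag where "ag f g = amap F (eqz A f g)"
definition pb where "pb f u = pull B (amap F f) u"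

lemma ag_idem: "f \<in> hom A i j \<Longrightarrow> g \<in> hom A i j \<Longrightarrow> ag f g \<in> opens i"
  unfolding ag_def by (rule amap_idem[OF A.eqz_idem])

lemma ag_sym: "f \<in> hom A i j \<Longrightarrow> g \<in> hom A i j \<Longrightarrow> w \<sqsubseteq> ag f g \<Longrightarrow> w \<sqsubseteq> ag g f"
  by (simp add: ag_def A.eqz_commute)

text \<open>To agree with itself is to be defined, so \<open>ag f f\<close> stands for the domain of
  \<open>F f\<close> throughout.\<close>

lemma ag_refl: "f \<in> hom A i j \<Longrightarrow> ag f f = Rst B (amap F f)"
  by (simp add: ag_def A.eqz_refl amap_Rst)

text \<open>\<open>F\<close> preserves binary meets of opens, though not meets of all parallel maps.
  An implication from two opens to a third that holds in \<open>A\<close> therefore holds for their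
  images, which is how laws of \<open>eqz\<close> become laws of \<open>ag\<close>.\<close>

lemma ag_transfer:
  assumes u: "u \<in> rest_idem A i" and v: "v \<in> rest_idem A i" and x: "x \<in> rest_idem A i"
    and imp: "\<And>w. le A w u \<Longrightarrow> le A w v \<Longrightarrow> le A w x"
    and wu: "w \<sqsubseteq> amap F u" and wv: "w \<sqsubseteq> amap F v"
  shows "w \<sqsubseteq> amap F x"
proof -
  have "le A (u \<cdot> v) x"
    using imp A.le_idem_comp_iff[OF u v] A.le_refl[OF idem_hom[OF A.idem_comp[OF u v]]] by blast
  moreover have "w \<sqsubseteq> amap F (u \<cdot> v)"
    using wu wv amap_comp[OF idem_hom[OF v] idem_hom[OF u]]
      B.le_idem_comp_iff[OF amap_idem[OF u] amap_idem[OF v]] by simp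
  ultimately show ?thesis using amap_le B.le_trans by blast
qed

lemma ag_trans:
  assumes "f \<in> hom A i j" "g \<in> hom A i j" "h \<in> hom A i j" "w \<sqsubseteq> ag f g" "w \<sqsubseteq> ag g h"
  shows "w \<sqsubseteq> ag f h"
  using A.eqz_trans[OF assms(1-3)] assms(4,5) unfolding ag_def
  by (rule ag_transfer[OF A.eqz_idem[OF assms(1,2)] A.eqz_idem[OF assms(2,3)]
        A.eqz_idem[OF assms(1,3)]])

lemma ag_dom:
  assumes "f \<in> hom A i j" "g \<in> hom A i j" "w \<sqsubseteq> ag f g"
  shows "w \<sqsubseteq> ag f f" "w \<sqsubseteq> ag g g"
proof -
  note s = ag_sym[OF assms]
  show "w \<sqsubseteq> ag f f" by (rule ag_trans[OF assms(1,2,1,3) s])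
  show "w \<sqsubseteq> ag g g" by (rule ag_trans[OF assms(2,1,2) s assms(3)])
qed

lemma ag_pb:
  assumes x: "x \<in> hom A k i" and f: "f \<in> hom A i j" and g: "g \<in> hom A i j" and w: "w \<sqsubseteq> pb x (ag f g)"
  shows "w \<sqsubseteq> ag (f \<cdot> x) (g \<cdot> x)"
  using B.le_trans[OF _ amap_le[OF A.pull_eqz_le[OF x f g]]] amap_pull[OF x A.eqz_idem[OF f g]] w
  by (simp add: ag_def pb_def)

text \<open>Agreement includes being defined, so \<open>w'\<close> supplies the domain of
  \<open>g f\<close>; inside it, replacing \<open>f\<close> by \<open>f'\<close> changes nothing on
  [f = f'].\<close>

lemma ag_post:
  assumes f: "f \<in> hom A i j" and f': "f' \<in> hom A i j" and g: "g \<in> hom A j k"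
    and w: "w \<sqsubseteq> ag f f'" and w': "w \<sqsubseteq> ag (g \<cdot> f) (g \<cdot> f)"
  shows "w \<sqsubseteq> ag (g \<cdot> f) (g \<cdot> f')"
proof -
  note gf = A.Comp_closed[OF f g]
  have "le A v (eqz A (g \<cdot> f) (g \<cdot> f'))"
    if v: "le A v (eqz A f f')" and v': "le A v (eqz A (g \<cdot> f) (g \<cdot> f))" for v
  proof (rule A.eqz_comp_le[OF f f' g g v])
    show "le A v (pull A f (eqz A g g))"
      using v' A.eqz_refl[OF g] A.eqz_refl[OF gf] A.pull_Rst[OF f g] by simp
  qed
  then show ?thesis
    using w w' unfolding ag_def
    by (rule ag_transfer[OF A.eqz_idem[OF f f'] A.eqz_idem[OF gf gf]
          A.eqz_idem[OF gf A.Comp_closed[OF f' g]]])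
qed

lemma ag_le:
  assumes fs: "le A f s" and s: "s \<in> hom A i j" and w: "w \<sqsubseteq> ag f f"
  shows "w \<sqsubseteq> ag f s"
proof -
  have f: "f \<in> hom A i j" using le_hom[OF fs] s by simp
  have "le A (Rst A f) (eqz A s s)"
    using A.le_Rst[OF fs s] A.eqz_refl[OF s] by simp
  then have "le A (Rst A f) (eqz A f s)"
    using A.le_eqz_of_le[OF fs s s] A.le_refl[OF A.Rst_closed[OF f]] by blast
  then show ?thesis
    using w amap_le B.le_trans A.eqz_refl[OF f] unfolding ag_def by metis
qed

lemma ag_Ide: "i \<in> Obj A \<Longrightarrow> w \<in> opens i \<Longrightarrow> w \<sqsubseteq> ag (Ide A i) (Ide A i)"
  using ag_refl[OF A.Ide_closed] amap_Ide[of i] idem_Rst[OF B.Ide_idem[OF omap_Obj]]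
    B.idem_le_Ide by simp

lemma pb_idem: "f \<in> hom A i j \<Longrightarrow> u \<in> opens j \<Longrightarrow> pb f u \<in> opens i"
  unfolding pb_def by (rule B.pull_idem[OF amap_hom])

lemma pb_comp: "f \<in> hom A i j \<Longrightarrow> g \<in> hom A j k \<Longrightarrow> u \<in> opens k \<Longrightarrow> pb (g \<cdot> f) u = pb f (pb g u)"
  unfolding pb_def using B.pull_comp[OF amap_hom amap_hom] amap_comp by metis

lemma pb_mono:
  "f \<in> hom A i j \<Longrightarrow> w \<sqsubseteq> pb f u \<Longrightarrow> u \<sqsubseteq> v \<Longrightarrow> v \<in> opens j \<Longrightarrow> w \<sqsubseteq> pb f v"
  unfolding pb_def using B.pull_mono[OF _ _ amap_hom] B.le_trans by blast

lemma pb_meet: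
  "f \<in> hom A i j \<Longrightarrow> u \<in> opens j \<Longrightarrow> v \<in> opens j \<Longrightarrow>
    w \<sqsubseteq> pb f (u \<sqinter> v) \<longleftrightarrow> w \<sqsubseteq> pb f u \<and> w \<sqsubseteq> pb f v"
  unfolding pb_def by (rule B.le_pull_comp_iff[OF amap_hom])

lemma pb_Ide: "i \<in> Obj A \<Longrightarrow> u \<in> opens i \<Longrightarrow> pb (Ide A i) u = u"
  unfolding pb_def using amap_Ide B.pull_Ide by simp

lemma pb_dom:
  assumes f: "f \<in> hom A i j" and u: "u \<in> opens j" and w: "w \<sqsubseteq> pb f u"
  shows "w \<sqsubseteq> ag f f"
  using B.le_trans[OF w[unfolded pb_def] B.pull_le_Rst[OF amap_hom[OF f] u]] ag_refl[OF f] by simp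

lemma pb_ag_refl: "f \<in> hom A i j \<Longrightarrow> g \<in> hom A j k \<Longrightarrow> pb f (ag g g) = ag (g \<cdot> f) (g \<cdot> f)"
  unfolding pb_def
  using ag_refl[OF A.Comp_closed] ag_refl amap_comp B.pull_Rst[OF amap_hom amap_hom] by metis

lemma pb_cong:
  assumes f: "f \<in> hom A i j" and g: "g \<in> hom A i j" and u: "u \<in> opens j"
    and w: "w \<sqsubseteq> pb f u" and e: "w \<sqsubseteq> ag f g"
  shows "w \<sqsubseteq> pb g u"
  using w amap_agree[OF f g] e unfolding pb_def ag_def
  by (intro B.le_pull_cong[OF amap_hom[OF f] amap_hom[OF g] u]) auto

text \<open>The two inequalities characterising the arrows of the intermediate category, in forcing form.\<close>

definition sections where
  "sections i j = {e \<in> extensional (hom A i j).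
     (\<forall>f\<in>hom A i j. e f \<in> opens i) \<and>
     (\<forall>f\<in>hom A i j. \<forall>g\<in>hom A i j. \<forall>w. w \<sqsubseteq> e f \<longrightarrow> w \<sqsubseteq> e g \<longrightarrow> w \<sqsubseteq> ag f g) \<and>
     (\<forall>f\<in>hom A i j. \<forall>g\<in>hom A i j. \<forall>w. w \<sqsubseteq> e f \<longrightarrow> w \<sqsubseteq> ag f g \<longrightarrow> w \<sqsubseteq> e g)}"

lemma sectionsI:
  assumes "e \<in> extensional (hom A i j)" "\<And>f. f \<in> hom A i j \<Longrightarrow> e f \<in> opens i"
    and "\<And>f g w. f \<in> hom A i j \<Longrightarrow> g \<in> hom A i j \<Longrightarrow> w \<sqsubseteq> e f \<Longrightarrow> w \<sqsubseteq> e g \<Longrightarrow> w \<sqsubseteq> ag f g"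
    and "\<And>f g w. f \<in> hom A i j \<Longrightarrow> g \<in> hom A i j \<Longrightarrow> w \<sqsubseteq> e f \<Longrightarrow> w \<sqsubseteq> ag f g \<Longrightarrow> w \<sqsubseteq> e g"
  shows "e \<in> sections i j"
  using assms unfolding sections_def by blast

lemma sec_idem: "e \<in> sections i j \<Longrightarrow> f \<in> hom A i j \<Longrightarrow> e f \<in> opens i"
  by (simp add: sections_def)

lemma sec_agree:
  "e \<in> sections i j \<Longrightarrow> f \<in> hom A i j \<Longrightarrow> g \<in> hom A i j \<Longrightarrow> w \<sqsubseteq> e f \<Longrightarrow> w \<sqsubseteq> e g \<Longrightarrow> w \<sqsubseteq> ag f g"
  unfolding sections_def by blast

lemma sec_extensional: "e \<in> sections i j \<Longrightarrow> e \<in> extensional (hom A i j)"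
  unfolding sections_def by blast

lemma sec_move:
  "e \<in> sections i j \<Longrightarrow> f \<in> hom A i j \<Longrightarrow> g \<in> hom A i j \<Longrightarrow> w \<sqsubseteq> e f \<Longrightarrow> w \<sqsubseteq> ag f g \<Longrightarrow> w \<sqsubseteq> e g"
  unfolding sections_def by blast

lemma sec_eqI:
  assumes e: "e \<in> sections i j" and d: "d \<in> sections i j"
    and 1: "\<And>h w. h \<in> hom A i j \<Longrightarrow> w \<sqsubseteq> e h \<Longrightarrow> w \<sqsubseteq> d h"
    and 2: "\<And>h w. h \<in> hom A i j \<Longrightarrow> w \<sqsubseteq> d h \<Longrightarrow> w \<sqsubseteq> e h"
  shows "e = d"
proof (rule extensionalityI[of _ "hom A i j"])
  show "e \<in> extensional (hom A i j)" "d \<in> extensional (hom A i j)"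
    using sec_extensional[OF e] sec_extensional[OF d] .
  fix h assume h: "h \<in> hom A i j"
  show "e h = d h"
    using 1[OF h B.le_refl[OF idem_hom[OF sec_idem[OF e h]]]]
      2[OF h B.le_refl[OF idem_hom[OF sec_idem[OF d h]]]] by (rule B.le_antisym)
qed

section \<open>Extents of sections and matrix entries\<close>

text \<open>The part of \<open>F i\<close> over which \<open>e\<close> is represented, locally, by
  arrows of \<open>A\<close>; it will be the domain of definition of \<open>e\<close> as an
  arrow.\<close>

definition extent where
  "extent i j e = osup B (omap F i) (e ` hom A i j)"

lemma extent_image: "e \<in> sections i j \<Longrightarrow> e ` hom A i j \<subseteq> opens i"
  using sec_idem by blast

lemma extent_idem: "i \<in> Obj A \<Longrightarrow> e \<in> sections i j \<Longrightarrow> extent i j e \<in> opens i"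
  unfolding extent_def by (rule B.osup_idem[OF extent_image omap_Obj])

lemma extent_upper:
  assumes e: "e \<in> sections i j" and f: "f \<in> hom A i j"
  shows "e f \<sqsubseteq> extent i j e"
  unfolding extent_def using f
  by (intro B.osup_upper[OF _ extent_image[OF e] omap_Obj[OF A.hom_Obj(1)[OF f]]]) blast

lemma extent_intro:
  "e \<in> sections i j \<Longrightarrow> f \<in> hom A i j \<Longrightarrow> w \<sqsubseteq> e f \<Longrightarrow> w \<sqsubseteq> extent i j e"
  using extent_upper B.le_trans by blast

lemma extent_elim:
  assumes e: "e \<in> sections i j" and w: "w \<sqsubseteq> extent i j e" and z: "z \<in> opens i"
    and step: "\<And>v f. v \<sqsubseteq> w \<Longrightarrow> f \<in> hom A i j \<Longrightarrow> v \<sqsubseteq> e f \<Longrightarrow> v \<sqsubseteq> z"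
  shows "w \<sqsubseteq> z"
  using w unfolding extent_def
  by (rule B.osup_elim[OF _ extent_image[OF e] z]) (use step in blast)

lemma pb_extent_elim:
  assumes x: "x \<in> hom A k i" and e: "e \<in> sections i j" and w: "w \<sqsubseteq> pb x (extent i j e)"
    and z: "z \<in> opens k"
    and step: "\<And>v f. v \<sqsubseteq> w \<Longrightarrow> f \<in> hom A i j \<Longrightarrow> v \<sqsubseteq> pb x (e f) \<Longrightarrow> v \<sqsubseteq> z"
  shows "w \<sqsubseteq> z"
  using w unfolding extent_def pb_def
  by (rule B.pull_osup_elim[OF _ amap_hom[OF x] extent_image[OF e] z])
    (use step in \<open>auto simp: pb_def\<close>)

text \<open>\<open>hat i j k d f h\<close> is the matrix entry [d f = h].\<close>

definition hat where
  "hat i j k d f h = osup B (omap F i) ((\<lambda>g. pb f (d g) \<sqinter> ag (g \<cdot> f) h) ` hom A j k)"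

context
  fixes i j k d f h
  assumes d: "d \<in> sections j k" and f: "f \<in> hom A i j" and h: "h \<in> hom A i k"
begin

lemma hat_parts:
  assumes g: "g \<in> hom A j k"
  shows "pb f (d g) \<in> opens i" "ag (g \<cdot> f) h \<in> opens i"
  using pb_idem[OF f sec_idem[OF d g]] ag_idem[OF A.Comp_closed[OF f g] h] by auto

lemma hat_image: "(\<lambda>g. pb f (d g) \<sqinter> ag (g \<cdot> f) h) ` hom A j k \<subseteq> opens i"
  using hat_parts B.idem_comp by blast

lemma hat_idem: "hat i j k d f h \<in> opens i"
  unfolding hat_def by (rule B.osup_idem[OF hat_image omap_Obj[OF A.hom_Obj(1)[OF f]]])

lemma hat_intro:
  assumes g: "g \<in> hom A j k" and w: "w \<sqsubseteq> pb f (d g)" "w \<sqsubseteq> ag (g \<cdot> f) h"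
  shows "w \<sqsubseteq> hat i j k d f h"
proof -
  have "w \<sqsubseteq> pb f (d g) \<sqinter> ag (g \<cdot> f) h"
    using w B.le_idem_comp_iff[OF hat_parts[OF g]] by simp
  moreover have "pb f (d g) \<sqinter> ag (g \<cdot> f) h \<sqsubseteq> hat i j k d f h"
    unfolding hat_def using g
    by (intro B.osup_upper[OF _ hat_image omap_Obj[OF A.hom_Obj(1)[OF f]]]) blast
  ultimately show ?thesis using B.le_trans by blast
qed

lemma hat_elim:
  assumes w: "w \<sqsubseteq> hat i j k d f h" and z: "z \<in> opens i"
    and step: "\<And>v g. v \<sqsubseteq> w \<Longrightarrow> g \<in> hom A j k \<Longrightarrow> v \<sqsubseteq> pb f (d g) \<Longrightarrow> v \<sqsubseteq> ag (g \<cdot> f) h \<Longrightarrow> v \<sqsubseteq> z"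
  shows "w \<sqsubseteq> z"
  using w unfolding hat_def
proof (rule B.osup_elim[OF _ hat_image z])
  fix v u assume vw: "v \<sqsubseteq> w" and "u \<in> (\<lambda>g. pb f (d g) \<sqinter> ag (g \<cdot> f) h) ` hom A j k" and vu: "v \<sqsubseteq> u"
  then obtain g where g: "g \<in> hom A j k" and u: "u = pb f (d g) \<sqinter> ag (g \<cdot> f) h" by blast
  show "v \<sqsubseteq> z"
    using step[OF vw g] vu u B.le_idem_comp_iff[OF hat_parts[OF g]] by simp
qed

text \<open>The inverse image of an entry along \<open>x\<close> is used through witnesses for the
  entry at \<open>f x\<close> and \<open>h x\<close>. The passage goes in this direction because
  \<open>ag_pb\<close> is an inclusion.\<close>

lemma pb_hat_elim:
  assumes x: "x \<in> hom A l i" and w: "w \<sqsubseteq> pb x (hat i j k d f h)" and z: "z \<in> opens l"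
    and step: "\<And>v g. v \<sqsubseteq> w \<Longrightarrow> g \<in> hom A j k \<Longrightarrow> v \<sqsubseteq> pb (f \<cdot> x) (d g) \<Longrightarrow>
      v \<sqsubseteq> ag (g \<cdot> (f \<cdot> x)) (h \<cdot> x) \<Longrightarrow> v \<sqsubseteq> z"
  shows "w \<sqsubseteq> z"
  using w unfolding hat_def pb_def
proof (rule B.pull_osup_elim[OF _ amap_hom[OF x] _ z])
  show "(\<lambda>g. pull B (amap F f) (d g) \<sqinter> ag (g \<cdot> f) h) ` hom A j k \<subseteq> opens i"
    using hat_image by (simp add: pb_def)
  fix v u assume vw: "v \<sqsubseteq> w"
    and "u \<in> (\<lambda>g. pull B (amap F f) (d g) \<sqinter> ag (g \<cdot> f) h) ` hom A j k"
    and vu: "v \<sqsubseteq> pull B (amap F x) u"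
  then obtain g where g: "g \<in> hom A j k" and u: "u = pb f (d g) \<sqinter> ag (g \<cdot> f) h"
    by (auto simp: pb_def)
  have "v \<sqsubseteq> pb x (pb f (d g))" "v \<sqsubseteq> pb x (ag (g \<cdot> f) h)"
    using vu u pb_meet[OF x hat_parts[OF g]] by (auto simp: pb_def)
  then have "v \<sqsubseteq> pb (f \<cdot> x) (d g)" "v \<sqsubseteq> ag (g \<cdot> (f \<cdot> x)) (h \<cdot> x)"
    using pb_comp[OF x f sec_idem[OF d g]] ag_pb[OF x A.Comp_closed[OF f g] h]
      A.Comp_assoc[OF x f g] by auto
  then show "v \<sqsubseteq> z" by (rule step[OF vw g])
qed

lemma hat_dom: "w \<sqsubseteq> hat i j k d f h \<Longrightarrow> w \<sqsubseteq> ag f f"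
  by (erule hat_elim[OF _ ag_idem[OF f f]]) (use pb_dom[OF f sec_idem[OF d]] in blast)

end

text \<open>A witness \<open>g\<close> at \<open>f\<close> is also one at \<open>f'\<close>: inverse
  images along \<open>f\<close> and \<open>f'\<close> coincide where the two agree, and
  \<open>g f\<close>, being defined there, agrees with \<open>g f'\<close>.\<close>

lemma hat_left:
  assumes d: "d \<in> sections j k" and f: "f \<in> hom A i j" and f': "f' \<in> hom A i j" and h: "h \<in> hom A i k"
    and w: "w \<sqsubseteq> hat i j k d f h" and e: "w \<sqsubseteq> ag f f'"
  shows "w \<sqsubseteq> hat i j k d f' h"
proof (rule hat_elim[OF d f h w hat_idem[OF d f' h]])
  fix v g assume v: "v \<sqsubseteq> w" and g: "g \<in> hom A j k" and 1: "v \<sqsubseteq> pb f (d g)" and 2: "v \<sqsubseteq> ag (g \<cdot> f) h"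
  have e': "v \<sqsubseteq> ag f f'" by (rule B.le_trans[OF v e])
  note gf = A.Comp_closed[OF f g] and gf' = A.Comp_closed[OF f' g]
  have "v \<sqsubseteq> ag (g \<cdot> f) (g \<cdot> f')"
    by (rule ag_post[OF f f' g e' ag_dom(1)[OF gf h 2]])
  then have "v \<sqsubseteq> ag (g \<cdot> f') h"
    using ag_trans[OF gf' gf h ag_sym[OF gf gf'] 2] by blast
  with pb_cong[OF f f' sec_idem[OF d g] 1 e'] show "v \<sqsubseteq> hat i j k d f' h"
    by (rule hat_intro[OF d f' h g])
qed

lemma hat_right:
  assumes d: "d \<in> sections j k" and f: "f \<in> hom A i j" and h: "h \<in> hom A i k" and h': "h' \<in> hom A i k"
    and w: "w \<sqsubseteq> hat i j k d f h" and e: "w \<sqsubseteq> ag h h'"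
  shows "w \<sqsubseteq> hat i j k d f h'"
proof (rule hat_elim[OF d f h w hat_idem[OF d f h']])
  fix v g assume v: "v \<sqsubseteq> w" and g: "g \<in> hom A j k" and 1: "v \<sqsubseteq> pb f (d g)" and 2: "v \<sqsubseteq> ag (g \<cdot> f) h"
  show "v \<sqsubseteq> hat i j k d f h'"
    by (rule hat_intro[OF d f h' g 1 ag_trans[OF A.Comp_closed[OF f g] h h' 2 B.le_trans[OF v e]]])
qed

text \<open>Two witnesses \<open>g\<close> and \<open>g'\<close> for \<open>d\<close> along
  \<open>f\<close> meet inside the inverse image of [g = g'], so there h = g f = g' f = h'. In this
  sense each row of the matrix is single valued.\<close>

lemma hat_agree:
  assumes d: "d \<in> sections j k" and f: "f \<in> hom A i j" and h: "h \<in> hom A i k" and h': "h' \<in> hom A i k"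
    and w: "w \<sqsubseteq> hat i j k d f h" and w': "w \<sqsubseteq> hat i j k d f h'"
  shows "w \<sqsubseteq> ag h h'"
proof (rule hat_elim[OF d f h w ag_idem[OF h h']])
  fix v g assume v: "v \<sqsubseteq> w" and g: "g \<in> hom A j k" and 1: "v \<sqsubseteq> pb f (d g)" and 2: "v \<sqsubseteq> ag (g \<cdot> f) h"
  show "v \<sqsubseteq> ag h h'"
  proof (rule hat_elim[OF d f h' B.le_trans[OF v w'] ag_idem[OF h h']])
    fix x g' assume x: "x \<sqsubseteq> v" and g': "g' \<in> hom A j k"
      and x1: "x \<sqsubseteq> pb f (d g')" and x2: "x \<sqsubseteq> ag (g' \<cdot> f) h'"
    note gf = A.Comp_closed[OF f g] and gf' = A.Comp_closed[OF f g']
    note dg = sec_idem[OF d g] and dg' = sec_idem[OF d g']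
    have "x \<sqsubseteq> pb f (d g \<sqinter> d g')"
      using pb_meet[OF f dg dg'] B.le_trans[OF x 1] x1 by blast
    moreover have "d g \<sqinter> d g' \<sqsubseteq> ag g g'"
      using sec_agree[OF d g g'] B.le_idem_comp_iff[OF dg dg']
        B.le_refl[OF idem_hom[OF B.idem_comp[OF dg dg']]] by blast
    ultimately have "x \<sqsubseteq> ag (g \<cdot> f) (g' \<cdot> f)"
      using ag_pb[OF f g g' pb_mono[OF f _ _ ag_idem[OF g g']]] by blast
    then have "x \<sqsubseteq> ag (g \<cdot> f) h'"
      using ag_trans[OF gf gf' h' _ x2] by blast
    then show "x \<sqsubseteq> ag h h'"
      using ag_trans[OF h gf h' ag_sym[OF gf h B.le_trans[OF x 2]]] by blast
  qed
qed

text \<open>The arrow \<open>g\<close> is its own witness, as \<open>g f\<close> is defined wherever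
  \<open>f\<close> lands in \<open>d g\<close>.\<close>

lemma pb_le_hat:
  assumes d: "d \<in> sections j k" and f: "f \<in> hom A i j" and g: "g \<in> hom A j k"
  shows "pb f (d g) \<sqsubseteq> hat i j k d f (g \<cdot> f)"
proof -
  note gf = A.Comp_closed[OF f g] and dg = sec_idem[OF d g]
  have r: "pb f (d g) \<sqsubseteq> pb f (d g)" by (rule B.le_refl[OF idem_hom[OF pb_idem[OF f dg]]])
  have "d g \<sqsubseteq> ag g g" using sec_agree[OF d g g] B.le_refl[OF idem_hom[OF dg]] by blast
  then have "pb f (d g) \<sqsubseteq> ag (g \<cdot> f) (g \<cdot> f)"
    using pb_mono[OF f r _ ag_idem[OF g g]] pb_ag_refl[OF f g] by simp
  with r show ?thesis by (rule hat_intro[OF d f gf g])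
qed

text \<open>The row at the identity is \<open>d\<close> itself, so a section is recovered from its
  matrix.\<close>

lemma hat_Ide:
  assumes d: "d \<in> sections j k" and h: "h \<in> hom A j k"
  shows "w \<sqsubseteq> hat j j k d (Ide A j) h \<longleftrightarrow> w \<sqsubseteq> d h"
proof
  note j = A.hom_Obj(1)[OF h]
  note I = A.Ide_closed[OF j]
  show "w \<sqsubseteq> d h" if w: "w \<sqsubseteq> hat j j k d (Ide A j) h"
  proof (rule hat_elim[OF d I h w sec_idem[OF d h]])
    fix v g assume g: "g \<in> hom A j k" and "v \<sqsubseteq> pb (Ide A j) (d g)" "v \<sqsubseteq> ag (g \<cdot> Ide A j) h"
    then show "v \<sqsubseteq> d h"
      using pb_Ide[OF j sec_idem[OF d g]] A.Comp_Ide_right[OF g] sec_move[OF d g h] by simp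
  qed
  assume "w \<sqsubseteq> d h"
  then show "w \<sqsubseteq> hat j j k d (Ide A j) h"
    using B.le_trans[OF _ pb_le_hat[OF d I h]] pb_Ide[OF j sec_idem[OF d h]] A.Comp_Ide_right[OF h]
    by simp
qed

section \<open>Composition of sections and its associativity\<close>

text \<open>A section is the row at the identity of its own matrix, by \<open>hat_Ide\<close>, so
  the product of matrices is formed for that row only: the vector \<open>e\<close> is multiplied by
  the matrix of \<open>d\<close>.\<close>

definition scomp where
  "scomp i j k d e =
    restrict (\<lambda>h. osup B (omap F i) ((\<lambda>f. e f \<sqinter> hat i j k d f h) ` hom A i j)) (hom A i k)"

context
  fixes i j k d e h
  assumes d: "d \<in> sections j k" and e: "e \<in> sections i j" and h: "h \<in> hom A i k"
begin

lemma comp_image: "(\<lambda>f. e f \<sqinter> hat i j k d f h) ` hom A i j \<subseteq> opens i"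
  using sec_idem[OF e] hat_idem[OF d _ h] B.idem_comp by blast

lemma comp_eq: "scomp i j k d e h = osup B (omap F i) ((\<lambda>f. e f \<sqinter> hat i j k d f h) ` hom A i j)"
  using h by (simp add: scomp_def)

lemma comp_idem: "scomp i j k d e h \<in> opens i"
  unfolding comp_eq by (rule B.osup_idem[OF comp_image omap_Obj[OF A.hom_Obj(1)[OF h]]])

lemma comp_intro:
  assumes f: "f \<in> hom A i j" and w: "w \<sqsubseteq> e f" "w \<sqsubseteq> hat i j k d f h"
  shows "w \<sqsubseteq> scomp i j k d e h"
proof -
  have "w \<sqsubseteq> e f \<sqinter> hat i j k d f h"
    using w B.le_idem_comp_iff[OF sec_idem[OF e f] hat_idem[OF d f h]] by simp
  moreover have "e f \<sqinter> hat i j k d f h \<sqsubseteq> scomp i j k d e h"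
    unfolding comp_eq using f
    by (intro B.osup_upper[OF _ comp_image omap_Obj[OF A.hom_Obj(1)[OF h]]]) blast
  ultimately show ?thesis using B.le_trans by blast
qed

lemma comp_elim:
  assumes w: "w \<sqsubseteq> scomp i j k d e h" and z: "z \<in> opens i"
    and step: "\<And>v f. v \<sqsubseteq> w \<Longrightarrow> f \<in> hom A i j \<Longrightarrow> v \<sqsubseteq> e f \<Longrightarrow> v \<sqsubseteq> hat i j k d f h \<Longrightarrow> v \<sqsubseteq> z"
  shows "w \<sqsubseteq> z"
  using w unfolding comp_eq
proof (rule B.osup_elim[OF _ comp_image z])
  fix v u assume vw: "v \<sqsubseteq> w" and "u \<in> (\<lambda>f. e f \<sqinter> hat i j k d f h) ` hom A i j" and vu: "v \<sqsubseteq> u"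
  then obtain f where f: "f \<in> hom A i j" and u: "u = e f \<sqinter> hat i j k d f h" by blast
  show "v \<sqsubseteq> z"
    using step[OF vw f] vu u B.le_idem_comp_iff[OF sec_idem[OF e f] hat_idem[OF d f h]] by simp
qed

lemma pb_comp_elim:
  assumes x: "x \<in> hom A l i" and w: "w \<sqsubseteq> pb x (scomp i j k d e h)" and z: "z \<in> opens l"
    and step: "\<And>v f. v \<sqsubseteq> w \<Longrightarrow> f \<in> hom A i j \<Longrightarrow> v \<sqsubseteq> pb x (e f) \<Longrightarrow>
      v \<sqsubseteq> pb x (hat i j k d f h) \<Longrightarrow> v \<sqsubseteq> z"
  shows "w \<sqsubseteq> z"
  using w unfolding comp_eq pb_def
proof (rule B.pull_osup_elim[OF _ amap_hom[OF x] comp_image z])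
  fix v u assume vw: "v \<sqsubseteq> w" and "u \<in> (\<lambda>f. e f \<sqinter> hat i j k d f h) ` hom A i j"
    and vu: "v \<sqsubseteq> pull B (amap F x) u"
  then obtain f where f: "f \<in> hom A i j" and u: "u = e f \<sqinter> hat i j k d f h" by blast
  show "v \<sqsubseteq> z"
    using step[OF vw f] vu u pb_meet[OF x sec_idem[OF e f] hat_idem[OF d f h], of v]
    by (simp add: pb_def)
qed

end

text \<open>Values reached through different arrows \<open>f\<close> and \<open>f'\<close> are
  compared in a single row: where \<open>e\<close> is represented by both, these agree, and
  \<open>hat_left\<close> changes \<open>f'\<close> into \<open>f\<close>, after which
  \<open>hat_agree\<close> applies.\<close>

lemma comp_sections:
  assumes d: "d \<in> sections j k" and e: "e \<in> sections i j"
  shows "scomp i j k d e \<in> sections i k"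
proof (rule sectionsI)
  show "scomp i j k d e \<in> extensional (hom A i k)" by (simp add: scomp_def)
  show "scomp i j k d e h \<in> opens i" if "h \<in> hom A i k" for h
    by (rule comp_idem[OF d e that])
  fix h h' w assume h: "h \<in> hom A i k" and h': "h' \<in> hom A i k" and w: "w \<sqsubseteq> scomp i j k d e h"
  show "w \<sqsubseteq> ag h h'" if w': "w \<sqsubseteq> scomp i j k d e h'"
  proof (rule comp_elim[OF d e h w ag_idem[OF h h']])
    fix v f assume v: "v \<sqsubseteq> w" and f: "f \<in> hom A i j" and ef: "v \<sqsubseteq> e f" and df: "v \<sqsubseteq> hat i j k d f h"
    show "v \<sqsubseteq> ag h h'"
    proof (rule comp_elim[OF d e h' B.le_trans[OF v w'] ag_idem[OF h h']])
      fix x f' assume x: "x \<sqsubseteq> v" and f': "f' \<in> hom A i j" and ef': "x \<sqsubseteq> e f'"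
        and df': "x \<sqsubseteq> hat i j k d f' h'"
      have "x \<sqsubseteq> hat i j k d f h'"
        by (rule hat_left[OF d f' f h' df' sec_agree[OF e f' f ef' B.le_trans[OF x ef]]])
      with B.le_trans[OF x df] show "x \<sqsubseteq> ag h h'"
        by (rule hat_agree[OF d f h h'])
    qed
  qed
  show "w \<sqsubseteq> scomp i j k d e h'" if w': "w \<sqsubseteq> ag h h'"
  proof (rule comp_elim[OF d e h w comp_idem[OF d e h']])
    fix v f assume v: "v \<sqsubseteq> w" and f: "f \<in> hom A i j" and ef: "v \<sqsubseteq> e f" and df: "v \<sqsubseteq> hat i j k d f h"
    show "v \<sqsubseteq> scomp i j k d e h'"
      by (rule comp_intro[OF d e h' f ef hat_right[OF d f h h' df B.le_trans[OF v w']]])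
  qed
qed

text \<open>
  The next two lemmas say that the matrix of a composite is the product of the matrices, which is
  what makes composition associative.
\<close>

lemma hat_comp_intro:
  assumes d: "d \<in> sections j k" and e: "e \<in> sections i j" and f: "f \<in> hom A l i"
    and g: "g \<in> hom A l j" and h: "h \<in> hom A l k"
    and w: "w \<sqsubseteq> hat l i j e f g" and w': "w \<sqsubseteq> hat l j k d g h"
  shows "w \<sqsubseteq> hat l i k (scomp i j k d e) f h"
proof (rule hat_elim[OF e f g w])
  note de = comp_sections[OF d e]
  note z = hat_idem[OF de f h]
  show "hat l i k (scomp i j k d e) f h \<in> opens l" by (rule z)
  fix v n assume v: "v \<sqsubseteq> w" and n: "n \<in> hom A i j" and en: "v \<sqsubseteq> pb f (e n)" and nf: "v \<sqsubseteq> ag (n \<cdot> f) g"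
  note nfh = A.Comp_closed[OF f n]
  have "v \<sqsubseteq> hat l j k d (n \<cdot> f) h"
    by (rule hat_left[OF d g nfh h B.le_trans[OF v w'] ag_sym[OF nfh g nf]])
  then show "v \<sqsubseteq> hat l i k (scomp i j k d e) f h"
  proof (rule hat_elim[OF d nfh h _ z])
    fix x p assume x: "x \<sqsubseteq> v" and p: "p \<in> hom A j k" and dp: "x \<sqsubseteq> pb (n \<cdot> f) (d p)"
      and ph: "x \<sqsubseteq> ag (p \<cdot> (n \<cdot> f)) h"
    \<comment> \<open>The witness for the composite along \<open>f\<close> is \<open>p n\<close>:
      here \<open>e\<close> is represented by \<open>n\<close> and, after \<open>n\<close>,
      \<open>d\<close> by \<open>p\<close>.\<close>
    note pn = A.Comp_closed[OF n p]
    note dn = hat_idem[OF d n pn]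
    have "x \<sqsubseteq> pb f (hat i j k d n (p \<cdot> n))"
      using pb_mono[OF f _ pb_le_hat[OF d n p] dn] dp pb_comp[OF f n sec_idem[OF d p]] by simp
    then have "x \<sqsubseteq> pb f (e n \<sqinter> hat i j k d n (p \<cdot> n))"
      using pb_meet[OF f sec_idem[OF e n] dn] B.le_trans[OF x en] by simp
    moreover have "e n \<sqinter> hat i j k d n (p \<cdot> n) \<sqsubseteq> scomp i j k d e (p \<cdot> n)"
      using comp_intro[OF d e pn n] B.le_idem_comp_iff[OF sec_idem[OF e n] dn]
        B.le_refl[OF idem_hom[OF B.idem_comp[OF sec_idem[OF e n] dn]]] by blast
    ultimately have "x \<sqsubseteq> pb f (scomp i j k d e (p \<cdot> n))"
      by (rule pb_mono[OF f _ _ comp_idem[OF d e pn]])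
    then show "x \<sqsubseteq> hat l i k (scomp i j k d e) f h"
      using ph A.Comp_assoc[OF f n p] by (intro hat_intro[OF de f h pn]) simp_all
  qed
qed

lemma hat_comp_elim:
  assumes d: "d \<in> sections j k" and e: "e \<in> sections i j" and f: "f \<in> hom A l i" and h: "h \<in> hom A l k"
    and w: "w \<sqsubseteq> hat l i k (scomp i j k d e) f h" and z: "z \<in> opens l"
    and step: "\<And>v g. v \<sqsubseteq> w \<Longrightarrow> g \<in> hom A l j \<Longrightarrow> v \<sqsubseteq> hat l i j e f g \<Longrightarrow>
      v \<sqsubseteq> hat l j k d g h \<Longrightarrow> v \<sqsubseteq> z"
  shows "w \<sqsubseteq> z"
proof (rule hat_elim[OF comp_sections[OF d e] f h w z])
  fix v m assume v: "v \<sqsubseteq> w" and m: "m \<in> hom A i k" and vm: "v \<sqsubseteq> pb f (scomp i j k d e m)"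
    and vh: "v \<sqsubseteq> ag (m \<cdot> f) h"
  show "v \<sqsubseteq> z"
  proof (rule pb_comp_elim[OF d e m f vm z])
    fix x n assume x: "x \<sqsubseteq> v" and n: "n \<in> hom A i j" and en: "x \<sqsubseteq> pb f (e n)"
      and dn: "x \<sqsubseteq> pb f (hat i j k d n m)"
    note nf = A.Comp_closed[OF f n]
    \<comment> \<open>The intermediate index is \<open>n f\<close>, the composite of
      \<open>f\<close> with the arrow representing \<open>e\<close>.\<close>
    have 1: "x \<sqsubseteq> hat l i j e f (n \<cdot> f)"
      by (rule B.le_trans[OF en pb_le_hat[OF e f n]])
    have 2: "x \<sqsubseteq> hat l j k d (n \<cdot> f) h"
    proof (rule pb_hat_elim[OF d n m f dn hat_idem[OF d nf h]])
      fix y g assume y: "y \<sqsubseteq> x" and g: "g \<in> hom A j k" and 1: "y \<sqsubseteq> pb (n \<cdot> f) (d g)"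
        and 2: "y \<sqsubseteq> ag (g \<cdot> (n \<cdot> f)) (m \<cdot> f)"
      show "y \<sqsubseteq> hat l j k d (n \<cdot> f) h"
        by (rule hat_intro[OF d nf h g 1 ag_trans[OF A.Comp_closed[OF nf g] A.Comp_closed[OF f m] h 2
                B.le_trans[OF B.le_trans[OF y x] vh]]])
    qed
    show "x \<sqsubseteq> z" by (rule step[OF B.le_trans[OF x v] nf 1 2])
  qed
qed

lemma comp_assoc:
  assumes c: "c \<in> sections k l" and d: "d \<in> sections j k" and e: "e \<in> sections i j"
  shows "scomp i j l (scomp j k l c d) e = scomp i k l c (scomp i j k d e)"
proof (rule sec_eqI)
  note cd = comp_sections[OF c d] and de = comp_sections[OF d e]
  note cde = comp_sections[OF cd e] and cde' = comp_sections[OF c de]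
  show "scomp i j l (scomp j k l c d) e \<in> sections i l" "scomp i k l c (scomp i j k d e) \<in> sections i l"
    by (rule cde, rule cde')
  fix h w assume h: "h \<in> hom A i l"
  show "w \<sqsubseteq> scomp i k l c (scomp i j k d e) h" if w: "w \<sqsubseteq> scomp i j l (scomp j k l c d) e h"
  proof (rule comp_elim[OF cd e h w sec_idem[OF cde' h]])
    fix v f assume f: "f \<in> hom A i j" and ef: "v \<sqsubseteq> e f" and vf: "v \<sqsubseteq> hat i j l (scomp j k l c d) f h"
    show "v \<sqsubseteq> scomp i k l c (scomp i j k d e) h"
    proof (rule hat_comp_elim[OF c d f h vf sec_idem[OF cde' h]])
      fix x g assume x: "x \<sqsubseteq> v" and g: "g \<in> hom A i k" and 1: "x \<sqsubseteq> hat i j k d f g"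
        and 2: "x \<sqsubseteq> hat i k l c g h"
      show "x \<sqsubseteq> scomp i k l c (scomp i j k d e) h"
        by (rule comp_intro[OF c de h g comp_intro[OF d e g f B.le_trans[OF x ef] 1] 2])
    qed
  qed
  show "w \<sqsubseteq> scomp i j l (scomp j k l c d) e h" if w: "w \<sqsubseteq> scomp i k l c (scomp i j k d e) h"
  proof (rule comp_elim[OF c de h w sec_idem[OF cde h]])
    fix v g assume g: "g \<in> hom A i k" and vg: "v \<sqsubseteq> scomp i j k d e g" and cg: "v \<sqsubseteq> hat i k l c g h"
    show "v \<sqsubseteq> scomp i j l (scomp j k l c d) e h"
    proof (rule comp_elim[OF d e g vg sec_idem[OF cde h]])
      fix x f assume x: "x \<sqsubseteq> v" and f: "f \<in> hom A i j" and ef: "x \<sqsubseteq> e f" and df: "x \<sqsubseteq> hat i j k d f g"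
      show "x \<sqsubseteq> scomp i j l (scomp j k l c d) e h"
        by (rule comp_intro[OF cd e h f ef hat_comp_intro[OF c d f g h df B.le_trans[OF x cg]]])
    qed
  qed
qed

section \<open>Sections coming from arrows of \<open>A\<close>, and the unit laws\<close>

text \<open>The analogue of a representable: the regions [x = h] for varying \<open>h\<close>. It is
  the arrow \<open>x\<close> as seen in the intermediate category.\<close>

definition yon where "yon i j x = restrict (ag x) (hom A i j)"

lemma yon_apply: "h \<in> hom A i j \<Longrightarrow> yon i j x h = ag x h"
  by (simp add: yon_def)

lemma yon_sections:
  assumes x: "x \<in> hom A i j"
  shows "yon i j x \<in> sections i j"
proof (rule sectionsI)
  show "yon i j x \<in> extensional (hom A i j)" by (simp add: yon_def)
  fix f assume f: "f \<in> hom A i j"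
  show "yon i j x f \<in> opens i" using f ag_idem[OF x f] by (simp add: yon_apply)
  fix g w assume g: "g \<in> hom A i j" and w: "w \<sqsubseteq> yon i j x f"
  show "w \<sqsubseteq> ag f g" if "w \<sqsubseteq> yon i j x g"
    using that w f g ag_trans[OF f x g ag_sym[OF x f]] by (simp add: yon_apply)
  show "w \<sqsubseteq> yon i j x g" if "w \<sqsubseteq> ag f g"
    using that w f g ag_trans[OF x f g] by (simp add: yon_apply)
qed

text \<open>In one direction a witness \<open>g\<close> agrees with \<open>x\<close> along
  \<open>f\<close>, so \<open>x f\<close> agrees with \<open>g f\<close> and hence with
  \<open>h\<close>; in the other \<open>x\<close> is its own witness.\<close>

lemma hat_yon:
  assumes x: "x \<in> hom A j k" and f: "f \<in> hom A i j" and h: "h \<in> hom A i k"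
  shows "w \<sqsubseteq> hat i j k (yon j k x) f h \<longleftrightarrow> w \<sqsubseteq> ag (x \<cdot> f) h"
proof
  note y = yon_sections[OF x] and xf = A.Comp_closed[OF f x]
  show "w \<sqsubseteq> ag (x \<cdot> f) h" if w: "w \<sqsubseteq> hat i j k (yon j k x) f h"
  proof (rule hat_elim[OF y f h w ag_idem[OF xf h]])
    fix v g assume g: "g \<in> hom A j k" and 1: "v \<sqsubseteq> pb f (yon j k x g)" and 2: "v \<sqsubseteq> ag (g \<cdot> f) h"
    show "v \<sqsubseteq> ag (x \<cdot> f) h"
      using 1 ag_pb[OF f x g] yon_apply[OF g]
      by (intro ag_trans[OF xf A.Comp_closed[OF f g] h _ 2]) simp
  qed
  assume w: "w \<sqsubseteq> ag (x \<cdot> f) h"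
  then have "w \<sqsubseteq> pb f (yon j k x x)"
    using pb_ag_refl[OF f x] yon_apply[OF x] ag_dom(1)[OF xf h] by simp
  with w show "w \<sqsubseteq> hat i j k (yon j k x) f h"
    by (intro hat_intro[OF y f h x])
qed

lemma comp_yon_left:
  assumes x: "x \<in> hom A j k" and e: "e \<in> sections i j" and h: "h \<in> hom A i k" and f: "f \<in> hom A i j"
    and w: "w \<sqsubseteq> e f" "w \<sqsubseteq> ag (x \<cdot> f) h"
  shows "w \<sqsubseteq> scomp i j k (yon j k x) e h"
  by (rule comp_intro[OF yon_sections[OF x] e h f w(1)]) (use w hat_yon[OF x f h] in blast)

lemma comp_yon_right:
  assumes d: "d \<in> sections j k" and x: "x \<in> hom A i j" and h: "h \<in> hom A i k"
  shows "w \<sqsubseteq> scomp i j k d (yon i j x) h \<longleftrightarrow> w \<sqsubseteq> hat i j k d x h"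
proof
  show "w \<sqsubseteq> hat i j k d x h" if w: "w \<sqsubseteq> scomp i j k d (yon i j x) h"
  proof (rule comp_elim[OF d yon_sections[OF x] h w hat_idem[OF d x h]])
    fix v f assume f: "f \<in> hom A i j" and 1: "v \<sqsubseteq> yon i j x f" and 2: "v \<sqsubseteq> hat i j k d f h"
    show "v \<sqsubseteq> hat i j k d x h"
      using 1 yon_apply[OF f] ag_sym[OF x f] by (intro hat_left[OF d f x h 2]) simp
  qed
  assume w: "w \<sqsubseteq> hat i j k d x h"
  show "w \<sqsubseteq> scomp i j k d (yon i j x) h"
    using hat_dom[OF d x h w] yon_apply[OF x]
    by (intro comp_intro[OF d yon_sections[OF x] h x _ w]) simp
qed

lemma comp_yon_yon:
  assumes x: "x \<in> hom A i j" and y: "y \<in> hom A j k"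
  shows "scomp i j k (yon j k y) (yon i j x) = yon i k (y \<cdot> x)"
  using comp_yon_right[OF yon_sections[OF y] x] hat_yon[OF y x] yon_apply
  by (intro sec_eqI[OF comp_sections[OF yon_sections[OF y] yon_sections[OF x]]
        yon_sections[OF A.Comp_closed[OF x y]]]) auto

lemma comp_Ide_right:
  assumes i: "i \<in> Obj A" and e: "e \<in> sections i j"
  shows "scomp i i j e (yon i i (Ide A i)) = e"
  using comp_yon_right[OF e A.Ide_closed[OF i]] hat_Ide[OF e]
  by (intro sec_eqI[OF comp_sections[OF e yon_sections[OF A.Ide_closed[OF i]]] e]) auto

lemma comp_Ide_left:
  assumes j: "j \<in> Obj A" and e: "e \<in> sections i j"
  shows "scomp i j j (yon j j (Ide A j)) e = e"
proof (rule sec_eqI)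
  note I = A.Ide_closed[OF j]
  note y = yon_sections[OF I]
  show "scomp i j j (yon j j (Ide A j)) e \<in> sections i j" by (rule comp_sections[OF y e])
  show "e \<in> sections i j" by (rule e)
  fix h w assume h: "h \<in> hom A i j"
  show "w \<sqsubseteq> e h" if w: "w \<sqsubseteq> scomp i j j (yon j j (Ide A j)) e h"
  proof (rule comp_elim[OF y e h w sec_idem[OF e h]])
    fix v f assume f: "f \<in> hom A i j" and 1: "v \<sqsubseteq> e f" and 2: "v \<sqsubseteq> hat i j j (yon j j (Ide A j)) f h"
    show "v \<sqsubseteq> e h"
      using 2 hat_yon[OF I f h] A.Comp_Ide_left[OF f] by (intro sec_move[OF e f h 1]) simp
  qed
  show "w \<sqsubseteq> scomp i j j (yon j j (Ide A j)) e h" if w: "w \<sqsubseteq> e h"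
    using sec_agree[OF e h h w w] A.Comp_Ide_left[OF h] by (intro comp_yon_left[OF I e h h w]) simp
qed

section \<open>Partial identities and the restriction axioms\<close>

text \<open>The open \<open>u\<close> as a partial identity: [u = h] is the part of [Ide = h] inside
  \<open>u\<close>. Every open of \<open>F i\<close> occurs, whether or not it comes from
  \<open>A\<close>, which is what the hyperconnected factor requires.\<close>

definition idf where "idf i u = restrict (\<lambda>h. u \<sqinter> ag (Ide A i) h) (hom A i i)"

context
  fixes i u
  assumes i: "i \<in> Obj A" and u: "u \<in> opens i"
begin

lemma le_idf: "h \<in> hom A i i \<Longrightarrow> w \<sqsubseteq> idf i u h \<longleftrightarrow> w \<sqsubseteq> u \<and> w \<sqsubseteq> ag (Ide A i) h"
  using B.le_idem_comp_iff[OF u ag_idem[OF A.Ide_closed[OF i]]] by (simp add: idf_def)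

lemma idf_sections: "idf i u \<in> sections i i"
proof (rule sectionsI)
  note I = A.Ide_closed[OF i]
  show "idf i u \<in> extensional (hom A i i)" by (simp add: idf_def)
  fix f assume f: "f \<in> hom A i i"
  show "idf i u f \<in> opens i" using f B.idem_comp[OF u ag_idem[OF I f]] by (simp add: idf_def)
  fix g w assume g: "g \<in> hom A i i" and w: "w \<sqsubseteq> idf i u f"
  show "w \<sqsubseteq> ag f g" if "w \<sqsubseteq> idf i u g"
    using that w f g ag_trans[OF f I g ag_sym[OF I f]] by (simp add: le_idf)
  show "w \<sqsubseteq> idf i u g" if "w \<sqsubseteq> ag f g"
    using that w f g ag_trans[OF I f g] by (simp add: le_idf)
qed

text \<open>Wherever \<open>idf i u\<close> is represented by \<open>f\<close>, the arrow
  \<open>f\<close> agrees with the identity, so \<open>hat_left\<close> moves to the identity row,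
  which is \<open>e\<close>.\<close>

lemma comp_idf_right:
  assumes e: "e \<in> sections i j" and h: "h \<in> hom A i j"
  shows "w \<sqsubseteq> scomp i i j e (idf i u) h \<longleftrightarrow> w \<sqsubseteq> u \<and> w \<sqsubseteq> e h"
proof
  note I = A.Ide_closed[OF i] and s = idf_sections
  have z: "u \<sqinter> e h \<in> opens i" by (rule B.idem_comp[OF u sec_idem[OF e h]])
  assume w: "w \<sqsubseteq> scomp i i j e (idf i u) h"
  have "w \<sqsubseteq> u \<sqinter> e h"
  proof (rule comp_elim[OF e s h w z])
    fix v f assume f: "f \<in> hom A i i" and 1: "v \<sqsubseteq> idf i u f" and 2: "v \<sqsubseteq> hat i i j e f h"
    have "v \<sqsubseteq> hat i i j e (Ide A i) h"
      using 1 le_idf[OF f] ag_sym[OF I f] by (intro hat_left[OF e f I h 2]) simp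
    then show "v \<sqsubseteq> u \<sqinter> e h"
      using 1 le_idf[OF f] hat_Ide[OF e h] B.le_idem_comp_iff[OF u sec_idem[OF e h]] by simp
  qed
  then show "w \<sqsubseteq> u \<and> w \<sqsubseteq> e h" using B.le_idem_comp_iff[OF u sec_idem[OF e h]] by simp
next
  note I = A.Ide_closed[OF i] and s = idf_sections
  assume w: "w \<sqsubseteq> u \<and> w \<sqsubseteq> e h"
  then have "w \<sqsubseteq> idf i u (Ide A i)"
    using le_idf[OF I] ag_Ide[OF i] B.le_idem[OF _ u] by blast
  then show "w \<sqsubseteq> scomp i i j e (idf i u) h"
    using w hat_Ide[OF e h] by (intro comp_intro[OF e s h I]) simp_all
qed

lemma extent_comp_idf:
  assumes e: "e \<in> sections i j"
  shows "extent i j (scomp i i j e (idf i u)) = extent i j e \<sqinter> u"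
proof (rule B.le_antisym)
  note ee = extent_idem[OF i e] and c = comp_sections[OF e idf_sections]
  have z: "extent i j e \<sqinter> u \<in> opens i" by (rule B.idem_comp[OF ee u])
  have z': "extent i j (scomp i i j e (idf i u)) \<in> opens i" by (rule extent_idem[OF i c])
  show "extent i j (scomp i i j e (idf i u)) \<sqsubseteq> extent i j e \<sqinter> u"
  proof (rule extent_elim[OF c B.le_refl[OF idem_hom[OF z']] z])
    fix v f assume f: "f \<in> hom A i j" and "v \<sqsubseteq> scomp i i j e (idf i u) f"
    then show "v \<sqsubseteq> extent i j e \<sqinter> u"
      using comp_idf_right[OF e f] extent_intro[OF e f] B.le_idem_comp_iff[OF ee u] by simp
  qed
  have r: "extent i j e \<sqinter> u \<sqsubseteq> extent i j e" "extent i j e \<sqinter> u \<sqsubseteq> u"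
    using B.le_idem_comp_iff[OF ee u] B.le_refl[OF idem_hom[OF z]] by auto
  show "extent i j e \<sqinter> u \<sqsubseteq> extent i j (scomp i i j e (idf i u))"
  proof (rule extent_elim[OF e r(1) z'])
    fix v f assume v: "v \<sqsubseteq> extent i j e \<sqinter> u" and f: "f \<in> hom A i j" and vf: "v \<sqsubseteq> e f"
    show "v \<sqsubseteq> extent i j (scomp i i j e (idf i u))"
      using comp_idf_right[OF e f] vf B.le_trans[OF v r(2)] by (intro extent_intro[OF c f]) simp
  qed
qed

lemma extent_idf: "extent i i (idf i u) = u"
proof (rule B.le_antisym)
  note s = idf_sections
  show "extent i i (idf i u) \<sqsubseteq> u"
    by (rule extent_elim[OF s B.le_refl[OF idem_hom[OF extent_idem[OF i s]]] u]) (simp add: le_idf)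
  show "u \<sqsubseteq> extent i i (idf i u)"
    using le_idf[OF A.Ide_closed[OF i]] B.le_refl[OF idem_hom[OF u]] ag_Ide[OF i u]
    by (intro extent_intro[OF s A.Ide_closed[OF i]]) simp
qed

end

lemma comp_idf_idf:
  assumes i: "i \<in> Obj A" and u: "u \<in> opens i" and v: "v \<in> opens i"
  shows "scomp i i i (idf i u) (idf i v) = idf i (u \<sqinter> v)"
  using comp_idf_right[OF i v idf_sections[OF i u]] le_idf[OF i u] le_idf[OF i B.idem_comp[OF u v]]
    B.le_idem_comp_iff[OF u v]
  by (intro sec_eqI[OF comp_sections[OF idf_sections[OF i u] idf_sections[OF i v]]
        idf_sections[OF i B.idem_comp[OF u v]]]) auto

lemma comp_idf_extent:
  assumes i: "i \<in> Obj A" and e: "e \<in> sections i j"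
  shows "scomp i i j e (idf i (extent i j e)) = e"
  using comp_idf_right[OF i extent_idem[OF i e] e] extent_intro[OF e]
  by (intro sec_eqI[OF comp_sections[OF e idf_sections[OF i extent_idem[OF i e]]] e]) auto

lemma hat_idf:
  assumes j: "j \<in> Obj A" and u: "u \<in> opens j" and f: "f \<in> hom A i j" and h: "h \<in> hom A i j"
  shows "w \<sqsubseteq> hat i j j (idf j u) f h \<longleftrightarrow> w \<sqsubseteq> pb f u \<and> w \<sqsubseteq> ag f h"
proof
  note I = A.Ide_closed[OF j] and s = idf_sections[OF j u]
  have z: "pb f u \<sqinter> ag f h \<in> opens i" by (rule B.idem_comp[OF pb_idem[OF f u] ag_idem[OF f h]])
  assume w: "w \<sqsubseteq> hat i j j (idf j u) f h"
  have "w \<sqsubseteq> pb f u \<sqinter> ag f h"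
  proof (rule hat_elim[OF s f h w z])
    fix v g assume g: "g \<in> hom A j j" and 1: "v \<sqsubseteq> pb f (idf j u g)" and 2: "v \<sqsubseteq> ag (g \<cdot> f) h"
    have "idf j u g = u \<sqinter> ag (Ide A j) g" using g by (simp add: idf_def)
    then have 3: "v \<sqsubseteq> pb f u" "v \<sqsubseteq> pb f (ag (Ide A j) g)"
      using 1 pb_meet[OF f u ag_idem[OF I g]] by auto
    have "v \<sqsubseteq> ag f (g \<cdot> f)" using ag_pb[OF f I g 3(2)] A.Comp_Ide_left[OF f] by simp
    then have "v \<sqsubseteq> ag f h" by (rule ag_trans[OF f A.Comp_closed[OF f g] h _ 2])
    with 3(1) show "v \<sqsubseteq> pb f u \<sqinter> ag f h"
      using B.le_idem_comp_iff[OF pb_idem[OF f u] ag_idem[OF f h]] by simp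
  qed
  then show "w \<sqsubseteq> pb f u \<and> w \<sqsubseteq> ag f h"
    using B.le_idem_comp_iff[OF pb_idem[OF f u] ag_idem[OF f h]] by simp
next
  note I = A.Ide_closed[OF j] and s = idf_sections[OF j u]
  assume w: "w \<sqsubseteq> pb f u \<and> w \<sqsubseteq> ag f h"
  have "u \<sqsubseteq> idf j u (Ide A j)"
    using le_idf[OF j u I] B.le_refl[OF idem_hom[OF u]] ag_Ide[OF j u] by simp
  then have "w \<sqsubseteq> pb f (idf j u (Ide A j))"
    using w pb_mono[OF f _ _ sec_idem[OF s I]] by blast
  then show "w \<sqsubseteq> hat i j j (idf j u) f h"
    using w A.Comp_Ide_left[OF f] by (intro hat_intro[OF s f h I]) simp_all
qed

text \<open>Together with \<open>extent_comp_elim\<close> this describes where a composite is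
  defined: \<open>e\<close> is represented by some \<open>f\<close> that lands in the extent of
  \<open>d\<close>. A local witness \<open>g\<close> for \<open>d\<close> then gives the value
  \<open>g f\<close>.\<close>

lemma extent_comp_intro:
  assumes d: "d \<in> sections j k" and e: "e \<in> sections i j" and f: "f \<in> hom A i j"
    and w: "w \<sqsubseteq> e f" and w': "w \<sqsubseteq> pb f (extent j k d)"
  shows "w \<sqsubseteq> extent i k (scomp i j k d e)"
proof (rule pb_extent_elim[OF f d w'])
  note de = comp_sections[OF d e]
  show "extent i k (scomp i j k d e) \<in> opens i" by (rule extent_idem[OF A.hom_Obj(1)[OF f] de])
  fix v g assume v: "v \<sqsubseteq> w" and g: "g \<in> hom A j k" and vg: "v \<sqsubseteq> pb f (d g)"
  note gf = A.Comp_closed[OF f g]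
  show "v \<sqsubseteq> extent i k (scomp i j k d e)"
    by (rule extent_intro[OF de gf comp_intro[OF d e gf f B.le_trans[OF v w]
            B.le_trans[OF vg pb_le_hat[OF d f g]]]])
qed

lemma extent_comp_elim:
  assumes d: "d \<in> sections j k" and e: "e \<in> sections i j" and j: "j \<in> Obj A"
    and w: "w \<sqsubseteq> extent i k (scomp i j k d e)" and z: "z \<in> opens i"
    and step: "\<And>v f. v \<sqsubseteq> w \<Longrightarrow> f \<in> hom A i j \<Longrightarrow> v \<sqsubseteq> e f \<Longrightarrow> v \<sqsubseteq> pb f (extent j k d) \<Longrightarrow> v \<sqsubseteq> z"
  shows "w \<sqsubseteq> z"
proof (rule extent_elim[OF comp_sections[OF d e] w z])
  fix v h assume v: "v \<sqsubseteq> w" and h: "h \<in> hom A i k" and vh: "v \<sqsubseteq> scomp i j k d e h"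
  show "v \<sqsubseteq> z"
  proof (rule comp_elim[OF d e h vh z])
    fix x f assume x: "x \<sqsubseteq> v" and f: "f \<in> hom A i j" and ef: "x \<sqsubseteq> e f" and df: "x \<sqsubseteq> hat i j k d f h"
    note ed = extent_idem[OF j d]
    have "x \<sqsubseteq> pb f (extent j k d)"
    proof (rule hat_elim[OF d f h df pb_idem[OF f ed]])
      fix y g assume g: "g \<in> hom A j k" and y: "y \<sqsubseteq> pb f (d g)"
      show "y \<sqsubseteq> pb f (extent j k d)" by (rule pb_mono[OF f y extent_upper[OF d g] ed])
    qed
    then show "x \<sqsubseteq> z" by (rule step[OF B.le_trans[OF x v] f ef])
  qed
qed

text \<open>The last restriction axiom for the intermediate category. Where \<open>e\<close> is
  represented by \<open>f\<close>, both sides are \<open>e\<close> cut down to the inverse image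
  along \<open>f\<close> of the extent of \<open>d\<close>.\<close>

lemma comp_idf_left:
  assumes i: "i \<in> Obj A" and j: "j \<in> Obj A" and d: "d \<in> sections j k" and e: "e \<in> sections i j"
  shows "scomp i j j (idf j (extent j k d)) e = scomp i i j e (idf i (extent i k (scomp i j k d e)))"
proof (rule sec_eqI)
  note ed = extent_idem[OF j d] and de = comp_sections[OF d e]
  note ede = extent_idem[OF i de]
  note s = idf_sections[OF j ed] and t = idf_sections[OF i ede]
  show "scomp i j j (idf j (extent j k d)) e \<in> sections i j"
    "scomp i i j e (idf i (extent i k (scomp i j k d e))) \<in> sections i j"
    by (rule comp_sections[OF s e], rule comp_sections[OF e t])
  fix h w assume h: "h \<in> hom A i j"
  note z = sec_idem[OF comp_sections[OF s e] h] and z' = sec_idem[OF comp_sections[OF e t] h]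
  show "w \<sqsubseteq> scomp i i j e (idf i (extent i k (scomp i j k d e))) h"
    if w: "w \<sqsubseteq> scomp i j j (idf j (extent j k d)) e h"
  proof (rule comp_elim[OF s e h w z'])
    fix v f assume f: "f \<in> hom A i j" and ef: "v \<sqsubseteq> e f" and "v \<sqsubseteq> hat i j j (idf j (extent j k d)) f h"
    then have 1: "v \<sqsubseteq> pb f (extent j k d)" "v \<sqsubseteq> ag f h" using hat_idf[OF j ed f h] by auto
    show "v \<sqsubseteq> scomp i i j e (idf i (extent i k (scomp i j k d e))) h"
      using comp_idf_right[OF i ede e h] sec_move[OF e f h ef 1(2)] extent_comp_intro[OF d e f ef 1(1)]
      by simp
  qed
  show "w \<sqsubseteq> scomp i j j (idf j (extent j k d)) e h"
    if "w \<sqsubseteq> scomp i i j e (idf i (extent i k (scomp i j k d e))) h"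
  proof -
    have 1: "w \<sqsubseteq> extent i k (scomp i j k d e)" "w \<sqsubseteq> e h"
      using that comp_idf_right[OF i ede e h] by auto
    show ?thesis
    proof (rule extent_comp_elim[OF d e j 1(1) z])
      fix v f assume v: "v \<sqsubseteq> w" and f: "f \<in> hom A i j" and ef: "v \<sqsubseteq> e f" and vf: "v \<sqsubseteq> pb f (extent j k d)"
      have "v \<sqsubseteq> ag f h" by (rule sec_agree[OF e f h ef B.le_trans[OF v 1(2)]])
      then show "v \<sqsubseteq> scomp i j j (idf j (extent j k d)) e h"
        using vf hat_idf[OF j ed f h] by (intro comp_intro[OF s e h f ef]) simp
    qed
  qed
qed

end

section \<open>The intermediate restriction category\<close>

context localic_part
begin

text \<open>An arrow carries its source and target, because \<open>Dom\<close> and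
  \<open>Cod\<close> are functions of the arrow and the family \<open>e\<close> does not record
  them. With the objects of \<open>A\<close> as objects, the left factor is the identity on
  objects.\<close>

definition fact_cat :: "('o, 'o \<times> ('m \<Rightarrow> 'n) \<times> 'o) rcat" where
  "fact_cat = \<lparr>Obj = Obj A, Arr = {(i, e, j). i \<in> Obj A \<and> j \<in> Obj A \<and> e \<in> sections i j},
     Dom = fst, Cod = snd \<circ> snd, Ide = (\<lambda>i. (i, yon i i (Ide A i), i)),
     Comp = (\<lambda>(_, d, k) (i, e, j). (i, scomp i j k d e, k)),
     Rst = (\<lambda>(i, e, j). (i, idf i (extent i j e), i))\<rparr>"

lemma fact_simps [simp]:
  "Obj fact_cat = Obj A" "Ide fact_cat i = (i, yon i i (Ide A i), i)"
  "Dom fact_cat x = fst x" "Cod fact_cat x = snd (snd x)"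
  "(j', d, k) \<odot>\<^bsub>fact_cat\<^esub> (i, e, j) = (i, scomp i j k d e, k)"
  "Rst fact_cat (i, e, j) = (i, idf i (extent i j e), i)"
  by (simp_all add: fact_cat_def)

lemma fact_hom: "(k, e, l) \<in> hom fact_cat i j \<longleftrightarrow>
    k = i \<and> l = j \<and> i \<in> Obj A \<and> j \<in> Obj A \<and> e \<in> sections i j"
  by (auto simp: hom_def fact_cat_def)

lemma fact_homE:
  assumes "x \<in> hom fact_cat i j"
  obtains e where "x = (i, e, j)" "i \<in> Obj A" "j \<in> Obj A" "e \<in> sections i j"
  using assms fact_hom by (cases x) auto

lemma fact_ArrE:
  assumes "x \<in> Arr fact_cat"
  obtains i e j where "x = (i, e, j)" "i \<in> Obj A" "j \<in> Obj A" "e \<in> sections i j"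
  using assms by (auto simp: fact_cat_def)

lemma fact_category: "category fact_cat"
proof
  fix f assume "f \<in> Arr fact_cat"
  then show "Dom fact_cat f \<in> Obj fact_cat" "Cod fact_cat f \<in> Obj fact_cat"
    by (auto elim!: fact_ArrE)
next
  fix i assume "i \<in> Obj fact_cat"
  then show "Ide fact_cat i \<in> hom fact_cat i i"
    using yon_sections[OF A.Ide_closed] by (simp add: fact_hom)
next
  fix f g i j k assume "f \<in> hom fact_cat i j" "g \<in> hom fact_cat j k"
  then show "g \<odot>\<^bsub>fact_cat\<^esub> f \<in> hom fact_cat i k"
    by (elim fact_homE) (simp add: fact_hom comp_sections)
next
  fix f g h i j k l
  assume "f \<in> hom fact_cat i j" "g \<in> hom fact_cat j k" "h \<in> hom fact_cat k l"
  then show "(h \<odot>\<^bsub>fact_cat\<^esub> g) \<odot>\<^bsub>fact_cat\<^esub> f = h \<odot>\<^bsub>fact_cat\<^esub> (g \<odot>\<^bsub>fact_cat\<^esub> f)"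
    by (elim fact_homE) (simp add: comp_assoc)
next
  fix f i j assume "f \<in> hom fact_cat i j"
  then show "f \<odot>\<^bsub>fact_cat\<^esub> Ide fact_cat i = f" "Ide fact_cat j \<odot>\<^bsub>fact_cat\<^esub> f = f"
    by (auto elim!: fact_homE simp: comp_Ide_right comp_Ide_left)
qed

sublocale T: category fact_cat
  by (rule fact_category)

sublocale T: restriction_category fact_cat
proof
  fix f i j assume "f \<in> hom fact_cat i j"
  then show "Rst fact_cat f \<in> hom fact_cat i i"
    by (elim fact_homE) (simp add: fact_hom idf_sections extent_idem)
next
  fix f assume "f \<in> Arr fact_cat"
  then show "f \<odot>\<^bsub>fact_cat\<^esub> Rst fact_cat f = f"
    by (elim fact_ArrE) (simp add: comp_idf_extent)
next
  fix f g i j k assume fg: "f \<in> hom fact_cat i j" "g \<in> hom fact_cat i k"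
  then show "Rst fact_cat f \<odot>\<^bsub>fact_cat\<^esub> Rst fact_cat g = Rst fact_cat g \<odot>\<^bsub>fact_cat\<^esub> Rst fact_cat f"
    by (elim fact_homE) (simp add: comp_idf_idf extent_idem B.idem_commute[OF extent_idem extent_idem])
  show "Rst fact_cat (g \<odot>\<^bsub>fact_cat\<^esub> Rst fact_cat f) = Rst fact_cat g \<odot>\<^bsub>fact_cat\<^esub> Rst fact_cat f"
    using fg by (elim fact_homE) (simp add: comp_idf_idf extent_idem extent_comp_idf)
next
  fix f g i j k assume "f \<in> hom fact_cat i j" "g \<in> hom fact_cat j k"
  then show "Rst fact_cat g \<odot>\<^bsub>fact_cat\<^esub> f = f \<odot>\<^bsub>fact_cat\<^esub> Rst fact_cat (g \<odot>\<^bsub>fact_cat\<^esub> f)"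
    by (elim fact_homE) (simp add: comp_idf_left)
qed

section \<open>Order and joins in the intermediate category\<close>

text \<open>For the converse, let \<open>d\<close> be represented by \<open>h\<close> inside the
  extent of \<open>e\<close>. Locally \<open>e\<close> is represented by some \<open>f\<close>,
  hence so is \<open>d\<close>; thus \<open>f\<close> and \<open>h\<close> agree there, and
  \<open>e\<close> is represented by \<open>h\<close> as well.\<close>

lemma fact_le:
  assumes i: "i \<in> Obj A" and j: "j \<in> Obj A" and e: "e \<in> sections i j" and d: "d \<in> sections i j"
  shows "le fact_cat (i, e, j) (i, d, j) \<longleftrightarrow> (\<forall>h\<in>hom A i j. e h \<sqsubseteq> d h)"
proof
  note ee = extent_idem[OF i e]
  note c = comp_sections[OF d idf_sections[OF i ee]]
  have eh: "(i, e, j) \<in> hom fact_cat i j" and dh: "(i, d, j) \<in> hom fact_cat i j"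
    using assms by (auto simp: fact_hom)
  show "\<forall>h\<in>hom A i j. e h \<sqsubseteq> d h" if l: "le fact_cat (i, e, j) (i, d, j)"
  proof
    fix h assume h: "h \<in> hom A i j"
    have "scomp i i j d (idf i (extent i j e)) = e" using le_eq[OF l] by simp
    then show "e h \<sqsubseteq> d h"
      using comp_idf_right[OF i ee d h] B.le_refl[OF idem_hom[OF sec_idem[OF e h]]] by metis
  qed
  assume le: "\<forall>h\<in>hom A i j. e h \<sqsubseteq> d h"
  have "scomp i i j d (idf i (extent i j e)) = e"
  proof (rule sec_eqI[OF c e])
    fix h w assume h: "h \<in> hom A i j"
    show "w \<sqsubseteq> scomp i i j d (idf i (extent i j e)) h" if w: "w \<sqsubseteq> e h"
      using comp_idf_right[OF i ee d h] extent_intro[OF e h w] B.le_trans[OF w] le h by blast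
    assume "w \<sqsubseteq> scomp i i j d (idf i (extent i j e)) h"
    then have w: "w \<sqsubseteq> extent i j e" "w \<sqsubseteq> d h" using comp_idf_right[OF i ee d h] by auto
    show "w \<sqsubseteq> e h"
    proof (rule extent_elim[OF e w(1) sec_idem[OF e h]])
      fix v f assume v: "v \<sqsubseteq> w" and f: "f \<in> hom A i j" and vf: "v \<sqsubseteq> e f"
      have "v \<sqsubseteq> d f" using B.le_trans[OF vf] le f by blast
      then have "v \<sqsubseteq> ag f h" by (rule sec_agree[OF d f h _ B.le_trans[OF v w(2)]])
      then show "v \<sqsubseteq> e h" by (rule sec_move[OF e f h vf])
    qed
  qed
  then show "le fact_cat (i, e, j) (i, d, j)" by (intro leI[OF eh dh]) simp
qed

lemma fact_joinI:
  assumes i: "i \<in> Obj A" and j: "j \<in> Obj A" and E: "E \<subseteq> sections i j" and d: "d \<in> sections i j"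
    and up: "\<And>e h. e \<in> E \<Longrightarrow> h \<in> hom A i j \<Longrightarrow> e h \<sqsubseteq> d h"
    and cover: "\<And>h. h \<in> hom A i j \<Longrightarrow> d h \<sqsubseteq> osup B (omap F i) ((\<lambda>e. e h) ` E)"
  shows "is_join fact_cat i j ((\<lambda>e. (i, e, j)) ` E) (i, d, j)"
  unfolding is_join_def
proof (intro conjI ballI impI)
  show "(\<lambda>e. (i, e, j)) ` E \<subseteq> hom fact_cat i j" "(i, d, j) \<in> hom fact_cat i j"
    using i j E d by (auto simp: fact_hom)
  show "le fact_cat x (i, d, j)" if "x \<in> (\<lambda>e. (i, e, j)) ` E" for x
    using that up fact_le[OF i j _ d] E by blast
  fix t assume "t \<in> hom fact_cat i j" and ub: "\<forall>x\<in>(\<lambda>e. (i, e, j)) ` E. le fact_cat x t"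
  then obtain c where t: "t = (i, c, j)" and c: "c \<in> sections i j" by (elim fact_homE) blast
  have le: "e h \<sqsubseteq> c h" if "e \<in> E" "h \<in> hom A i j" for e h
    using that ub E fact_le[OF i j _ c] t by blast
  have "d h \<sqsubseteq> c h" if h: "h \<in> hom A i j" for h
  proof (rule B.le_trans[OF cover[OF h]])
    show "osup B (omap F i) ((\<lambda>e. e h) ` E) \<sqsubseteq> c h"
    proof (rule B.osup_least[OF _ sec_idem[OF c h]])
      show "(\<lambda>e. e h) ` E \<subseteq> opens i" using E sec_idem h by blast
    qed (use le h in blast)
  qed
  then show "le fact_cat (i, d, j) t" using fact_le[OF i j d c] t by simp
qed

definition joinsec where
  "joinsec i j E = restrict (\<lambda>h. osup B (omap F i) ((\<lambda>e. e h) ` E)) (hom A i j)"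

lemma joinsec_apply: "h \<in> hom A i j \<Longrightarrow> joinsec i j E h = osup B (omap F i) ((\<lambda>e. e h) ` E)"
  by (simp add: joinsec_def)

context
  fixes i j E
  assumes i: "i \<in> Obj A" and E: "E \<subseteq> sections i j"
begin

lemma joinsec_image: "h \<in> hom A i j \<Longrightarrow> (\<lambda>e. e h) ` E \<subseteq> opens i"
  using E sec_idem by blast

lemma joinsec_upper: "e \<in> E \<Longrightarrow> h \<in> hom A i j \<Longrightarrow> e h \<sqsubseteq> joinsec i j E h"
  unfolding joinsec_apply by (rule B.osup_upper[OF _ joinsec_image omap_Obj[OF i]]) auto

lemma joinsec_elim:
  assumes h: "h \<in> hom A i j" and w: "w \<sqsubseteq> joinsec i j E h" and z: "z \<in> opens i"
    and step: "\<And>v e. v \<sqsubseteq> w \<Longrightarrow> e \<in> E \<Longrightarrow> v \<sqsubseteq> e h \<Longrightarrow> v \<sqsubseteq> z"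
  shows "w \<sqsubseteq> z"
  using w unfolding joinsec_apply[OF h]
  by (rule B.osup_elim[OF _ joinsec_image[OF h] z]) (use step in blast)

lemma pb_joinsec_elim:
  assumes x: "x \<in> hom A k i" and h: "h \<in> hom A i j" and w: "w \<sqsubseteq> pb x (joinsec i j E h)"
    and z: "z \<in> opens k" and step: "\<And>v e. v \<sqsubseteq> w \<Longrightarrow> e \<in> E \<Longrightarrow> v \<sqsubseteq> pb x (e h) \<Longrightarrow> v \<sqsubseteq> z"
  shows "w \<sqsubseteq> z"
  using w unfolding joinsec_apply[OF h] pb_def
  by (rule B.pull_osup_elim[OF _ amap_hom[OF x] joinsec_image[OF h] z])
    (use step in \<open>auto simp: pb_def\<close>)

text \<open>\<open>compat\<close> expresses that the members coincide where they are both defined.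
  If \<open>e\<close> is represented by \<open>f\<close> and \<open>d\<close> by \<open>g\<close>,
  then \<open>e\<close> is represented by \<open>g\<close> too, and agreement of \<open>f\<close>
  and \<open>g\<close> follows inside the single section \<open>e\<close>.\<close>

lemma joinsec_sections:
  assumes compat: "\<And>e d h w. e \<in> E \<Longrightarrow> d \<in> E \<Longrightarrow> h \<in> hom A i j \<Longrightarrow> w \<sqsubseteq> e h \<Longrightarrow>
      w \<sqsubseteq> extent i j d \<Longrightarrow> w \<sqsubseteq> d h"
  shows "joinsec i j E \<in> sections i j"
proof (rule sectionsI)
  show "joinsec i j E \<in> extensional (hom A i j)" by (simp add: joinsec_def)
  show z: "joinsec i j E f \<in> opens i" if "f \<in> hom A i j" for f
    unfolding joinsec_apply[OF that] by (rule B.osup_idem[OF joinsec_image[OF that] omap_Obj[OF i]])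
  fix f g w assume f: "f \<in> hom A i j" and g: "g \<in> hom A i j" and w: "w \<sqsubseteq> joinsec i j E f"
  show "w \<sqsubseteq> ag f g" if w': "w \<sqsubseteq> joinsec i j E g"
  proof (rule joinsec_elim[OF f w ag_idem[OF f g]])
    fix v e assume v: "v \<sqsubseteq> w" and e: "e \<in> E" and ve: "v \<sqsubseteq> e f"
    have es: "e \<in> sections i j" using e E by blast
    show "v \<sqsubseteq> ag f g"
    proof (rule joinsec_elim[OF g B.le_trans[OF v w'] ag_idem[OF f g]])
      fix x d assume x: "x \<sqsubseteq> v" and d: "d \<in> E" and xd: "x \<sqsubseteq> d g"
      have xe: "x \<sqsubseteq> e f" by (rule B.le_trans[OF x ve])
      have "x \<sqsubseteq> e g" by (rule compat[OF d e g xd extent_intro[OF es f xe]])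
      with xe show "x \<sqsubseteq> ag f g" by (rule sec_agree[OF es f g])
    qed
  qed
  show "w \<sqsubseteq> joinsec i j E g" if w': "w \<sqsubseteq> ag f g"
  proof (rule joinsec_elim[OF f w z[OF g]])
    fix v e assume v: "v \<sqsubseteq> w" and e: "e \<in> E" and ve: "v \<sqsubseteq> e f"
    have es: "e \<in> sections i j" using e E by blast
    show "v \<sqsubseteq> joinsec i j E g"
      by (rule B.le_trans[OF sec_move[OF es f g ve B.le_trans[OF v w']] joinsec_upper[OF e g]])
  qed
qed

end

lemma fact_family:
  assumes "compatible_family fact_cat i j S"
  obtains E where "i \<in> Obj A" "j \<in> Obj A" "E \<subseteq> sections i j" "S = (\<lambda>e. (i, e, j)) ` E"
    "joinsec i j E \<in> sections i j"
proof -
  have i: "i \<in> Obj A" and j: "j \<in> Obj A" and S: "S \<subseteq> hom fact_cat i j"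
    and c: "\<And>x y. x \<in> S \<Longrightarrow> y \<in> S \<Longrightarrow> compatible fact_cat x y"
    using assms by (auto simp: compatible_family_def)
  define E where "E = {e. (i, e, j) \<in> S}"
  have E: "E \<subseteq> sections i j" using S by (auto simp: E_def fact_hom)
  have SE: "S = (\<lambda>e. (i, e, j)) ` E"
  proof
    show "S \<subseteq> (\<lambda>e. (i, e, j)) ` E"
    proof
      fix x assume x: "x \<in> S"
      then obtain e where "x = (i, e, j)" using S by (blast elim: fact_homE)
      with x show "x \<in> (\<lambda>e. (i, e, j)) ` E" by (auto simp: E_def)
    qed
  qed (auto simp: E_def)
  have "joinsec i j E \<in> sections i j"
  proof (rule joinsec_sections[OF i E])
    fix e d h w assume e: "e \<in> E" and d: "d \<in> E" and h: "h \<in> hom A i j"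
      and w: "w \<sqsubseteq> e h" "w \<sqsubseteq> extent i j d"
    have es: "e \<in> sections i j" and ds: "d \<in> sections i j" using e d E by auto
    have "scomp i i j e (idf i (extent i j d)) = scomp i i j d (idf i (extent i j e))"
      using c[of "(i, e, j)" "(i, d, j)"] e d by (simp add: E_def compatible_def)
    then show "w \<sqsubseteq> d h"
      using comp_idf_right[OF i extent_idem[OF i ds] es h] comp_idf_right[OF i extent_idem[OF i es] ds h] w
      by metis
  qed
  then show thesis using that[OF i j E SE] by simp
qed

lemma fact_is_join:
  assumes i: "i \<in> Obj A" and j: "j \<in> Obj A" and E: "E \<subseteq> sections i j"
    and J: "joinsec i j E \<in> sections i j"
  shows "is_join fact_cat i j ((\<lambda>e. (i, e, j)) ` E) (i, joinsec i j E, j)"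
proof (rule fact_joinI[OF i j E J])
  show "e h \<sqsubseteq> joinsec i j E h" if "e \<in> E" "h \<in> hom A i j" for e h
    by (rule joinsec_upper[OF i E that])
  show "joinsec i j E h \<sqsubseteq> osup B (omap F i) ((\<lambda>e. e h) ` E)" if h: "h \<in> hom A i j" for h
    using B.le_refl[OF idem_hom[OF sec_idem[OF J h]]] joinsec_apply[OF h] by simp
qed

text \<open>Read off from the pointwise order. The general antisymmetry lemma lives in
  \<open>join_restriction_category\<close>, and that structure on \<open>fact_cat\<close> is what
  this one helps to establish.\<close>

lemma fact_le_antisym:
  assumes xy: "le fact_cat x y" and yx: "le fact_cat y x"
  shows "x = y"
proof -
  have "x \<in> hom fact_cat (fst x) (snd (snd x))" "y \<in> hom fact_cat (fst x) (snd (snd x))"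
    using xy by (auto simp: le_def parallel_def hom_def)
  then obtain i j e d where x: "x = (i, e, j)" and y: "y = (i, d, j)"
    and i: "i \<in> Obj A" and j: "j \<in> Obj A" and e: "e \<in> sections i j" and d: "d \<in> sections i j"
    by (elim fact_homE) simp
  have "e = d"
  proof (rule sec_eqI[OF e d])
    fix h w assume h: "h \<in> hom A i j"
    have "e h \<sqsubseteq> d h" "d h \<sqsubseteq> e h"
      using xy yx h fact_le[OF i j e d] fact_le[OF i j d e] x y by auto
    then show "w \<sqsubseteq> e h \<Longrightarrow> w \<sqsubseteq> d h" "w \<sqsubseteq> d h \<Longrightarrow> w \<sqsubseteq> e h"
      using B.le_trans by blast+
  qed
  with x y show ?thesis by simp
qed

lemma fact_joinE:
  assumes fam: "compatible_family fact_cat i j S" and s: "is_join fact_cat i j S s"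
  obtains E where "i \<in> Obj A" "j \<in> Obj A" "E \<subseteq> sections i j" "S = (\<lambda>e. (i, e, j)) ` E"
    "joinsec i j E \<in> sections i j" "s = (i, joinsec i j E, j)"
proof -
  obtain E where E: "i \<in> Obj A" "j \<in> Obj A" "E \<subseteq> sections i j" "S = (\<lambda>e. (i, e, j)) ` E"
    "joinsec i j E \<in> sections i j"
    by (rule fact_family[OF fam])
  have "is_join fact_cat i j S (i, joinsec i j E, j)"
    using fact_is_join[OF E(1,2,3,5)] E(4) by simp
  then have "s = (i, joinsec i j E, j)"
    using s fact_le_antisym unfolding is_join_def by blast
  with that[OF E] show thesis by blast
qed

sublocale T: join_restriction_category fact_cat
proof
  fix i j S assume fam: "compatible_family fact_cat i j S"
  show "\<exists>s. is_join fact_cat i j S s"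
  proof (rule fact_family[OF fam])
    fix E assume "i \<in> Obj A" "j \<in> Obj A" "E \<subseteq> sections i j"
      and S: "S = (\<lambda>e. (i, e, j)) ` E" and "joinsec i j E \<in> sections i j"
    then show ?thesis unfolding S by (blast intro: fact_is_join)
  qed
  fix s x k assume s: "is_join fact_cat i j S s" and x: "x \<in> hom fact_cat k i"
  obtain E where i: "i \<in> Obj A" and j: "j \<in> Obj A" and E: "E \<subseteq> sections i j"
    and S: "S = (\<lambda>e. (i, e, j)) ` E" and J: "joinsec i j E \<in> sections i j"
    and s': "s = (i, joinsec i j E, j)"
    by (rule fact_joinE[OF fam s])
  obtain c where x': "x = (k, c, i)" and k: "k \<in> Obj A" and c: "c \<in> sections k i"
    by (rule fact_homE[OF x])
  let ?E = "(\<lambda>e. scomp k i j e c) ` E"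
  have cE: "scomp k i j e c \<in> sections k j" if "e \<in> E" for e
    using comp_sections[OF _ c] that E by blast
  then have sE: "?E \<subseteq> sections k j" by blast
  note Jc = comp_sections[OF J c]
  have "is_join fact_cat k j ((\<lambda>e. (k, e, j)) ` ?E) (k, scomp k i j (joinsec i j E) c, j)"
  proof (rule fact_joinI[OF k j sE Jc])
    fix h assume h: "h \<in> hom A k j"
    show "e' h \<sqsubseteq> scomp k i j (joinsec i j E) c h" if E': "e' \<in> ?E" for e'
    proof -
      obtain e where e: "e \<in> E" and e': "e' = scomp k i j e c" using E' by blast
      have es: "e \<in> sections i j" using e E by blast
      note z = sec_idem[OF Jc h]
      have "scomp k i j e c h \<sqsubseteq> scomp k i j (joinsec i j E) c h"
      proof (rule comp_elim[OF es c h B.le_refl[OF idem_hom[OF sec_idem[OF cE[OF e] h]]] z])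
        fix v f assume f: "f \<in> hom A k i" and cf: "v \<sqsubseteq> c f" and vf: "v \<sqsubseteq> hat k i j e f h"
        show "v \<sqsubseteq> scomp k i j (joinsec i j E) c h"
        proof (rule hat_elim[OF es f h vf z])
          fix y g assume y: "y \<sqsubseteq> v" and g: "g \<in> hom A i j" and 1: "y \<sqsubseteq> pb f (e g)"
            and 2: "y \<sqsubseteq> ag (g \<cdot> f) h"
          \<comment> \<open>A witness for \<open>e\<close> along \<open>f\<close> is also one for
            the larger section \<open>joinsec i j E\<close>.\<close>
          have "y \<sqsubseteq> pb f (joinsec i j E g)"
            by (rule pb_mono[OF f 1 joinsec_upper[OF i E e g] sec_idem[OF J g]])
          then show "y \<sqsubseteq> scomp k i j (joinsec i j E) c h"
            by (rule comp_intro[OF J c h f B.le_trans[OF y cf] hat_intro[OF J f h g _ 2]])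
        qed
      qed
      then show ?thesis using e' by simp
    qed
    have im: "(\<lambda>e. e h) ` ?E \<subseteq> opens k" using sE sec_idem h by blast
    note z = B.osup_idem[OF im omap_Obj[OF k]]
    show "scomp k i j (joinsec i j E) c h \<sqsubseteq> osup B (omap F k) ((\<lambda>e. e h) ` ?E)"
    proof (rule comp_elim[OF J c h B.le_refl[OF idem_hom[OF sec_idem[OF Jc h]]] z])
      fix v f assume f: "f \<in> hom A k i" and cf: "v \<sqsubseteq> c f" and vf: "v \<sqsubseteq> hat k i j (joinsec i j E) f h"
      show "v \<sqsubseteq> osup B (omap F k) ((\<lambda>e. e h) ` ?E)"
      proof (rule hat_elim[OF J f h vf z])
        fix y g assume y: "y \<sqsubseteq> v" and g: "g \<in> hom A i j" and 1: "y \<sqsubseteq> pb f (joinsec i j E g)"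
          and 2: "y \<sqsubseteq> ag (g \<cdot> f) h"
        show "y \<sqsubseteq> osup B (omap F k) ((\<lambda>e. e h) ` ?E)"
        \<comment> \<open>Inverse images preserve joins, so a witness \<open>g\<close> for the join
          is locally a witness for a single member of \<open>E\<close>.\<close>
        proof (rule pb_joinsec_elim[OF i E f g 1 z])
          fix x e assume x: "x \<sqsubseteq> y" and e: "e \<in> E" and xe: "x \<sqsubseteq> pb f (e g)"
          have es: "e \<in> sections i j" using e E by blast
          have "x \<sqsubseteq> scomp k i j e c h"
            by (rule comp_intro[OF es c h f B.le_trans[OF x B.le_trans[OF y cf]]
                  hat_intro[OF es f h g xe B.le_trans[OF x 2]]])
          moreover have "scomp k i j e c h \<sqsubseteq> osup B (omap F k) ((\<lambda>e. e h) ` ?E)"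
            using e by (intro B.osup_upper[OF _ im omap_Obj[OF k]]) blast
          ultimately show "x \<sqsubseteq> osup B (omap F k) ((\<lambda>e. e h) ` ?E)" by (rule B.le_trans)
        qed
      qed
    qed
  qed
  moreover have "(\<lambda>e. (k, e, j)) ` ?E = (\<lambda>f. f \<odot>\<^bsub>fact_cat\<^esub> x) ` S"
    by (simp add: S x' image_image)
  ultimately show "is_join fact_cat k j ((\<lambda>f. f \<odot>\<^bsub>fact_cat\<^esub> x) ` S) (s \<odot>\<^bsub>fact_cat\<^esub> x)"
    by (simp add: s' x')
qed

section \<open>The localic factor\<close>

definition left_ftor :: "('o, 'm, 'o, 'o \<times> ('m \<Rightarrow> 'n) \<times> 'o) ftor" where
  "left_ftor = \<lparr>omap = restrict id (Obj A),
     amap = restrict (\<lambda>x. (Dom A x, yon (Dom A x) (Cod A x) x, Cod A x)) (Arr A)\<rparr>"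

lemma left_omap: "i \<in> Obj A \<Longrightarrow> omap left_ftor i = i"
  by (simp add: left_ftor_def)

lemma left_amap: "x \<in> hom A i j \<Longrightarrow> amap left_ftor x = (i, yon i j x, j)"
  by (auto simp: left_ftor_def hom_def)

lemma extent_yon:
  assumes x: "x \<in> hom A i j"
  shows "extent i j (yon i j x) = amap F (Rst A x)"
proof (rule B.le_antisym)
  note i = A.hom_Obj(1)[OF x] and y = yon_sections[OF x]
  have e: "amap F (Rst A x) = ag x x" using ag_refl[OF x] amap_Rst[OF x] by simp
  note z = ag_idem[OF x x]
  show "extent i j (yon i j x) \<sqsubseteq> amap F (Rst A x)"
    unfolding e
    by (rule extent_elim[OF y B.le_refl[OF idem_hom[OF extent_idem[OF i y]]] z])
      (use yon_apply ag_dom(1)[OF x] in auto)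
  show "amap F (Rst A x) \<sqsubseteq> extent i j (yon i j x)"
    unfolding e using extent_upper[OF y x] yon_apply[OF x] by simp
qed

text \<open>\<open>Rst A x\<close> lies below the identity and agrees with it on its domain, so
  [Rst x = h] is the part of [Ide = h] inside that domain.\<close>

lemma yon_Rst:
  assumes x: "x \<in> hom A i j"
  shows "yon i i (Rst A x) = idf i (amap F (Rst A x))"
proof -
  note i = A.hom_Obj(1)[OF x] and u = amap_idem[OF A.Rst_idem[OF x]] and r = A.Rst_closed[OF x]
  note I = A.Ide_closed[OF i] and le = A.idem_le_Ide[OF A.Rst_idem[OF x]]
  have rr: "ag (Rst A x) (Rst A x) = amap F (Rst A x)"
    using ag_refl[OF r] idem_Rst[OF u] amap_Rst[OF r] idem_Rst[OF A.Rst_idem[OF x]] by simp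
  show ?thesis
  proof (rule sec_eqI[OF yon_sections[OF r] idf_sections[OF i u]])
    fix h w assume h: "h \<in> hom A i i"
    show "w \<sqsubseteq> idf i (amap F (Rst A x)) h" if "w \<sqsubseteq> yon i i (Rst A x) h"
    proof -
      have w: "w \<sqsubseteq> ag (Rst A x) h" using that yon_apply[OF h] by simp
      note d = ag_dom(1)[OF r h w]
      show ?thesis
        using ag_trans[OF I r h ag_sym[OF r I ag_le[OF le I d]] w] d rr le_idf[OF i u h] by simp
    qed
    show "w \<sqsubseteq> yon i i (Rst A x) h" if "w \<sqsubseteq> idf i (amap F (Rst A x)) h"
    proof -
      have "w \<sqsubseteq> ag (Rst A x) (Rst A x)" "w \<sqsubseteq> ag (Ide A i) h"
        using that le_idf[OF i u h] rr by auto
      then show ?thesis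
        using ag_trans[OF r I h ag_le[OF le I]] yon_apply[OF h] by simp
    qed
  qed
qed

text \<open>The region [s = h] lies in the domain of \<open>s\<close>, and as \<open>F\<close>
  preserves joins of opens this is covered by the domains of the members of \<open>S\<close>. On the
  domain of a member \<open>f\<close> the join \<open>s\<close> agrees with \<open>f\<close>, so
  \<open>f\<close> agrees with \<open>h\<close> there.\<close>

lemma yon_join:
  assumes s: "is_join A i j S s"
  shows "is_join fact_cat i j ((\<lambda>f. (i, yon i j f, j)) ` S) (i, yon i j s, j)"
proof -
  have sh: "s \<in> hom A i j" and S: "S \<subseteq> hom A i j" and up: "\<And>f. f \<in> S \<Longrightarrow> le A f s"
    using s by (auto simp: is_join_def)
  note i = A.hom_Obj(1)[OF sh] and j = A.hom_Obj(2)[OF sh]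
  have yS: "yon i j ` S \<subseteq> sections i j" using S yon_sections by blast
  have "is_join fact_cat i j ((\<lambda>e. (i, e, j)) ` yon i j ` S) (i, yon i j s, j)"
  proof (rule fact_joinI[OF i j yS yon_sections[OF sh]])
    fix h assume h: "h \<in> hom A i j"
    show "e h \<sqsubseteq> yon i j s h" if eS: "e \<in> yon i j ` S" for e
    proof -
      obtain f where f: "f \<in> S" and e: "e = yon i j f" using eS by blast
      have fh: "f \<in> hom A i j" using f S by blast
      note w = B.le_refl[OF idem_hom[OF ag_idem[OF fh h]]]
      have "ag f h \<sqsubseteq> ag s h"
        by (rule ag_trans[OF sh fh h ag_sym[OF fh sh ag_le[OF up[OF f] sh ag_dom(1)[OF fh h w]]] w])
      then show ?thesis using e yon_apply[OF h] by simp
    qed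
    let ?U = "(\<lambda>e. e h) ` yon i j ` S"
    have U: "?U \<subseteq> opens i" using yS sec_idem h by blast
    note z = B.osup_idem[OF U omap_Obj[OF i]]
    note w = B.le_refl[OF idem_hom[OF ag_idem[OF sh h]]]
    have RS: "Rst A ` S \<subseteq> rest_idem A i" using S A.Rst_idem by blast
    have "ag s h \<sqsubseteq> osup B (omap F i) (amap F ` Rst A ` S)"
      using ag_dom(1)[OF sh h w] ag_refl[OF sh] amap_Rst[OF sh] A.Rst_join[OF s] amap_osup[OF RS i]
      by simp
    then have "ag s h \<sqsubseteq> osup B (omap F i) ?U"
    proof (rule B.osup_elim[OF _ _ z])
      show "amap F ` Rst A ` S \<subseteq> opens i" using RS amap_idem by blast
      fix v u assume v: "v \<sqsubseteq> ag s h" and "u \<in> amap F ` Rst A ` S" and vu: "v \<sqsubseteq> u"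
      then obtain f where f: "f \<in> S" and u: "u = amap F (Rst A f)" by blast
      have fh: "f \<in> hom A i j" using f S by blast
      have "v \<sqsubseteq> ag f f" using vu u ag_refl[OF fh] amap_Rst[OF fh] by simp
      then have "v \<sqsubseteq> yon i j f h"
        using ag_trans[OF fh sh h ag_le[OF up[OF f] sh] v] yon_apply[OF h] by simp
      moreover have "yon i j f h \<sqsubseteq> osup B (omap F i) ?U"
        using f by (intro B.osup_upper[OF _ U omap_Obj[OF i]]) blast
      ultimately show "v \<sqsubseteq> osup B (omap F i) ?U" by (rule B.le_trans)
    qed
    then show "yon i j s h \<sqsubseteq> osup B (omap F i) ?U" using yon_apply[OF h] by simp
  qed
  then show ?thesis by (simp add: image_image)
qed

lemma left_jr: "jr_functor A fact_cat left_ftor"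
proof (rule jr_functorI[OF A.join_restriction_category_axioms T.join_restriction_category_axioms])
  show "omap left_ftor \<in> Obj A \<rightarrow>\<^sub>E Obj fact_cat" by (auto simp: left_ftor_def)
  show "amap left_ftor \<in> extensional (Arr A)" by (simp add: left_ftor_def)
  show "amap left_ftor f \<in> hom fact_cat (omap left_ftor i) (omap left_ftor j)"
    if f: "f \<in> hom A i j" for f i j
    using A.hom_Obj[OF f] yon_sections[OF f] by (simp add: left_amap[OF f] left_omap fact_hom)
  show "amap left_ftor (Ide A i) = Ide fact_cat (omap left_ftor i)" if i: "i \<in> Obj A" for i
    by (simp add: left_amap[OF A.Ide_closed[OF i]] left_omap[OF i])
  show "amap left_ftor (g \<cdot> f) = amap left_ftor g \<odot>\<^bsub>fact_cat\<^esub> amap left_ftor f"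
    if f: "f \<in> hom A i j" and g: "g \<in> hom A j k" for f g i j k
    by (simp add: left_amap[OF f] left_amap[OF g] left_amap[OF A.Comp_closed[OF f g]]
        comp_yon_yon[OF f g])
  show r: "amap left_ftor (Rst A f) = Rst fact_cat (amap left_ftor f)" if f: "f \<in> hom A i j" for f i j
    by (simp add: left_amap[OF f] left_amap[OF A.Rst_closed[OF f]] yon_Rst[OF f] extent_yon[OF f])
  fix i j S s assume s: "is_join A i j S s"
  then have sh: "s \<in> hom A i j" and S: "S \<subseteq> hom A i j" by (auto simp: is_join_def)
  note i = A.hom_Obj(1)[OF sh]
  have "Rst fact_cat (amap left_ftor s) =
      osup fact_cat i (Rst fact_cat ` (\<lambda>f. (i, yon i j f, j)) ` S)"
    unfolding left_amap[OF sh] by (rule T.Rst_join[OF yon_join[OF s]])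
  also have "Rst fact_cat ` (\<lambda>f. (i, yon i j f, j)) ` S = (\<lambda>f. amap left_ftor (Rst A f)) ` S"
    unfolding image_image
  proof (rule image_cong[OF refl])
    fix f assume "f \<in> S"
    then have f: "f \<in> hom A i j" using S by blast
    show "Rst fact_cat (i, yon i j f, j) = amap left_ftor (Rst A f)"
      using r[OF f] left_amap[OF f] by simp
  qed
  finally have "amap left_ftor (Rst A s) =
      osup fact_cat (omap left_ftor i) ((\<lambda>f. amap left_ftor (Rst A f)) ` S)"
    using r[OF sh] left_omap[OF i] by simp
  moreover have "amap left_ftor (Rst A s) \<in> hom fact_cat i i"
    using left_amap[OF A.Rst_closed[OF sh]] yon_sections[OF A.Rst_closed[OF sh]] i
    by (simp add: fact_hom)
  ultimately show "le fact_cat (amap left_ftor (Rst A s))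
      (osup fact_cat (omap left_ftor i) ((\<lambda>f. amap left_ftor (Rst A f)) ` S))"
    using T.le_refl by metis
qed

lemma ag_meet:
  assumes f: "f \<in> hom A i j" and g: "g \<in> hom A i j" and h: "h \<in> hom A i j"
    and w: "w \<sqsubseteq> ag f h" "w \<sqsubseteq> ag g h"
  shows "w \<sqsubseteq> ag (meet A f g) h"
proof -
  have "le A v (eqz A (meet A f g) h)" if "le A v (eqz A f h)" "le A v (eqz A g h)" for v
    using that A.le_eqz_meet_iff[OF f g h] by blast
  then show ?thesis
    using w unfolding ag_def
    by (rule ag_transfer[OF A.eqz_idem[OF f h] A.eqz_idem[OF g h]
          A.eqz_idem[OF A.meet_hom[OF f g] h]])
qed

lemma left_localic: "localic A fact_cat left_ftor"
  unfolding localic_def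
proof (intro conjI ballI left_jr)
  interpret L: jr_map A fact_cat left_ftor by (rule jr_mapI[OF left_jr])
  show "bij_betw (omap left_ftor) (Obj A) (Obj fact_cat)"
    using left_omap by (auto simp: bij_betw_def inj_on_def image_iff)
  fix i j assume i: "i \<in> Obj A" and j: "j \<in> Obj A"
  show "meet fact_cat (amap left_ftor f) (amap left_ftor g) = amap left_ftor (meet A f g)"
    if f: "f \<in> hom A i j" and g: "g \<in> hom A i j" for f g
  proof (rule T.meet_eqI, unfold is_meet_def, intro conjI allI impI)
    note m = A.meet_hom[OF f g]
    show "le fact_cat (amap left_ftor (meet A f g)) (amap left_ftor f)"
      "le fact_cat (amap left_ftor (meet A f g)) (amap left_ftor g)"
      using L.amap_le A.meet_le[OF f g] by auto
    fix x assume x: "le fact_cat x (amap left_ftor f) \<and> le fact_cat x (amap left_ftor g)"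
    then have "x \<in> hom fact_cat i j"
      using le_hom[of fact_cat x "amap left_ftor f"] L.amap_hom[OF f] left_omap i j by simp
    then obtain e where x': "x = (i, e, j)" and e: "e \<in> sections i j" by (elim fact_homE) blast
    \<comment> \<open>The order is pointwise, so the meet is tested at each \<open>h\<close>, where
      \<open>ag_meet\<close> applies.\<close>
    have "e h \<sqsubseteq> yon i j (meet A f g) h" if h: "h \<in> hom A i j" for h
    proof -
      have "e h \<sqsubseteq> ag f h" "e h \<sqsubseteq> ag g h"
        using x x' left_amap[OF f] left_amap[OF g] fact_le[OF i j e yon_sections[OF f]]
          fact_le[OF i j e yon_sections[OF g]] h yon_apply[OF h] by auto
      then show ?thesis using ag_meet[OF f g h] yon_apply[OF h] by simp
    qed
    then show "le fact_cat x (amap left_ftor (meet A f g))"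
      using x' left_amap[OF m] fact_le[OF i j e yon_sections[OF m]] by simp
  qed
  fix x assume "x \<in> hom fact_cat (omap left_ftor i) (omap left_ftor j)"
  then have x: "x \<in> hom fact_cat i j" using left_omap i j by simp
  then obtain e where x': "x = (i, e, j)" and e: "e \<in> sections i j" by (elim fact_homE) blast
  have Lh: "amap left_ftor f \<in> hom fact_cat i j" if "f \<in> hom A i j" for f
    using L.amap_hom[OF that] left_omap i j by simp
  have "is_join fact_cat i j ((\<lambda>f. meet fact_cat x (amap left_ftor f)) ` hom A i j) x"
    unfolding is_join_def
  proof (intro conjI ballI impI x)
    show "(\<lambda>f. meet fact_cat x (amap left_ftor f)) ` hom A i j \<subseteq> hom fact_cat i j"
      using T.meet_hom[OF x Lh] by blast
    show "le fact_cat y x" if "y \<in> (\<lambda>f. meet fact_cat x (amap left_ftor f)) ` hom A i j" for y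
      using that T.meet_le(1)[OF x Lh] by blast
    fix t assume t: "t \<in> hom fact_cat i j"
      and ub: "\<forall>y\<in>(\<lambda>f. meet fact_cat x (amap left_ftor f)) ` hom A i j. le fact_cat y t"
    obtain d where t': "t = (i, d, j)" and d: "d \<in> sections i j" by (rule fact_homE[OF t])
    have "e h \<sqsubseteq> d h" if h: "h \<in> hom A i j" for h
    proof -
      note y = yon_sections[OF h] and u = sec_idem[OF e h]
      \<comment> \<open>The image of \<open>h\<close> restricted to the open \<open>e h\<close>. It
        lies below both \<open>x\<close> and the image of \<open>h\<close>, hence below their meet
        and so below \<open>t\<close>, while its component at \<open>h\<close> is all of
        \<open>e h\<close>.\<close>
      let ?c = "scomp i i j (yon i j h) (idf i (e h))"
      have c: "?c \<in> sections i j" by (rule comp_sections[OF y idf_sections[OF i u]])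
      have ch: "w \<sqsubseteq> ?c f \<longleftrightarrow> w \<sqsubseteq> e h \<and> w \<sqsubseteq> ag h f" if f: "f \<in> hom A i j" for f w
        using comp_idf_right[OF i u y f] yon_apply[OF f] by simp
      have cr: "?c f \<sqsubseteq> ?c f" if "f \<in> hom A i j" for f
        by (rule B.le_refl[OF idem_hom[OF sec_idem[OF c that]]])
      have "?c f \<sqsubseteq> e f" "?c f \<sqsubseteq> yon i j h f" if f: "f \<in> hom A i j" for f
        using cr[OF f] ch[OF f] sec_move[OF e h f] yon_apply[OF f] by auto
      then have "le fact_cat (i, ?c, j) x" "le fact_cat (i, ?c, j) (amap left_ftor h)"
        using fact_le[OF i j c e] fact_le[OF i j c y] x' left_amap[OF h] by auto
      from T.le_trans[OF T.meet_greatest[OF this]] have "le fact_cat (i, ?c, j) t"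
        using ub h by blast
      then have "?c h \<sqsubseteq> d h" using fact_le[OF i j c d] t' h by simp
      moreover have "e h \<sqsubseteq> ?c h"
        using ch[OF h] B.le_refl[OF idem_hom[OF u]] sec_agree[OF e h h] by blast
      ultimately show ?thesis using B.le_trans by blast
    qed
    then show "le fact_cat x t" using fact_le[OF i j e d] x' t' by simp
  qed
  then show "is_join fact_cat (omap left_ftor i) (omap left_ftor j)
      ((\<lambda>f. meet fact_cat x (amap left_ftor f)) ` hom A i j) x"
    using left_omap i j by simp
qed

section \<open>The hyperconnected factor\<close>

text \<open>The arrow of \<open>B\<close> that is \<open>F f\<close> on each \<open>e f\<close>. The
  pieces match because the overlap of \<open>e f\<close> and \<open>e g\<close> lies in
  \<open>ag f g\<close>, on which \<open>F f\<close> and \<open>F g\<close> coincide. Different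
  sections may glue to the same arrow.\<close>

definition glue where
  "glue i j e = (SOME s. is_join B (omap F i) (omap F j) ((\<lambda>f. amap F f \<sqinter> e f) ` hom A i j) s)"

context
  fixes i j e
  assumes i: "i \<in> Obj A" and j: "j \<in> Obj A" and e: "e \<in> sections i j"
begin

lemma sec_le_Rst:
  assumes f: "f \<in> hom A i j"
  shows "e f \<sqsubseteq> Rst B (amap F f)"
  using sec_agree[OF e f f] B.le_refl[OF idem_hom[OF sec_idem[OF e f]]] ag_refl[OF f] by metis

lemma glue_join: "is_join B (omap F i) (omap F j) ((\<lambda>f. amap F f \<sqinter> e f) ` hom A i j) (glue i j e)"
  unfolding glue_def
proof (rule someI_ex, rule B.glue_exists[OF omap_Obj[OF i] omap_Obj[OF j] amap_hom sec_le_Rst])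
  fix f g assume f: "f \<in> hom A i j" and g: "g \<in> hom A i j"
  note ef = sec_idem[OF e f] and eg = sec_idem[OF e g]
  have "e f \<sqinter> e g \<sqsubseteq> ag f g"
    using sec_agree[OF e f g] B.le_idem_comp_iff[OF ef eg]
      B.le_refl[OF idem_hom[OF B.idem_comp[OF ef eg]]] by blast
  then show "amap F f \<sqinter> (e f \<sqinter> e g) = amap F g \<sqinter> (e f \<sqinter> e g)"
    unfolding ag_def by (rule amap_agree[OF f g])
qed

lemma glue_hom: "glue i j e \<in> hom B (omap F i) (omap F j)"
  by (rule B.glue_props(1)[OF glue_join amap_hom sec_le_Rst])

lemma glue_Rst: "Rst B (glue i j e) = extent i j e"
  unfolding extent_def by (rule B.glue_props(2)[OF glue_join amap_hom sec_le_Rst])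

lemma glue_agree:
  assumes f: "f \<in> hom A i j"
  shows "e f \<sqsubseteq> eqz B (glue i j e) (amap F f)"
  using B.glue_props(3)[OF glue_join amap_hom sec_le_Rst f] glue_Rst extent_upper[OF e f]
  by (intro B.le_eqzI[OF glue_hom amap_hom[OF f]]) simp_all

lemma glue_unique:
  assumes t: "t \<in> hom B (omap F i) (omap F j)"
    and eq: "\<And>f. f \<in> hom A i j \<Longrightarrow> t \<sqinter> e f = amap F f \<sqinter> e f"
    and cover: "Rst B t \<sqsubseteq> extent i j e"
  shows "glue i j e = t"
  using B.glue_unique[OF glue_join t amap_hom sec_le_Rst eq] cover by (simp add: extent_def)

end

lemma glue_yon:
  assumes x: "x \<in> hom A i j"
  shows "glue i j (yon i j x) = amap F x"
proof (rule glue_unique[OF A.hom_Obj[OF x] yon_sections[OF x] amap_hom[OF x]])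
  show "amap F x \<sqinter> yon i j x f = amap F f \<sqinter> yon i j x f" if f: "f \<in> hom A i j" for f
    unfolding yon_apply[OF f]
    by (rule amap_agree[OF x f], fold ag_def, rule B.le_refl[OF idem_hom[OF ag_idem[OF x f]]])
  show "Rst B (amap F x) \<sqsubseteq> extent i j (yon i j x)"
    using extent_yon[OF x] amap_Rst[OF x] B.le_refl[OF B.Rst_closed[OF amap_hom[OF x]]] by simp
qed

lemma glue_idf:
  assumes i: "i \<in> Obj A" and u: "u \<in> opens i"
  shows "glue i i (idf i u) = u"
proof (rule glue_unique[OF i i idf_sections[OF i u] idem_hom[OF u]])
  note I = A.Ide_closed[OF i] and s = idf_sections[OF i u]
  show "u \<sqinter> idf i u f = amap F f \<sqinter> idf i u f" if f: "f \<in> hom A i i" for f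
  proof -
    note z = sec_idem[OF s f]
    have 1: "idf i u f \<sqsubseteq> u" "idf i u f \<sqsubseteq> ag (Ide A i) f"
      using le_idf[OF i u f] B.le_refl[OF idem_hom[OF z]] by auto
    have "amap F f \<sqinter> idf i u f = idf i u f"
      using amap_agree[OF I f] 1(2) amap_Ide[OF i] B.Comp_Ide_left[OF idem_hom[OF z]]
      by (simp add: ag_def)
    then show ?thesis using 1(1) B.idem_le_iff[OF z u] by simp
  qed
  show "Rst B u \<sqsubseteq> extent i i (idf i u)"
    using extent_idf[OF i u] idem_Rst[OF u] B.le_refl[OF idem_hom[OF u]] by simp
qed

text \<open>By \<open>glue_unique\<close> the composite of the gluings is compared with
  \<open>F h\<close> on the component at \<open>h\<close>. Locally \<open>e\<close> is represented
  by \<open>f\<close> and, along \<open>f\<close>, \<open>d\<close> by \<open>g\<close>; there the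
  composite is \<open>F (g f)\<close>, which coincides with \<open>F h\<close> on the image of
  [g f = h].\<close>

lemma glue_comp:
  assumes i: "i \<in> Obj A" and j: "j \<in> Obj A" and k: "k \<in> Obj A"
    and d: "d \<in> sections j k" and e: "e \<in> sections i j"
  shows "glue i k (scomp i j k d e) = glue j k d \<sqinter> glue i j e"
proof (rule glue_unique[OF i k comp_sections[OF d e]])
  note ge = glue_hom[OF i j e] and gd = glue_hom[OF j k d]
  note t = B.Comp_closed[OF ge gd] and de = comp_sections[OF d e]
  show "glue j k d \<sqinter> glue i j e \<in> hom B (omap F i) (omap F k)" by (rule t)
  \<comment> \<open>\<open>glue i j e\<close> coincides with \<open>F f\<close> on
    \<open>e f\<close>, so inverse images along the two maps agree inside
    \<open>e f\<close>.\<close>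
  have pull: "v \<sqsubseteq> pb f u \<longleftrightarrow> v \<sqsubseteq> pull B (glue i j e) u"
    if f: "f \<in> hom A i j" and v: "v \<sqsubseteq> e f" and u: "u \<in> opens j" for f v u
  proof -
    have "glue i j e \<sqinter> v = amap F f \<sqinter> v"
      using B.le_trans[OF v glue_agree[OF i j e f]] B.le_eqz_iff[OF ge amap_hom[OF f]] by blast
    then show ?thesis
      unfolding pb_def using B.le_pull_cong[OF ge amap_hom[OF f] u] B.le_pull_cong[OF amap_hom[OF f] ge u]
      by metis
  qed
  show "(glue j k d \<sqinter> glue i j e) \<sqinter> scomp i j k d e h = amap F h \<sqinter> scomp i j k d e h"
    if h: "h \<in> hom A i k" for h
  proof -
    note z = B.eqz_idem[OF t amap_hom[OF h]]
    have "scomp i j k d e h \<sqsubseteq> eqz B (glue j k d \<sqinter> glue i j e) (amap F h)"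
    proof (rule comp_elim[OF d e h B.le_refl[OF idem_hom[OF sec_idem[OF de h]]] z])
      fix v f assume f: "f \<in> hom A i j" and ef: "v \<sqsubseteq> e f" and vf: "v \<sqsubseteq> hat i j k d f h"
      show "v \<sqsubseteq> eqz B (glue j k d \<sqinter> glue i j e) (amap F h)"
      proof (rule hat_elim[OF d f h vf z])
        fix x g assume x: "x \<sqsubseteq> v" and g: "g \<in> hom A j k" and 1: "x \<sqsubseteq> pb f (d g)"
          and 2: "x \<sqsubseteq> ag (g \<cdot> f) h"
        have xe: "x \<sqsubseteq> e f" by (rule B.le_trans[OF x ef])
        have "x \<sqsubseteq> pull B (glue i j e) (d g)" using 1 pull[OF f xe sec_idem[OF d g]] by simp
        from B.le_trans[OF this B.pull_mono[OF glue_agree[OF j k d g] B.eqz_idem[OF gd amap_hom[OF g]] ge]]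
        have 3: "x \<sqsubseteq> eqz B (glue j k d \<sqinter> glue i j e) (amap F (g \<cdot> f))"
          using B.eqz_comp_le[OF ge amap_hom[OF f] gd amap_hom[OF g] B.le_trans[OF xe glue_agree[OF i j e f]]]
            amap_comp[OF f g] by simp
        have gf: "g \<cdot> f \<in> hom A i k" by (rule A.Comp_closed[OF f g])
        have 4: "x \<sqsubseteq> eqz B (amap F (g \<cdot> f)) (amap F h)"
          using B.le_trans[OF 2] amap_eqz_le[OF gf h] by (simp add: ag_def)
        show "x \<sqsubseteq> eqz B (glue j k d \<sqinter> glue i j e) (amap F h)"
          by (rule B.eqz_trans[OF t amap_hom[OF gf] amap_hom[OF h] 3 4])
      qed
    qed
    then show ?thesis using B.le_eqz_iff[OF t amap_hom[OF h]] by blast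
  qed
  note ed = extent_idem[OF j d]
  let ?r = "Rst B (glue j k d \<sqinter> glue i j e)"
  \<comment> \<open>The domain of the composite is the inverse image of the extent of
    \<open>d\<close>. It is covered by the opens \<open>e f\<close>, over which it becomes an
    inverse image along \<open>F f\<close>.\<close>
  have r: "?r = pull B (glue i j e) (extent j k d)"
    using B.pull_Rst[OF ge gd] glue_Rst[OF j k d] by simp
  have "?r \<sqsubseteq> extent i j e" using B.Rst_comp_le[OF ge gd] glue_Rst[OF i j e] by simp
  then show "?r \<sqsubseteq> extent i k (scomp i j k d e)"
  proof (rule extent_elim[OF e _ extent_idem[OF i de]])
    fix v f assume v: "v \<sqsubseteq> ?r" and f: "f \<in> hom A i j" and ef: "v \<sqsubseteq> e f"
    have "v \<sqsubseteq> pb f (extent j k d)" using v r pull[OF f ef ed] by simp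
    then show "v \<sqsubseteq> extent i k (scomp i j k d e)" by (rule extent_comp_intro[OF d e f ef])
  qed
qed

definition right_ftor :: "('o, 'o \<times> ('m \<Rightarrow> 'n) \<times> 'o, 'p, 'n) ftor" where
  "right_ftor = \<lparr>omap = restrict (omap F) (Obj A),
     amap = restrict (\<lambda>(i, e, j). glue i j e) (Arr fact_cat)\<rparr>"

lemma right_omap: "i \<in> Obj A \<Longrightarrow> omap right_ftor i = omap F i"
  by (simp add: right_ftor_def)

lemma right_amap:
  "i \<in> Obj A \<Longrightarrow> j \<in> Obj A \<Longrightarrow> e \<in> sections i j \<Longrightarrow> amap right_ftor (i, e, j) = glue i j e"
  by (simp add: right_ftor_def fact_cat_def)

lemma right_amap_Rst:
  "i \<in> Obj A \<Longrightarrow> j \<in> Obj A \<Longrightarrow> e \<in> sections i j \<Longrightarrow>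
    amap right_ftor (Rst fact_cat (i, e, j)) = extent i j e"
  by (simp add: right_amap idf_sections extent_idem glue_idf)

lemma right_jr: "jr_functor fact_cat B right_ftor"
proof (rule jr_functorI[OF T.join_restriction_category_axioms B.join_restriction_category_axioms])
  show "omap right_ftor \<in> Obj fact_cat \<rightarrow>\<^sub>E Obj B" using omap_Obj by (auto simp: right_ftor_def)
  show "amap right_ftor \<in> extensional (Arr fact_cat)" by (simp add: right_ftor_def)
  show "amap right_ftor x \<in> hom B (omap right_ftor i) (omap right_ftor j)"
    if "x \<in> hom fact_cat i j" for x i j
    using that by (elim fact_homE) (simp add: right_amap right_omap glue_hom)
  show "amap right_ftor (Ide fact_cat i) = Ide B (omap right_ftor i)" if "i \<in> Obj fact_cat" for i
    using that glue_yon[OF A.Ide_closed] yon_sections[OF A.Ide_closed] amap_Ide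
    by (simp add: right_amap right_omap)
  show "amap right_ftor (y \<odot>\<^bsub>fact_cat\<^esub> x) = amap right_ftor y \<sqinter> amap right_ftor x"
    if "x \<in> hom fact_cat i j" "y \<in> hom fact_cat j k" for x y i j k
    using that by (elim fact_homE) (simp add: right_amap comp_sections glue_comp)
  show "amap right_ftor (Rst fact_cat x) = Rst B (amap right_ftor x)" if "x \<in> hom fact_cat i j" for x i j
    using that
  proof (rule fact_homE)
    fix e assume x: "x = (i, e, j)" and ij: "i \<in> Obj A" "j \<in> Obj A" "e \<in> sections i j"
    show "amap right_ftor (Rst fact_cat x) = Rst B (amap right_ftor x)"
      using right_amap_Rst[OF ij] right_amap[OF ij] glue_Rst[OF ij] x by simp
  qed
  fix i j S s assume s: "is_join fact_cat i j S s"
  obtain E where i: "i \<in> Obj A" and j: "j \<in> Obj A" and E: "E \<subseteq> sections i j"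
    and S: "S = (\<lambda>e. (i, e, j)) ` E" and J: "joinsec i j E \<in> sections i j"
    and s': "s = (i, joinsec i j E, j)"
    by (rule fact_joinE[OF T.is_join_family[OF s] s])
  have eE: "extent i j ` E \<subseteq> opens i" using E extent_idem[OF i] by blast
  have e: "(\<lambda>f. amap right_ftor (Rst fact_cat f)) ` S = extent i j ` E"
    unfolding S image_image using right_amap_Rst[OF i j] E by (intro image_cong) auto
  have "extent i j (joinsec i j E) \<sqsubseteq> osup B (omap F i) (extent i j ` E)"
  proof (rule extent_elim[OF J B.le_refl[OF idem_hom[OF extent_idem[OF i J]]] B.osup_idem[OF eE omap_Obj[OF i]]])
    fix v f assume f: "f \<in> hom A i j" and vf: "v \<sqsubseteq> joinsec i j E f"
    show "v \<sqsubseteq> osup B (omap F i) (extent i j ` E)"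
    proof (rule joinsec_elim[OF i E f vf B.osup_idem[OF eE omap_Obj[OF i]]])
      fix w e assume e: "e \<in> E" and we: "w \<sqsubseteq> e f"
      have es: "e \<in> sections i j" using e E by blast
      have "extent i j e \<sqsubseteq> osup B (omap F i) (extent i j ` E)"
        using e by (intro B.osup_upper[OF _ eE omap_Obj[OF i]]) blast
      with extent_intro[OF es f we] show "w \<sqsubseteq> osup B (omap F i) (extent i j ` E)"
        by (rule B.le_trans)
    qed
  qed
  then show "amap right_ftor (Rst fact_cat s) \<sqsubseteq>
      osup B (omap right_ftor i) ((\<lambda>f. amap right_ftor (Rst fact_cat f)) ` S)"
    using e right_amap_Rst[OF i j J] s' right_omap[OF i] by simp
qed

text \<open>An idempotent equals its own restriction, which is \<open>idf\<close> of its extent;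
  conversely \<open>idf i u\<close> has extent \<open>u\<close>. The opens of \<open>i\<close> in
  the intermediate category are thus the opens of \<open>F i\<close> in \<open>B\<close>.\<close>

lemma fact_idem_iff:
  assumes i: "i \<in> Obj A"
  shows "rest_idem fact_cat i = (\<lambda>u. (i, idf i u, i)) ` opens i"
proof
  show "rest_idem fact_cat i \<subseteq> (\<lambda>u. (i, idf i u, i)) ` opens i"
  proof
    fix x assume x: "x \<in> rest_idem fact_cat i"
    obtain e where x': "x = (i, e, i)" and e: "e \<in> sections i i"
      using fact_homE[OF idem_hom[OF x]] by blast
    have "e = idf i (extent i i e)" using idem_Rst[OF x] x' by simp
    then show "x \<in> (\<lambda>u. (i, idf i u, i)) ` opens i" using extent_idem[OF i e] x' by blast
  qed
  show "(\<lambda>u. (i, idf i u, i)) ` opens i \<subseteq> rest_idem fact_cat i"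
    using i idf_sections[OF i] extent_idf[OF i] by (auto simp: rest_idem_def fact_hom)
qed

lemma right_hyperconnected: "hyperconnected fact_cat B right_ftor"
  unfolding hyperconnected_def
proof (intro conjI ballI right_jr)
  interpret H: jr_map fact_cat B right_ftor by (rule jr_mapI[OF right_jr])
  fix i assume "i \<in> Obj fact_cat"
  then have i: "i \<in> Obj A" by simp
  have H: "amap right_ftor (i, idf i u, i) = u" if "u \<in> opens i" for u
    using right_amap[OF i i idf_sections[OF i that]] glue_idf[OF i that] by simp
  show "bij_betw (amap right_ftor) (rest_idem fact_cat i) (rest_idem B (omap right_ftor i))"
    unfolding right_omap[OF i] fact_idem_iff[OF i]
    by (rule bij_betw_byWitness[where f' = "\<lambda>u. (i, idf i u, i)"]) (auto simp: H)
  fix x y assume "x \<in> rest_idem fact_cat i" "y \<in> rest_idem fact_cat i"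
  then obtain u v where u: "u \<in> opens i" "x = (i, idf i u, i)" and v: "v \<in> opens i" "y = (i, idf i v, i)"
    unfolding fact_idem_iff[OF i] by blast
  show "le fact_cat x y \<longleftrightarrow> amap right_ftor x \<sqsubseteq> amap right_ftor y"
  proof
    assume "amap right_ftor x \<sqsubseteq> amap right_ftor y"
    then have uv: "u \<sqsubseteq> v" using H u v by simp
    have "idf i u h \<sqsubseteq> idf i v h" if h: "h \<in> hom A i i" for h
      using le_idf[OF i u(1) h] le_idf[OF i v(1) h] B.le_trans[OF _ uv]
        B.le_refl[OF idem_hom[OF sec_idem[OF idf_sections[OF i u(1)] h]]] by blast
    then show "le fact_cat x y"
      using fact_le[OF i i idf_sections[OF i u(1)] idf_sections[OF i v(1)]] u v by simp
  qed (rule H.amap_le)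
qed

lemma factorisation: "comp_ftor A right_ftor left_ftor = F"
proof (rule ftor.equality)
  show "omap (comp_ftor A right_ftor left_ftor) = omap F"
  proof (rule extensionalityI[of _ "Obj A"])
    show "omap F \<in> extensional (Obj A)" by (rule omap_extensional)
  qed (auto simp: comp_ftor_def left_omap right_omap)
  show "amap (comp_ftor A right_ftor left_ftor) = amap F"
  proof (rule extensionalityI[of _ "Arr A"])
    show "amap F \<in> extensional (Arr A)" by (rule amap_extensional)
    fix f assume f: "f \<in> Arr A"
    show "amap (comp_ftor A right_ftor left_ftor) f = amap F f"
      using left_amap[OF Arr_hom[OF f]] right_amap[OF A.hom_Obj[OF Arr_hom[OF f]] yon_sections[OF Arr_hom[OF f]]]
        glue_yon[OF Arr_hom[OF f]] f by (simp add: amap_comp_ftor)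
  qed (simp add: comp_ftor_def)
qed simp

end

text \<open>The type of the intermediate category is written out because HOL has no quantification
  over types inside a formula; its arrows are the triples of \<open>fact_cat\<close>.\<close>

theorem theorem7p11:
  "(\<forall>(A :: ('o1, 'm1) rcat) (B :: ('o2, 'm2) rcat) (B' :: ('o3, 'm3) rcat) L K.
      localic A B L \<and> jr_iso B B' K \<longrightarrow> localic A B' (comp_ftor A K L)) \<and>
   (\<forall>(A' :: ('o1, 'm1) rcat) (A :: ('o2, 'm2) rcat) (B :: ('o3, 'm3) rcat) K L.
      jr_iso A' A K \<and> localic A B L \<longrightarrow> localic A' B (comp_ftor A' L K)) \<and>
   (\<forall>(A :: ('o1, 'm1) rcat) (B :: ('o2, 'm2) rcat) (B' :: ('o3, 'm3) rcat) H K.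
      hyperconnected A B H \<and> jr_iso B B' K \<longrightarrow> hyperconnected A B' (comp_ftor A K H)) \<and>
   (\<forall>(A' :: ('o1, 'm1) rcat) (A :: ('o2, 'm2) rcat) (B :: ('o3, 'm3) rcat) K H.
      jr_iso A' A K \<and> hyperconnected A B H \<longrightarrow> hyperconnected A' B (comp_ftor A' H K)) \<and>
   (\<forall>(A :: ('o1, 'm1) rcat) (B :: ('o2, 'm2) rcat) F.
      jr_functor A B F \<longrightarrow>
      (\<exists>(C :: ('o1, 'o1 \<times> ('m1 \<Rightarrow> 'm2) \<times> 'o1) rcat) L H.
         localic A C L \<and> hyperconnected C B H \<and> F = comp_ftor A H L)) \<and>
   (\<forall>(A :: ('o1, 'm1) rcat) (B :: ('o2, 'm2) rcat)
      (C :: ('o3, 'm3) rcat) (D :: ('o4, 'm4) rcat) F G L H.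
      jr_functor A C F \<and> jr_functor B D G \<and> localic A B L \<and> hyperconnected C D H \<and>
      comp_ftor A H F = comp_ftor A G L \<longrightarrow>
      (\<exists>!J. jr_functor B C J \<and> comp_ftor A J L = F \<and> comp_ftor B H J = G))"
proof (intro conjI allI impI; (elim conjE)?)
  fix A :: "('o1, 'm1) rcat" and B :: "('o2, 'm2) rcat" and F
  assume "jr_functor A B F"
  then interpret localic_part A B F
    by (intro localic_part.intro jr_mapI)
  show "\<exists>(C :: ('o1, 'o1 \<times> ('m1 \<Rightarrow> 'm2) \<times> 'o1) rcat) L H.
      localic A C L \<and> hyperconnected C B H \<and> F = comp_ftor A H L"
    using left_localic right_hyperconnected factorisation by metis
qed (rule localic_comp hyperconnected_comp localic_hyperconnected_lift; (assumption | erule jr_iso_localic jr_iso_hyperconnected))+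

end
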